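(* Let $\mathcal M=(V,E,F)$ be a locally finite map with $|V|\ge3$ and $|F|\ge3$, and let $G\le\mathrm{Aut}\,\mathcal M$ be such that $\mathcal M$ is $G$-vertex-rotary. Fix an arc $(\alpha,e)$; then $G_\alpha=\langle a\rangle$ is cyclic of order $k\lambda\ge3$ ($k$ the valency, $\lambda$ the edge-multiplicity), $G_e=\langle z\rangle$ with $|z|=2$, $(a,z)$ is a rotary pair for $G$, and the underlying graph is identified with $\mathrm{Cos}(G,\langle a\rangle,\langle z\rangle)$ via $\alpha=\langle a\rangle$, $e=\langle z\rangle$. Let $f,f'$ be the two faces incident with $e$, and choose the generator $a$ (replacing $a$ by $a^{-1}$ if necessary) so that $f^a=f'$. Then $z$ either interchanges $f$ and $f'$ or fixes both, and: (a) if $z$ interchanges $f$ and $f'$, then $|az|$ is finite and $\mathcal M$ is the $G$-rotary map $\mathrm{RotaMap}(G,a,z)$, with face-length $|az|$; (b) if $z$ fixes each of $f$ and $f'$, then $|zz^a|$ is finite and $\mathcal M$ is the $G$-bi-rotary map $\mathrm{BiRoMap}(G,a,z)$, with face-length $2|zz^a|$.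
   Context: A map $(V,E,F)$ is a 2-cell embedding of a connected locally finite graph (multiple edges allowed, no loops) in a surface, with all face-lengths finite; each face $f$ has a boundary cycle $C(f)$ (determined up to cyclic shift and reversal). $G\le\mathrm{Aut}\,\mathcal M$ makes $\mathcal M$ $G$-vertex-rotary if $G$ is arc-transitive and the stabiliser of each vertex induces a transitive cyclic group on its incident edges; $G$-rotary if moreover face stabilisers induce cyclic groups on boundary edges; $G$-bi-rotary if $G$-vertex-rotary but not face-rotary. A rotary pair is $(a,z)$ with $G=\langle a,z\rangle$, $|a|$ finite, $|z|=2$, $z\notin\langle a\rangle$. $\mathrm{RotaMap}(G,a,z)$ (for $|az|=m$ finite): vertices $[G:\langle a\rangle]$, edges $[G:\langle z\rangle]$, faces $[G:\langle az\rangle]$, incidence by non-empty intersection; face $\langle az\rangle g$ has boundary cycle $(e_0,\dots,e_{m-1})g$ with $e_i=\langle z\rangle(az)^i$; discs glued along these cycles. $\mathrm{BiRoMap}(G,a,z)$ (for $|zz^a|=\ell$ finite): same vertices and edges; faces are the cycles $C g$, $g\in G$, where $C=(e'_0,\dots,e'_{2\ell-1})$ with $e'_{2i}=\langle z\rangle(zz^a)^i$, $e'_{2i+1}=\langle z\rangle a(zz^a)^i$; edges/vertices incident with a face are those on the cycle; discs glued along these cycles.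
   Formalization: The generator a is additionally required to be a one-step rotation at α (e and e^a bound a common corner at α), and such an a with f^a=f' is shown to exist; f^a=f' alone does not suffice when a face meets α in several corners. *)

theory Defs
  imports "HOL-Algebra.Multiplicative_Group"
begin

section \<open>Combinatorial maps\<close>

text \<open>A map is given by its vertex, edge and face sets, the end-vertex function of edges
(no loops, multiple edges allowed), and for each face its boundary closed walk.
The boundary walk of a face is a list of pairs (v_i, e_i) meaning that the walk is
v_0 e_0 v_1 e_1 ... v_(n-1) e_(n-1) v_0, i.e. edge e_i joins v_i and v_(i+1 mod n).
The paper's boundary cycle C(f) is the edge sequence map snd (bwalk f); the vertices
record the corners of the face.\<close>

record ('v, 'e, 'f) pmap =
  verts :: "'v set"
  edges :: "'e set"
  faces :: "'f set"
  ends  :: "'e \<Rightarrow> 'v set"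
  bwalk :: "'f \<Rightarrow> ('v \<times> 'e) list"

definition edges_at :: "('v, 'e, 'f) pmap \<Rightarrow> 'v \<Rightarrow> 'e set" where
  "edges_at M v = {x \<in> edges M. v \<in> ends M x}"

definition nbrs :: "('v, 'e, 'f) pmap \<Rightarrow> 'v \<Rightarrow> 'v set" where
  "nbrs M v = {w. \<exists>x \<in> edges M. ends M x = {v, w} \<and> w \<noteq> v}"

definition face_edges :: "('v, 'e, 'f) pmap \<Rightarrow> 'f \<Rightarrow> 'e set" where
  "face_edges M f = snd ` set (bwalk M f)"

definition adj_rel :: "('v, 'e, 'f) pmap \<Rightarrow> ('v \<times> 'v) set" where
  "adj_rel M = {(u, w). \<exists>x \<in> edges M. ends M x = {u, w}}"

text \<open>Face-sides carrying an edge: occurrences (f,i) of the edge in boundary walks.\<close>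
definition sides :: "('v, 'e, 'f) pmap \<Rightarrow> 'e \<Rightarrow> ('f \<times> nat) set" where
  "sides M x = {(f, i). f \<in> faces M \<and> i < length (bwalk M f) \<and> snd (bwalk M f ! i) = x}"

text \<open>Corners at a vertex v: occurrences (f,i) with v_i = v; the corner lies between the
edges e_(i-1) and e_i of the walk.\<close>
definition corners :: "('v, 'e, 'f) pmap \<Rightarrow> 'v \<Rightarrow> ('f \<times> nat) set" where
  "corners M v = {(f, i). f \<in> faces M \<and> i < length (bwalk M f) \<and> fst (bwalk M f ! i) = v}"

definition corner_prev :: "('v, 'e, 'f) pmap \<Rightarrow> 'f \<times> nat \<Rightarrow> 'e" where
  "corner_prev M c = (let w = bwalk M (fst c); n = length w
                      in snd (w ! ((snd c + n - 1) mod n)))"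

definition corner_cur :: "('v, 'e, 'f) pmap \<Rightarrow> 'f \<times> nat \<Rightarrow> 'e" where
  "corner_cur M c = snd (bwalk M (fst c) ! snd c)"

definition closed_walk :: "('v, 'e, 'f) pmap \<Rightarrow> ('v \<times> 'e) list \<Rightarrow> bool" where
  "closed_walk M w \<longleftrightarrow> w \<noteq> [] \<and>
     (\<forall>i < length w. snd (w ! i) \<in> edges M \<and>
        ends M (snd (w ! i)) = {fst (w ! i), fst (w ! ((i + 1) mod length w))})"

text \<open>The map conditions: a connected locally finite loopless multigraph; every face is
bounded by a finite closed walk; discs glued along the boundary walks form a surface:
each edge lies on exactly two face-sides, and at each vertex the corners fit together
into a single cycle (the rotation at the vertex), so every vertex has a disc
neighbourhood.\<close>
definition is_map :: "('v, 'e, 'f) pmap \<Rightarrow> bool" where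
  "is_map M \<longleftrightarrow>
     (\<forall>x \<in> edges M. ends M x \<subseteq> verts M \<and> card (ends M x) = 2) \<and>
     (\<forall>v \<in> verts M. finite (edges_at M v)) \<and>
     (\<forall>u \<in> verts M. \<forall>w \<in> verts M. (u, w) \<in> (adj_rel M)\<^sup>*) \<and>
     (\<forall>f \<in> faces M. closed_walk M (bwalk M f)) \<and>
     (\<forall>x \<in> edges M. finite (sides M x) \<and> card (sides M x) = 2) \<and>
     (\<forall>v \<in> verts M. \<exists>rs \<kappa>. distinct rs \<and> set rs = edges_at M v \<and>
        bij_betw \<kappa> (corners M v) {..<length rs} \<and>
        (\<forall>c \<in> corners M v. {corner_prev M c, corner_cur M c} =
            {rs ! \<kappa> c, rs ! ((\<kappa> c + 1) mod length rs)}))"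

text \<open>Equality of closed walks up to cyclic shift and reversal.\<close>
definition rev_walk :: "('v \<times> 'e) list \<Rightarrow> ('v \<times> 'e) list" where
  "rev_walk w = (let n = length w in
     map (\<lambda>i. (fst (w ! ((n - i) mod n)), snd (w ! ((2 * n - i - 1) mod n)))) [0..<n])"

definition walk_equiv :: "('v \<times> 'e) list \<Rightarrow> ('v \<times> 'e) list \<Rightarrow> bool" where
  "walk_equiv w w' \<longleftrightarrow> (\<exists>k. w' = rotate k w \<or> w' = rotate k (rev_walk w))"

definition map_walk :: "('v \<Rightarrow> 'v2) \<Rightarrow> ('e \<Rightarrow> 'e2) \<Rightarrow> ('v \<times> 'e) list \<Rightarrow> ('v2 \<times> 'e2) list" where
  "map_walk \<phi>V \<phi>E w = map (\<lambda>(v, x). (\<phi>V v, \<phi>E x)) w"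

text \<open>Isomorphism of maps.\<close>
definition map_iso ::
  "('v, 'e, 'f) pmap \<Rightarrow> ('v2, 'e2, 'f2) pmap \<Rightarrow> ('v \<Rightarrow> 'v2) \<Rightarrow> ('e \<Rightarrow> 'e2) \<Rightarrow> ('f \<Rightarrow> 'f2) \<Rightarrow> bool" where
  "map_iso M N \<phi>V \<phi>E \<phi>F \<longleftrightarrow>
     bij_betw \<phi>V (verts M) (verts N) \<and> bij_betw \<phi>E (edges M) (edges N) \<and>
     bij_betw \<phi>F (faces M) (faces N) \<and>
     (\<forall>x \<in> edges M. ends N (\<phi>E x) = \<phi>V ` ends M x) \<and>
     (\<forall>f \<in> faces M. walk_equiv (map_walk \<phi>V \<phi>E (bwalk M f)) (bwalk N (\<phi>F f)))"

section \<open>Groups of automorphisms\<close>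

text \<open>G \<le> Aut M is encoded as an abstract group G acting faithfully on the right
(x^(gh) = (x^g)^h) on vertices, edges and faces, every element acting as a map
automorphism (preserving incidence of vertices and edges and boundary walks).\<close>
definition aut_action ::
  "('v, 'e, 'f) pmap \<Rightarrow> ('g, 'b) monoid_scheme \<Rightarrow>
   ('v \<Rightarrow> 'g \<Rightarrow> 'v) \<Rightarrow> ('e \<Rightarrow> 'g \<Rightarrow> 'e) \<Rightarrow> ('f \<Rightarrow> 'g \<Rightarrow> 'f) \<Rightarrow> bool" where
  "aut_action M G aV aE aF \<longleftrightarrow> group G \<and>
     (\<forall>g \<in> carrier G. (\<forall>v \<in> verts M. aV v g \<in> verts M) \<and>
        (\<forall>x \<in> edges M. aE x g \<in> edges M) \<and> (\<forall>f \<in> faces M. aF f g \<in> faces M)) \<and>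
     (\<forall>v \<in> verts M. aV v \<one>\<^bsub>G\<^esub> = v) \<and> (\<forall>x \<in> edges M. aE x \<one>\<^bsub>G\<^esub> = x) \<and>
     (\<forall>f \<in> faces M. aF f \<one>\<^bsub>G\<^esub> = f) \<and>
     (\<forall>g \<in> carrier G. \<forall>h \<in> carrier G.
        (\<forall>v \<in> verts M. aV (aV v g) h = aV v (g \<otimes>\<^bsub>G\<^esub> h)) \<and>
        (\<forall>x \<in> edges M. aE (aE x g) h = aE x (g \<otimes>\<^bsub>G\<^esub> h)) \<and>
        (\<forall>f \<in> faces M. aF (aF f g) h = aF f (g \<otimes>\<^bsub>G\<^esub> h))) \<and>
     (\<forall>g \<in> carrier G. \<forall>x \<in> edges M. ends M (aE x g) = (\<lambda>v. aV v g) ` ends M x) \<and>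
     (\<forall>g \<in> carrier G. \<forall>f \<in> faces M.
        walk_equiv (map_walk (\<lambda>v. aV v g) (\<lambda>x. aE x g) (bwalk M f)) (bwalk M (aF f g))) \<and>
     (\<forall>g \<in> carrier G. (\<forall>v \<in> verts M. aV v g = v) \<and> (\<forall>x \<in> edges M. aE x g = x) \<and>
        (\<forall>f \<in> faces M. aF f g = f) \<longrightarrow> g = \<one>\<^bsub>G\<^esub>)"

definition stab :: "('g, 'b) monoid_scheme \<Rightarrow> ('x \<Rightarrow> 'g \<Rightarrow> 'x) \<Rightarrow> 'x \<Rightarrow> 'g set" where
  "stab G act x = {g \<in> carrier G. act x g = x}"

text \<open>The group induced by a subgroup H on a set X is cyclic (generated by the image of h),
resp. cyclic and transitive.\<close>
definition induces_cyclic ::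
  "('g, 'b) monoid_scheme \<Rightarrow> ('x \<Rightarrow> 'g \<Rightarrow> 'x) \<Rightarrow> 'g set \<Rightarrow> 'x set \<Rightarrow> bool" where
  "induces_cyclic G act H X \<longleftrightarrow>
     (\<exists>h \<in> H. \<forall>g \<in> H. \<exists>i::int. \<forall>x \<in> X. act x g = act x (h [^]\<^bsub>G\<^esub> i))"

definition induces_transitive ::
  "('x \<Rightarrow> 'g \<Rightarrow> 'x) \<Rightarrow> 'g set \<Rightarrow> 'x set \<Rightarrow> bool" where
  "induces_transitive act H X \<longleftrightarrow> (\<forall>x \<in> X. \<forall>y \<in> X. \<exists>g \<in> H. act x g = y)"

definition arc_transitive ::
  "('v, 'e, 'f) pmap \<Rightarrow> ('g, 'b) monoid_scheme \<Rightarrow> ('v \<Rightarrow> 'g \<Rightarrow> 'v) \<Rightarrow> ('e \<Rightarrow> 'g \<Rightarrow> 'e) \<Rightarrow> bool" where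
  "arc_transitive M G aV aE \<longleftrightarrow>
     (\<forall>v \<in> verts M. \<forall>x \<in> edges_at M v. \<forall>v' \<in> verts M. \<forall>x' \<in> edges_at M v'.
        \<exists>g \<in> carrier G. aV v g = v' \<and> aE x g = x')"

definition vertex_rotary ::
  "('v, 'e, 'f) pmap \<Rightarrow> ('g, 'b) monoid_scheme \<Rightarrow>
   ('v \<Rightarrow> 'g \<Rightarrow> 'v) \<Rightarrow> ('e \<Rightarrow> 'g \<Rightarrow> 'e) \<Rightarrow> ('f \<Rightarrow> 'g \<Rightarrow> 'f) \<Rightarrow> bool" where
  "vertex_rotary M G aV aE aF \<longleftrightarrow> aut_action M G aV aE aF \<and> arc_transitive M G aV aE \<and>
     (\<forall>v \<in> verts M. induces_cyclic G aE (stab G aV v) (edges_at M v) \<and>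
                    induces_transitive aE (stab G aV v) (edges_at M v))"

definition face_rotary ::
  "('v, 'e, 'f) pmap \<Rightarrow> ('g, 'b) monoid_scheme \<Rightarrow> ('e \<Rightarrow> 'g \<Rightarrow> 'e) \<Rightarrow> ('f \<Rightarrow> 'g \<Rightarrow> 'f) \<Rightarrow> bool" where
  "face_rotary M G aE aF \<longleftrightarrow>
     (\<forall>f \<in> faces M. induces_cyclic G aE (stab G aF f) (face_edges M f))"

definition G_rotary where
  "G_rotary M G aV aE aF \<longleftrightarrow> vertex_rotary M G aV aE aF \<and> face_rotary M G aE aF"

definition G_birotary where
  "G_birotary M G aV aE aF \<longleftrightarrow> vertex_rotary M G aV aE aF \<and> \<not> face_rotary M G aE aF"

section \<open>Rotary pairs and the coset constructions\<close>

definition rotary_pair :: "('g, 'b) monoid_scheme \<Rightarrow> 'g \<Rightarrow> 'g \<Rightarrow> bool" where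
  "rotary_pair G a z \<longleftrightarrow> a \<in> carrier G \<and> z \<in> carrier G \<and>
     generate G {a, z} = carrier G \<and> group.ord G a \<noteq> 0 \<and> group.ord G z = 2 \<and>
     z \<notin> generate G {a}"

text \<open>The coset graph Cos(G, <a>, <z>): vertices right cosets of <a>, edges right cosets
of <z>, incidence = non-empty intersection.\<close>
definition cos_ends :: "('g, 'b) monoid_scheme \<Rightarrow> 'g \<Rightarrow> 'g set \<Rightarrow> 'g set set" where
  "cos_ends G a X = {Y \<in> rcosets\<^bsub>G\<^esub> (generate G {a}). Y \<inter> X \<noteq> {}}"

definition conj_by :: "('g, 'b) monoid_scheme \<Rightarrow> 'g \<Rightarrow> 'g \<Rightarrow> 'g" where
  "conj_by G z a = inv\<^bsub>G\<^esub> a \<otimes>\<^bsub>G\<^esub> z \<otimes>\<^bsub>G\<^esub> a"  \<comment> \<open>z^a\<close>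

definition rep :: "'g set \<Rightarrow> 'g" where
  "rep X = (SOME g. g \<in> X)"

text \<open>RotaMap(G,a,z): faces are right cosets of <az>; the face <az>g has boundary cycle
(e_0,...,e_(m-1))g, e_i = <z>(az)^i, m = |az|; the vertex between e_(i-1) and e_i is
<a>(az)^i g.\<close>
definition RotaMap :: "('g, 'b) monoid_scheme \<Rightarrow> 'g \<Rightarrow> 'g \<Rightarrow> ('g set, 'g set, 'g set) pmap" where
  "RotaMap G a z =
     (let t = a \<otimes>\<^bsub>G\<^esub> z; m = group.ord G t; H = generate G {t} in
      \<lparr> verts = rcosets\<^bsub>G\<^esub> (generate G {a}),
        edges = rcosets\<^bsub>G\<^esub> (generate G {z}),
        faces = rcosets\<^bsub>G\<^esub> H,
        ends = cos_ends G a,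
        bwalk = (\<lambda>X. let g = (SOME g. g \<in> carrier G \<and> X = H #>\<^bsub>G\<^esub> g) in
                   map (\<lambda>i. (generate G {a} #>\<^bsub>G\<^esub> (t [^]\<^bsub>G\<^esub> i \<otimes>\<^bsub>G\<^esub> g),
                              generate G {z} #>\<^bsub>G\<^esub> (t [^]\<^bsub>G\<^esub> i \<otimes>\<^bsub>G\<^esub> g))) [0..<m]) \<rparr>)"

text \<open>BiRoMap(G,a,z): with w = z z^a and l = |w|, the cycle C has edges
e'_(2i) = <z>w^i, e'_(2i+1) = <z>a w^i; the vertex before e'_(2i) is <a>z w^i and the
vertex before e'_(2i+1) is <a>w^i. Faces are the distinct cycles Cg (g in G), where
cycles are taken up to cyclic shift and reversal; a face is represented by the set of
all g giving that cycle.\<close>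
definition BiRo_cycle :: "('g, 'b) monoid_scheme \<Rightarrow> 'g \<Rightarrow> 'g \<Rightarrow> 'g \<Rightarrow> ('g set \<times> 'g set) list" where
  "BiRo_cycle G a z g =
     (let w = z \<otimes>\<^bsub>G\<^esub> conj_by G z a; l = group.ord G w;
          A = generate G {a}; Z = generate G {z} in
      concat (map (\<lambda>i. [(A #>\<^bsub>G\<^esub> (z \<otimes>\<^bsub>G\<^esub> w [^]\<^bsub>G\<^esub> i \<otimes>\<^bsub>G\<^esub> g), Z #>\<^bsub>G\<^esub> (w [^]\<^bsub>G\<^esub> i \<otimes>\<^bsub>G\<^esub> g)),
                         (A #>\<^bsub>G\<^esub> (w [^]\<^bsub>G\<^esub> i \<otimes>\<^bsub>G\<^esub> g), Z #>\<^bsub>G\<^esub> (a \<otimes>\<^bsub>G\<^esub> w [^]\<^bsub>G\<^esub> i \<otimes>\<^bsub>G\<^esub> g))])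
                  [0..<l]))"

definition BiRoMap :: "('g, 'b) monoid_scheme \<Rightarrow> 'g \<Rightarrow> 'g \<Rightarrow> ('g set, 'g set, 'g set) pmap" where
  "BiRoMap G a z =
     \<lparr> verts = rcosets\<^bsub>G\<^esub> (generate G {a}),
       edges = rcosets\<^bsub>G\<^esub> (generate G {z}),
       faces = (\<lambda>g. {h \<in> carrier G. walk_equiv (BiRo_cycle G a z g) (BiRo_cycle G a z h)}) ` carrier G,
       ends = cos_ends G a,
       bwalk = (\<lambda>X. BiRo_cycle G a z (rep X)) \<rparr>"

text \<open>The identification of the underlying graph with Cos(G,<a>,<z>) via
alpha^g \<mapsto> <a>g and e^g \<mapsto> <z>g.\<close>
definition cos_identification ::
  "('v, 'e, 'f) pmap \<Rightarrow> ('g, 'b) monoid_scheme \<Rightarrow> ('v \<Rightarrow> 'g \<Rightarrow> 'v) \<Rightarrow> ('e \<Rightarrow> 'g \<Rightarrow> 'e) \<Rightarrow>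
   'v \<Rightarrow> 'e \<Rightarrow> 'g \<Rightarrow> 'g \<Rightarrow> ('v \<Rightarrow> 'g set) \<Rightarrow> ('e \<Rightarrow> 'g set) \<Rightarrow> bool" where
  "cos_identification M G aV aE \<alpha> e a z \<phi>V \<phi>E \<longleftrightarrow>
     bij_betw \<phi>V (verts M) (rcosets\<^bsub>G\<^esub> (generate G {a})) \<and>
     bij_betw \<phi>E (edges M) (rcosets\<^bsub>G\<^esub> (generate G {z})) \<and>
     (\<forall>g \<in> carrier G. \<phi>V (aV \<alpha> g) = generate G {a} #>\<^bsub>G\<^esub> g \<and>
                      \<phi>E (aE e g) = generate G {z} #>\<^bsub>G\<^esub> g) \<and>
     (\<forall>x \<in> edges M. \<phi>V ` ends M x = cos_ends G a (\<phi>E x))"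

text \<open>a is a one-step rotation at alpha: e and e^a are consecutive in the local rotation
at alpha, i.e. they bound a common corner at alpha.\<close>
definition rot_step :: "('v, 'e, 'f) pmap \<Rightarrow> ('e \<Rightarrow> 'g \<Rightarrow> 'e) \<Rightarrow> 'v \<Rightarrow> 'e \<Rightarrow> 'g \<Rightarrow> bool" where
  "rot_step M aE \<alpha> e a \<longleftrightarrow>
     (\<exists>c \<in> corners M \<alpha>. {corner_prev M c, corner_cur M c} = {e, aE e a})"

end

theory Submission
  imports Defs
begin

text \<open>A flag-fixing automorphism is trivial: since all valencies are at least 3, a corner is
determined by its two edges, and since every edge lies on two different faces, the boundary walk
of a face passes each of its edges once, so fixing two consecutive edges at a vertex propagates
over the whole map. Hence \<open>G\<^sub>\<alpha>\<close> acts regularly on the edges at \<open>\<alpha>\<close>, and a one-step rotation \<open>a\<close>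
generates it. The two faces at \<open>e\<close> are the face \<open>F0\<close> of the corner \<open>(e, \<alpha>, e\<^sup>a)\<close> and \<open>F1\<close>, its image
under the inverse of \<open>a\<close>. If \<open>z\<close> swaps them, \<open>az\<close> fixes \<open>F1\<close> and shifts its
boundary by one step; if \<open>z\<close> fixes both, \<open>z\<close> and \<open>z\<^sup>a\<close> are reflections of \<open>F0\<close> in two consecutive
edges, and \<open>zz\<^sup>a\<close> shifts its boundary by two steps. In both cases the boundary walk is traced out
by the images of one corner, which is the boundary cycle of the coset construction.\<close>

section \<open>Walks as periodic sequences\<close>

text \<open>The bound |F| >= 3 excludes valency at most 2, where one corner already meets every edge
  of its vertex and the two faces at an edge would carry the whole graph. The bound |V| >= 3
  excludes that a and z commute; in that case z^a = z and the two reflections of a face in the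
  bi-rotary case would be the same. Being vertex-rotary speaks only of the group induced on the
  edges at a vertex. Rigidity is what upgrades this to a statement about the stabiliser itself.
  Boundary walks are given only up to shift and reversal, so lists are replaced by periodic
  sequences indexed by the integers, on which these operations become j -> j + k and j -> k - j. The
  orders of az and zz^a are never computed from relations: powers of the element and positions on a
  face walk are shown to have the same periods, so finiteness of the order is inherited from the
  finite length of a face. That the coset constructions are maps is likewise not verified on cosets
  but transported along the isomorphism.\<close>

definition wlk :: "'a list \<Rightarrow> int \<Rightarrow> 'a" where
  "wlk w j = w ! nat (j mod int (length w))"

text \<open>In a closed walk \<open>ed w j\<close> joins \<open>vt w j\<close> to
  \<open>vt w (j + 1)\<close>, so the corner at index \<open>j\<close> lies between
  \<open>ed w (j - 1)\<close> and \<open>ed w j\<close>.\<close>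

abbreviation vt :: "('v \<times> 'e) list \<Rightarrow> int \<Rightarrow> 'v" where "vt w j \<equiv> fst (wlk w j)"
abbreviation ed :: "('v \<times> 'e) list \<Rightarrow> int \<Rightarrow> 'e" where "ed w j \<equiv> snd (wlk w j)"

lemma wlk_cong: "i mod int (length w) = j mod int (length w) \<Longrightarrow> wlk w i = wlk w j"
  by (simp add: wlk_def)

lemma wlk_nth: "i < length w \<Longrightarrow> wlk w (int i) = w ! i"
  by (simp add: wlk_def)

lemma wlk_in_set: "w \<noteq> [] \<Longrightarrow> wlk w j \<in> set w"
  by (simp add: wlk_def nat_less_iff)

lemma wlk_nat_index:
  assumes "w \<noteq> []"
  obtains i where "i < length w" "wlk w j = w ! i" "j mod int (length w) = int i"
  using assms that[of "nat (j mod int (length w))"] by (simp add: wlk_def nat_less_iff)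

lemma wlk_rotate:
  assumes "w \<noteq> []"
  shows "wlk (rotate k w) j = wlk w (j + int k)"
proof -
  let ?n = "int (length w)"
  have n: "?n > 0" using assms by simp
  have "nat (j mod ?n) < length w" using n by (simp add: nat_less_iff)
  then have "wlk (rotate k w) j = w ! ((k + nat (j mod ?n)) mod length w)"
    by (simp add: wlk_def nth_rotate)
  also have "(k + nat (j mod ?n)) mod length w = nat ((j + int k) mod ?n)"
  proof -
    have "int ((k + nat (j mod ?n)) mod length w) = (j + int k) mod ?n"
      using n by (simp add: zmod_int mod_simps add.commute)
    then show ?thesis by linarith
  qed
  finally show ?thesis by (simp add: wlk_def)
qed

lemma length_rev_walk [simp]: "length (rev_walk w) = length w"
  by (simp add: rev_walk_def Let_def)

text \<open>Walking backwards, vertex \<open>- j\<close> is left along the edge that precedes it in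
  \<open>w\<close>, which has index \<open>- j - 1\<close>. Vertices are thus reflected about 0 and
  edges about -1/2, an offset that recurs in every reversal below.\<close>

lemma wlk_rev_walk:
  assumes "w \<noteq> []"
  shows "wlk (rev_walk w) j = (vt w (- j), ed w (- j - 1))"
proof -
  let ?n = "int (length w)"
  define i where "i = nat (j mod ?n)"
  have n: "?n > 0" using assms by simp
  have i: "i < length w" "int i = j mod ?n" using n by (simp_all add: i_def nat_less_iff)
  have "int ((length w - i) mod length w) = (?n - j mod ?n) mod ?n"
    using i by (simp add: zmod_int of_nat_diff)
  also have "\<dots> = (- j) mod ?n" by (simp add: mod_simps)
  finally have 1: "(length w - i) mod length w = nat ((- j) mod ?n)" by linarith
  have "int ((2 * length w - i - 1) mod length w) = (2 * ?n - j mod ?n - 1) mod ?n"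
    using i by (simp add: zmod_int of_nat_diff algebra_simps)
  also have "\<dots> = (?n + (?n - j - 1)) mod ?n"
    by (metis (no_types, opaque_lifting) add_diff_eq mod_diff_left_eq mod_diff_right_eq mult_2)
  also have "\<dots> = (- j - 1) mod ?n"
    by (metis (no_types, lifting) add_diff_eq diff_add_eq mod_add_self1 uminus_add_conv_diff add.commute diff_0)
  finally have 2: "(2 * length w - i - 1) mod length w = nat ((- j - 1) mod ?n)" by linarith
  have "wlk (rev_walk w) j = rev_walk w ! i" by (simp add: wlk_def i_def)
  also have "\<dots> = (fst (w ! ((length w - i) mod length w)), snd (w ! ((2 * length w - i - 1) mod length w)))"
    using i by (simp add: rev_walk_def Let_def)
  finally show ?thesis unfolding 1 2 wlk_def by simp
qed

lemma wlk_eqI: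
  assumes "length w = length w'" "\<And>j. wlk w j = wlk w' j"
  shows "w = w'"
  using assms by (metis nth_equalityI wlk_nth)

lemma wlk_map: "w \<noteq> [] \<Longrightarrow> wlk (map h w) j = h (wlk w j)"
  by (simp add: wlk_def nat_less_iff)

text \<open>Shifts and reflections of the integers compose more easily than list rotations; a
  rotation applied after the reversal only moves the centre of the reflection.\<close>

lemma walk_equiv_iff:
  assumes "w \<noteq> []"
  shows "walk_equiv w w' \<longleftrightarrow> length w' = length w \<and>
    ((\<exists>k. \<forall>j. wlk w' j = wlk w (j + k)) \<or>
     (\<exists>k. \<forall>j. wlk w' j = (vt w (k - j), ed w (k - j - 1))))" (is "_ \<longleftrightarrow> ?R")
proof
  let ?n = "int (length w)"
  have n: "?n > 0" using assms by simp
  have r: "rev_walk w \<noteq> []" using assms by (metis length_0_conv length_rev_walk)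
  have rr: "wlk (rotate k (rev_walk w)) j = (vt w (- int k - j), ed w (- int k - j - 1))" for k j
  proof -
    have "- (j + int k) = - int k - j" by simp
    then show ?thesis by (simp only: wlk_rotate[OF r] wlk_rev_walk[OF assms])
  qed
  {
    assume "walk_equiv w w'"
    then obtain k where "w' = rotate k w \<or> w' = rotate k (rev_walk w)"
      unfolding walk_equiv_def by blast
    then show ?R
    proof
      assume "w' = rotate k w"
      then show ?R using wlk_rotate[OF assms] by auto
    next
      assume w': "w' = rotate k (rev_walk w)"
      then have "\<forall>j. wlk w' j = (vt w (- int k - j), ed w (- int k - j - 1))"
        using rr by simp
      then show ?R using w' by auto
    qed
  }
  assume R: ?R
  then consider k where "\<forall>j. wlk w' j = wlk w (j + k)"
    | k where "\<forall>j. wlk w' j = (vt w (k - j), ed w (k - j - 1))" by blast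
  then show "walk_equiv w w'"
  proof cases
    case 1
    have "w' = rotate (nat (k mod ?n)) w"
    proof (rule wlk_eqI)
      fix j
      have "wlk w (j + k) = wlk w (j + int (nat (k mod ?n)))"
        by (rule wlk_cong) (use n in \<open>simp add: mod_simps\<close>)
      then show "wlk w' j = wlk (rotate (nat (k mod ?n)) w) j"
        using 1 by (simp add: wlk_rotate[OF assms])
    qed (use R in simp)
    then show ?thesis unfolding walk_equiv_def by blast
  next
    case 2
    \<comment> \<open>Reversing and then rotating by \<open>k'\<close> reads \<open>w\<close> at
      \<open>- k' - j\<close>, so \<open>k'\<close> must be the natural residue of
      \<open>- k\<close>.\<close>
    define k' where "k' = nat ((- k) mod ?n)"
    have k': "int k' = (- k) mod ?n" using n by (simp add: k'_def)
    have m: "(k - i) mod ?n = (- int k' - i) mod ?n" for i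
    proof -
      have "(- int k' - i) mod ?n = (- (- k) - i) mod ?n"
        unfolding k' by (metis mod_diff_cong mod_minus_eq)
      then show ?thesis by simp
    qed
    have "w' = rotate k' (rev_walk w)"
    proof (rule wlk_eqI)
      fix j
      have "wlk w (k - j) = wlk w (- int k' - j)" by (rule wlk_cong) (rule m)
      moreover have "wlk w (k - j - 1) = wlk w (- int k' - j - 1)"
        using wlk_cong[OF m[of "j + 1"]] by (simp add: algebra_simps)
      ultimately show "wlk w' j = wlk (rotate k' (rev_walk w)) j"
        using 2 by (simp add: rr)
    qed (use R in simp)
    then show ?thesis unfolding walk_equiv_def by blast
  qed
qed

section \<open>Equivalence of closed walks and its invariants\<close>

lemma walk_equiv_length: "walk_equiv w w' \<Longrightarrow> length w' = length w"
  unfolding walk_equiv_def by auto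

lemma walk_equiv_trans:
  assumes "w \<noteq> []" "walk_equiv w w'" "walk_equiv w' w''"
  shows "walk_equiv w w''"
proof -
  have w': "w' \<noteq> []" using assms walk_equiv_length[OF assms(2)] by auto
  note 1 = assms(2)[unfolded walk_equiv_iff[OF assms(1)]]
  note 2 = assms(3)[unfolded walk_equiv_iff[OF w']]
  from 1 consider k where "\<forall>j. wlk w' j = wlk w (j + k)"
    | k where "\<forall>j. wlk w' j = (vt w (k - j), ed w (k - j - 1))" by blast
  then have "(\<exists>k. \<forall>j. wlk w'' j = wlk w (j + k)) \<or>
     (\<exists>k. \<forall>j. wlk w'' j = (vt w (k - j), ed w (k - j - 1)))"
  proof cases
    case a: 1
    from 2 consider l where "\<forall>j. wlk w'' j = wlk w' (j + l)"
      | l where "\<forall>j. wlk w'' j = (vt w' (l - j), ed w' (l - j - 1))" by blast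
    then show ?thesis
    proof cases
      case 1
      have "\<forall>j. wlk w'' j = wlk w (j + (l + k))" using 1 a by (simp add: algebra_simps)
      then show ?thesis by blast
    next
      case 2
      have "\<forall>j. wlk w'' j = (vt w (l + k - j), ed w (l + k - j - 1))"
        using 2 a by (simp add: algebra_simps)
      then show ?thesis by blast
    qed
  next
    case b: 2
    from 2 consider l where "\<forall>j. wlk w'' j = wlk w' (j + l)"
      | l where "\<forall>j. wlk w'' j = (vt w' (l - j), ed w' (l - j - 1))" by blast
    then show ?thesis
    proof cases
      case 1
      have "\<forall>j. wlk w'' j = (vt w (k - l - j), ed w (k - l - j - 1))"
        using 1 b by (simp add: algebra_simps)
      then show ?thesis by blast
    next
      case 2
      have "\<forall>j. wlk w'' j = wlk w (j + (k - l))"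
        using 2 b by (simp add: algebra_simps)
      then show ?thesis by blast
    qed
  qed
  then show ?thesis using 1 2 walk_equiv_iff[OF assms(1)] by auto
qed

text \<open>A shift is undone by the opposite shift and a reflection by itself; on edges the two
  offsets -1 cancel.\<close>

lemma walk_equiv_sym:
  assumes "w \<noteq> []" "walk_equiv w w'"
  shows "walk_equiv w' w"
proof -
  have w': "w' \<noteq> []" using assms walk_equiv_length[OF assms(2)] by auto
  note 1 = assms(2)[unfolded walk_equiv_iff[OF assms(1)]]
  then consider k where "\<forall>j. wlk w' j = wlk w (j + k)"
    | k where "\<forall>j. wlk w' j = (vt w (k - j), ed w (k - j - 1))" by blast
  then have "(\<exists>k. \<forall>j. wlk w j = wlk w' (j + k)) \<or>
     (\<exists>k. \<forall>j. wlk w j = (vt w' (k - j), ed w' (k - j - 1)))"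
  proof cases
    case 1
    then have "\<forall>j. wlk w j = wlk w' (j + (- k))" by simp
    then show ?thesis by blast
  next
    case 2
    then have "\<forall>j. wlk w j = (vt w' (k - j), ed w' (k - j - 1))" by simp
    then show ?thesis by blast
  qed
  then show ?thesis using 1 walk_equiv_iff[OF w'] by auto
qed

lemma walk_equiv_map_walk:
  assumes "w \<noteq> []" "walk_equiv w w'"
  shows "walk_equiv (map_walk p q w) (map_walk p q w')"
proof -
  have w': "w' \<noteq> []" using assms walk_equiv_length[OF assms(2)] by auto
  have m: "map_walk p q w \<noteq> []" using assms by (simp add: map_walk_def)
  show ?thesis
    using assms(2) unfolding walk_equiv_iff[OF m] walk_equiv_iff[OF assms(1)]
    by (fastforce simp: map_walk_def wlk_map w' assms(1) case_prod_unfold)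
qed

lemma walk_equiv_edges:
  assumes "w \<noteq> []" "walk_equiv w w'"
  shows "snd ` set w' = snd ` set w"
proof -
  have *: "snd ` set w' \<subseteq> snd ` set w" if w: "w \<noteq> []" and we: "walk_equiv w w'" for w w' :: "('x \<times> 'y) list"
  proof
    fix x assume "x \<in> snd ` set w'"
    then obtain i where i: "i < length w'" "x = snd (w' ! i)" by (auto simp: in_set_conv_nth)
    then have "x = ed w' (int i)" by (simp add: wlk_nth)
    then have "\<exists>j. x = ed w j" using we unfolding walk_equiv_iff[OF w] by auto
    then show "x \<in> snd ` set w" using wlk_in_set[OF w] by auto
  qed
  have "w' \<noteq> []" using assms walk_equiv_length[OF assms(2)] by auto
  then show ?thesis using *[OF assms] *[OF _ walk_equiv_sym[OF assms]] by blast
qed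

definition corner_in :: "('v \<times> 'e) list \<Rightarrow> 'e \<Rightarrow> 'v \<Rightarrow> 'e \<Rightarrow> bool" where
  "corner_in w x v y \<longleftrightarrow> (\<exists>j. vt w j = v \<and>
     (x = ed w (j - 1) \<and> y = ed w j \<or> x = ed w j \<and> y = ed w (j - 1)))"

lemma corner_in_sym: "corner_in w x v y \<Longrightarrow> corner_in w y v x"
  unfolding corner_in_def by blast

lemma corner_in_equiv:
  assumes "w \<noteq> []" "walk_equiv w w'" "corner_in w x v y"
  shows "corner_in w' x v y"
proof -
  have w': "w' \<noteq> []" using assms walk_equiv_length[OF assms(2)] by auto
  obtain j where j: "vt w j = v"
     "x = ed w (j - 1) \<and> y = ed w j \<or> x = ed w j \<and> y = ed w (j - 1)"
    using assms(3) unfolding corner_in_def by blast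
  have "walk_equiv w' w" by (rule walk_equiv_sym[OF assms(1,2)])
  then consider k where "\<forall>j. wlk w j = wlk w' (j + k)"
    | k where "\<forall>j. wlk w j = (vt w' (k - j), ed w' (k - j - 1))"
    unfolding walk_equiv_iff[OF w'] by blast
  then show ?thesis
  proof cases
    case 1
    then show ?thesis
      using j unfolding corner_in_def by (intro exI[of _ "j + k"]) (auto simp: algebra_simps)
  next
    case 2
    then show ?thesis
      using j unfolding corner_in_def by (intro exI[of _ "k - j"]) (auto simp: algebra_simps)
  qed
qed

lemma corner_in_map_walk:
  assumes "w \<noteq> []"
  shows "corner_in (map_walk p q w) x' v' y' \<longleftrightarrow>
    (\<exists>x v y. corner_in w x v y \<and> x' = q x \<and> v' = p v \<and> y' = q y)"
  using assms unfolding corner_in_def map_walk_def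
  by (simp add: wlk_map case_prod_unfold) blast

text \<open>The edges of \<open>w\<close> being distinct, a sequence that stays on corners of \<open>w\<close>
and never steps back to the vertex it came from can only run through \<open>w\<close>,
forwards or backwards.\<close>
lemma corner_sequence_follows_walk:
  fixes w :: "('v \<times> 'e) list" and s :: "nat \<Rightarrow> 'v \<times> 'e"
  assumes w: "w \<noteq> []"
    and inj: "\<And>i j. ed w i = ed w j \<Longrightarrow> i mod int (length w) = j mod int (length w)"
    and start: "corner_in w x (fst (s 0)) (snd (s 0))"
    and step: "\<And>j. corner_in w (snd (s j)) (fst (s (Suc j))) (snd (s (Suc j)))"
    and neq: "\<And>j. fst (s j) \<noteq> fst (s (Suc j))"
  shows "(\<exists>k. \<forall>j. s j = wlk w (int j + k)) \<or>
         (\<exists>k. \<forall>j. s j = (vt w (k - int j), ed w (k - int j - 1)))"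
proof -
  \<comment> \<open>An edge of \<open>w\<close> determines its index modulo the length, hence also
    everything at a fixed distance from it.\<close>
  have same: "ed w i = ed w j \<Longrightarrow> wlk w (i + d) = wlk w (j + d)" for i j d
    by (rule wlk_cong) (metis inj mod_add_left_eq)
  obtain k where k: "vt w k = fst (s 0)" "snd (s 0) = ed w k \<or> snd (s 0) = ed w (k - 1)"
    using start unfolding corner_in_def by blast
  from k(2) show ?thesis
  proof
    assume k0: "snd (s 0) = ed w k"
    have "s j = wlk w (int j + k)" for j
    proof (induction j)
      case 0
      then show ?case using k k0 by (simp add: prod_eq_iff)
    next
      case (Suc j)
      obtain i where i: "vt w i = fst (s (Suc j))"
        "snd (s j) = ed w (i - 1) \<and> snd (s (Suc j)) = ed w i \<or>
         snd (s j) = ed w i \<and> snd (s (Suc j)) = ed w (i - 1)"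
        using step[of j] unfolding corner_in_def by blast
      from i(2) show ?case
      proof
        assume a: "snd (s j) = ed w (i - 1) \<and> snd (s (Suc j)) = ed w i"
        then have "ed w (i - 1) = ed w (int j + k)" using Suc by simp
        from same[OF this, of 1] have "wlk w i = wlk w (int (Suc j) + k)"
          by (simp add: algebra_simps)
        then show ?case using a i by (simp add: prod_eq_iff)
      next
        \<comment> \<open>The corner is read against the direction of travel: its vertex would be
          the one just left, which \<open>neq\<close> forbids.\<close>
        assume a: "snd (s j) = ed w i \<and> snd (s (Suc j)) = ed w (i - 1)"
        then have "ed w i = ed w (int j + k)" using Suc by simp
        from same[OF this, of 0] have "fst (s (Suc j)) = fst (s j)" using i Suc by simp
        then show ?case using neq[of j] by simp
      qed
    qed
    then show ?thesis by blast
  next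
    assume k0: "snd (s 0) = ed w (k - 1)"
    have "s j = (vt w (k - int j), ed w (k - int j - 1))" for j
    proof (induction j)
      case 0
      then show ?case using k k0 by (simp add: prod_eq_iff)
    next
      case (Suc j)
      obtain i where i: "vt w i = fst (s (Suc j))"
        "snd (s j) = ed w (i - 1) \<and> snd (s (Suc j)) = ed w i \<or>
         snd (s j) = ed w i \<and> snd (s (Suc j)) = ed w (i - 1)"
        using step[of j] unfolding corner_in_def by blast
      from i(2) show ?case
      proof
        assume a: "snd (s j) = ed w (i - 1) \<and> snd (s (Suc j)) = ed w i"
        then have "ed w (i - 1) = ed w (k - int j - 1)" using Suc by simp
        from same[OF this, of 1] have "fst (s (Suc j)) = fst (s j)" using i Suc by simp
        then show ?case using neq[of j] by simp
      next
        assume a: "snd (s j) = ed w i \<and> snd (s (Suc j)) = ed w (i - 1)"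
        then have *: "ed w i = ed w (k - int j - 1)" using Suc by simp
        have "wlk w i = wlk w (k - int (Suc j))" using same[OF *, of 0]
          by (simp add: algebra_simps)
        moreover have "wlk w (i - 1) = wlk w (k - int (Suc j) - 1)"
          using same[OF *, of "- 1"] by (simp add: algebra_simps)
        ultimately show ?case using a i by (simp add: prod_eq_iff)
      qed
    qed
    then show ?thesis by blast
  qed
qed

text \<open>The last two claims pin down the period of \<open>s\<close>: it is the length of
  \<open>w\<close>, and the return of a single edge already detects it. This is what later equates
  face lengths with orders of group elements.\<close>

lemma corner_sequence_walk_equiv:
  fixes w :: "('v \<times> 'e) list" and s :: "nat \<Rightarrow> 'v \<times> 'e"
  assumes w: "w \<noteq> []"
    and inj: "\<And>i j. ed w i = ed w j \<Longrightarrow> i mod int (length w) = j mod int (length w)"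
    and start: "corner_in w x (fst (s 0)) (snd (s 0))"
    and step: "\<And>j. corner_in w (snd (s j)) (fst (s (Suc j))) (snd (s (Suc j)))"
    and neq: "\<And>j. fst (s j) \<noteq> fst (s (Suc j))"
  shows "walk_equiv w (map s [0..<length w])"
    and "length w dvd j \<Longrightarrow> s j = s 0"
    and "snd (s j) = snd (s 0) \<longleftrightarrow> length w dvd j"
proof -
  let ?n = "int (length w)" let ?m = "map s [0..<length w]"
  have n: "?n > 0" using w by simp
  have m: "wlk ?m j = s (nat (j mod ?n))" for j
    using w by (simp add: wlk_def nat_less_iff)
  have mi: "int (nat (j mod ?n)) = j mod ?n" for j using n by simp
  note * = corner_sequence_follows_walk[OF assms]
  have md: "(k - j mod ?n) mod ?n = (k - j) mod ?n" for k j :: int by (simp add: mod_simps)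
  have md1: "(k - j mod ?n - 1) mod ?n = (k - j - 1) mod ?n" for k j :: int
    by (metis md diff_right_commute)
  consider k where "\<forall>j. s j = wlk w (int j + k)"
    | k where "\<forall>j. s j = (vt w (k - int j), ed w (k - int j - 1))"
    using * by blast
  note cs = this
  have "(\<exists>k. \<forall>j. wlk ?m j = wlk w (j + k)) \<or>
        (\<exists>k. \<forall>j. wlk ?m j = (vt w (k - j), ed w (k - j - 1)))"
  proof (cases rule: cs)
    case (1 k)
    have "\<forall>j. wlk ?m j = wlk w (j + k)"
      unfolding m using 1 n by (auto intro!: wlk_cong simp: mod_simps)
    then show ?thesis by blast
  next
    case (2 k)
    have "\<forall>j. wlk ?m j = (vt w (k - j), ed w (k - j - 1))"
      unfolding m using 2 by (simp only: mi wlk_cong[OF md] wlk_cong[OF md1]) simp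
    then show ?thesis by blast
  qed
  then show "walk_equiv w ?m" unfolding walk_equiv_iff[OF w] by simp
  have per: "s (length w + j) = s j" for j
  proof (cases rule: cs)
    case (1 k)
    then show ?thesis by (auto intro!: wlk_cong simp: add.assoc)
  next
    case (2 k)
    have a: "(k - int (length w + j)) mod ?n = (k - int j) mod ?n" for k
      by (metis diff_diff_eq minus_mod_self2 of_nat_add add.commute)
    have b: "(k - int (length w + j) - 1) mod ?n = (k - int j - 1) mod ?n" for k
      using a[of "k - 1"] by (simp add: algebra_simps)
    show ?thesis using 2 by (simp only: wlk_cong[OF a] wlk_cong[OF b])
  qed
  have "s (length w * q) = s 0" for q
    by (induction q) (simp_all add: per)
  then show "length w dvd j \<Longrightarrow> s j = s 0" by auto
  have ed: "ed w i = ed w j \<longleftrightarrow> ?n dvd i - j" for i j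
    by (metis inj mod_eq_dvd_iff wlk_cong)
  show "snd (s j) = snd (s 0) \<longleftrightarrow> length w dvd j"
  proof (cases rule: cs)
    case (1 k)
    then show ?thesis by (simp add: ed)
  next
    case (2 k)
    then show ?thesis by (simp add: ed)
  qed
qed

text \<open>Aligns the two entries per round in the definition of \<open>BiRo_cycle\<close> with a
  sequence defined by the parity of its index.\<close>

lemma concat_pairs:
  "concat (map (\<lambda>i. [p i, q i]) [0..<l]) =
   map (\<lambda>j. if even j then p (j div 2) else q (j div 2)) [0..<2 * l]"
  by (induction l) simp_all

section \<open>Corners and local rotations\<close>

definition is_corner :: "('v, 'e, 'f) pmap \<Rightarrow> 'f \<Rightarrow> 'e \<Rightarrow> 'v \<Rightarrow> 'e \<Rightarrow> bool" where
  "is_corner M h x v y \<longleftrightarrow> h \<in> faces M \<and> corner_in (bwalk M h) x v y"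

lemma is_corner_sym: "is_corner M h x v y \<Longrightarrow> is_corner M h y v x"
  unfolding is_corner_def using corner_in_sym by metis

lemma corner_prev_wlk:
  assumes "i < length (bwalk M h)"
  shows "corner_prev M (h, i) = ed (bwalk M h) (int i - 1)"
proof -
  let ?n = "length (bwalk M h)"
  have "int ((i + ?n - 1) mod ?n) = (int i + int ?n - 1) mod int ?n"
    using assms by (simp add: zmod_int of_nat_diff)
  also have "\<dots> = (int i - 1) mod int ?n"
    by (metis add_diff_eq diff_add_eq mod_add_self2)
  finally have "(i + ?n - 1) mod ?n = nat ((int i - 1) mod int ?n)" by linarith
  then show ?thesis by (simp add: corner_prev_def wlk_def Let_def)
qed

lemma corner_cur_wlk: "i < length (bwalk M h) \<Longrightarrow> corner_cur M (h, i) = ed (bwalk M h) (int i)"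
  by (simp add: corner_cur_def wlk_nth)

lemma closed_walk_iff:
  "closed_walk M w \<longleftrightarrow> w \<noteq> [] \<and> (\<forall>j. ed w j \<in> edges M \<and> ends M (ed w j) = {vt w j, vt w (j + 1)})"
proof (cases "w = []")
  case False
  have step: "wlk w (j + 1) = w ! ((i + 1) mod length w)"
    if "j mod int (length w) = int i" for i j
  proof -
    have "(j + 1) mod int (length w) = int ((i + 1) mod length w)"
      using that by (metis mod_add_left_eq of_nat_1 of_nat_add zmod_int)
    then show ?thesis unfolding wlk_def by simp
  qed
  show ?thesis
  proof
    assume cl: "closed_walk M w"
    have "ed w j \<in> edges M \<and> ends M (ed w j) = {vt w j, vt w (j + 1)}" for j
    proof -
      obtain i where i: "i < length w" "wlk w j = w ! i" "j mod int (length w) = int i"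
        using wlk_nat_index[OF False] by blast
      then show ?thesis using cl step[OF i(3)] unfolding closed_walk_def by auto
    qed
    then show "w \<noteq> [] \<and> (\<forall>j. ed w j \<in> edges M \<and> ends M (ed w j) = {vt w j, vt w (j + 1)})"
      using False by blast
  next
    assume r: "w \<noteq> [] \<and> (\<forall>j. ed w j \<in> edges M \<and> ends M (ed w j) = {vt w j, vt w (j + 1)})"
    show "closed_walk M w"
      unfolding closed_walk_def
    proof (intro conjI allI impI)
      fix i assume i: "i < length w"
      have "int i mod int (length w) = int i" using i by simp
      note s = step[OF this]
      show "snd (w ! i) \<in> edges M" using r wlk_nth[OF i] by metis
      show "ends M (snd (w ! i)) = {fst (w ! i), fst (w ! ((i + 1) mod length w))}"
        using r wlk_nth[OF i] s by metis
    qed (rule False)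
  qed
qed (simp add: closed_walk_def)

locale surface_map =
  fixes M :: "('v, 'e, 'f) pmap"
  assumes is_map: "is_map M"
begin

lemma ends_subset: "x \<in> edges M \<Longrightarrow> v \<in> ends M x \<Longrightarrow> v \<in> verts M"
  using is_map unfolding is_map_def by blast

lemma card_ends: "x \<in> edges M \<Longrightarrow> card (ends M x) = 2"
  using is_map unfolding is_map_def by blast

lemma finite_edges_at: "v \<in> verts M \<Longrightarrow> finite (edges_at M v)"
  using is_map unfolding is_map_def by blast

lemma connected: "u \<in> verts M \<Longrightarrow> w \<in> verts M \<Longrightarrow> (u, w) \<in> (adj_rel M)\<^sup>*"
  using is_map unfolding is_map_def by blast

lemma closed_walk_bwalk: "h \<in> faces M \<Longrightarrow> closed_walk M (bwalk M h)"
  using is_map unfolding is_map_def by blast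

lemma bwalk_ne: "h \<in> faces M \<Longrightarrow> bwalk M h \<noteq> []"
  using closed_walk_bwalk unfolding closed_walk_def by blast

lemma ed_in_edges: "h \<in> faces M \<Longrightarrow> ed (bwalk M h) j \<in> edges M"
  using closed_walk_bwalk closed_walk_iff by metis

lemma ends_ed:
  "h \<in> faces M \<Longrightarrow> ends M (ed (bwalk M h) j) = {vt (bwalk M h) j, vt (bwalk M h) (j + 1)}"
  using closed_walk_bwalk closed_walk_iff by metis

lemma vt_neq: "h \<in> faces M \<Longrightarrow> vt (bwalk M h) j \<noteq> vt (bwalk M h) (j + 1)"
  using card_ends[OF ed_in_edges] ends_ed by (metis card_2_iff' insert_absorb2 insertI1 singletonD)

lemma vt_in_verts: "h \<in> faces M \<Longrightarrow> vt (bwalk M h) j \<in> verts M"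
  using ends_ed ends_subset[OF ed_in_edges] by (metis insertI1)

lemma is_cornerD:
  assumes "is_corner M h x v y"
  shows "x \<in> edges_at M v" "y \<in> edges_at M v" "v \<in> verts M" "h \<in> faces M"
    "x \<in> face_edges M h" "y \<in> face_edges M h"
proof -
  let ?w = "bwalk M h"
  have h: "h \<in> faces M" using assms by (simp add: is_corner_def)
  have *: "x \<in> edges_at M v \<and> y \<in> edges_at M v \<and> v \<in> verts M \<and> x \<in> face_edges M h"
    if "is_corner M h x v y" for x y
  proof -
    obtain j where j: "vt ?w j = v" "x = ed ?w (j - 1) \<and> y = ed ?w j \<or> x = ed ?w j \<and> y = ed ?w (j - 1)"
      using \<open>is_corner M h x v y\<close> unfolding is_corner_def corner_in_def by blast
    have "v \<in> ends M (ed ?w j)" "v \<in> ends M (ed ?w (j - 1))"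
      using ends_ed[OF h] j(1) by auto
    moreover have "v \<in> verts M" using vt_in_verts[OF h] j(1) by auto
    moreover have "ed ?w j \<in> face_edges M h" "ed ?w (j - 1) \<in> face_edges M h"
      unfolding face_edges_def using wlk_in_set[OF bwalk_ne[OF h]] by auto
    ultimately show ?thesis using j(2) ed_in_edges[OF h] unfolding edges_at_def by auto
  qed
  show "x \<in> edges_at M v" "y \<in> edges_at M v" "v \<in> verts M" "h \<in> faces M"
    "x \<in> face_edges M h" "y \<in> face_edges M h"
    using *[OF assms] *[OF is_corner_sym[OF assms]] h by auto
qed

lemma face_edges_subset: "h \<in> faces M \<Longrightarrow> face_edges M h \<subseteq> edges M"
  using closed_walk_bwalk unfolding closed_walk_def face_edges_def
  by (auto simp: in_set_conv_nth) (metis snd_conv)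

lemma face_edges_ed: 
  assumes "h \<in> faces M" 
  shows "x \<in> face_edges M h \<longleftrightarrow> (\<exists>j. x = ed (bwalk M h) j)"
proof
  assume "x \<in> face_edges M h"
  then show "\<exists>j. x = ed (bwalk M h) j"
    unfolding face_edges_def using wlk_nth by (metis imageE in_set_conv_nth)
next
  assume "\<exists>j. x = ed (bwalk M h) j"
  then show "x \<in> face_edges M h"
    unfolding face_edges_def using wlk_in_set[OF bwalk_ne[OF assms]] by auto
qed

lemma ex_corner:
  assumes "h \<in> faces M" "x \<in> face_edges M h" "v \<in> ends M x"
  shows "\<exists>y. is_corner M h x v y"
proof -
  let ?w = "bwalk M h"
  obtain j where j: "x = ed ?w j" using assms face_edges_ed by blast
  then have "v = vt ?w j \<or> v = vt ?w (j + 1)" using assms ends_ed by auto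
  then show ?thesis
  proof
    assume "v = vt ?w j"
    then have "is_corner M h x v (ed ?w (j - 1))"
      using j assms(1) unfolding is_corner_def corner_in_def by auto
    then show ?thesis by blast
  next
    assume "v = vt ?w (j + 1)"
    then have "is_corner M h x v (ed ?w (j + 1))"
      using j assms(1) unfolding is_corner_def corner_in_def by (auto intro!: exI[of _ "j + 1"])
    then show ?thesis by blast
  qed
qed

lemma is_corner_iff_index:
  assumes "h \<in> faces M"
  shows "is_corner M h x v y \<longleftrightarrow> (\<exists>i < length (bwalk M h). (h, i) \<in> corners M v \<and>
    {corner_prev M (h, i), corner_cur M (h, i)} = {x, y})" (is "_ \<longleftrightarrow> ?R")
proof
  let ?w = "bwalk M h"
  {
    assume "is_corner M h x v y"
    then obtain j where j: "vt ?w j = v" "x = ed ?w (j - 1) \<and> y = ed ?w j \<or> x = ed ?w j \<and> y = ed ?w (j - 1)"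
      unfolding is_corner_def corner_in_def by blast
    obtain i where i: "i < length ?w" "wlk ?w j = ?w ! i" "j mod int (length ?w) = int i"
      using wlk_nat_index[OF bwalk_ne[OF assms]] by blast
    have m: "int i mod int (length ?w) = j mod int (length ?w)" using i(1) i(3) by simp
    have "(int i - 1) mod int (length ?w) = (j - 1) mod int (length ?w)"
      using m by (metis mod_diff_left_eq)
    then have e: "ed ?w (int i - 1) = ed ?w (j - 1)" "ed ?w (int i) = ed ?w j"
      using wlk_cong m by metis+
    have "(h, i) \<in> corners M v" using i j assms unfolding corners_def by auto
    moreover have "{corner_prev M (h, i), corner_cur M (h, i)} = {x, y}"
      using j(2) e by (auto simp: corner_prev_wlk corner_cur_wlk i)
    ultimately show ?R using i by blast
  }
  assume ?R
  then obtain i where i: "i < length ?w" "(h, i) \<in> corners M v"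
    "{corner_prev M (h, i), corner_cur M (h, i)} = {x, y}" by blast
  have "vt ?w (int i) = v" using i unfolding corners_def by (auto simp: wlk_nth)
  then show "is_corner M h x v y"
    unfolding is_corner_def corner_in_def using i(3) assms
    by (auto simp: corner_prev_wlk corner_cur_wlk i(1) doubleton_eq_iff intro!: exI[of _ "int i"])
qed

lemma ex_corner_iff:
  "(\<exists>c \<in> corners M v. {corner_prev M c, corner_cur M c} = {x, y}) \<longleftrightarrow> (\<exists>h. is_corner M h x v y)"
proof
  assume "\<exists>c \<in> corners M v. {corner_prev M c, corner_cur M c} = {x, y}"
  then obtain h i where c: "(h, i) \<in> corners M v" "{corner_prev M (h, i), corner_cur M (h, i)} = {x, y}"
    by auto
  then have "h \<in> faces M" "i < length (bwalk M h)" by (auto simp: corners_def)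
  then show "\<exists>h. is_corner M h x v y" using c is_corner_iff_index by blast
next
  assume "\<exists>h. is_corner M h x v y"
  then show "\<exists>c \<in> corners M v. {corner_prev M c, corner_cur M c} = {x, y}"
    using is_corner_iff_index is_cornerD(4) by blast
qed

text \<open>Unrolls the cyclic list of edges at a vertex into a sequence over the integers whose
  period is the valency. Corners correspond one to one to positions, and from period 3 on distinct
  positions have distinct unordered pairs of consecutive edges; this gives the last claim.\<close>

lemma rotation:
  assumes v: "v \<in> verts M" and x0: "x0 \<in> edges_at M v"
  obtains \<rho> :: "int \<Rightarrow> 'e" where "range \<rho> = edges_at M v"
    "\<And>i j. \<rho> i = \<rho> j \<longleftrightarrow> i mod int (card (edges_at M v)) = j mod int (card (edges_at M v))"
    "\<And>x y. (\<exists>h. is_corner M h x v y) \<longleftrightarrow> (\<exists>i. {x, y} = {\<rho> i, \<rho> (i + 1)})"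
    "\<And>h h' x y. card (edges_at M v) \<ge> 3 \<Longrightarrow> is_corner M h x v y \<Longrightarrow> is_corner M h' x v y \<Longrightarrow> h = h'"
proof -
  obtain rs \<kappa> where rs: "distinct rs" "set rs = edges_at M v"
    "bij_betw \<kappa> (corners M v) {..<length rs}"
    "\<And>c. c \<in> corners M v \<Longrightarrow> {corner_prev M c, corner_cur M c} =
            {rs ! \<kappa> c, rs ! ((\<kappa> c + 1) mod length rs)}"
  proof -
    have "\<exists>rs \<kappa>. distinct rs \<and> set rs = edges_at M v \<and>
        bij_betw \<kappa> (corners M v) {..<length rs} \<and>
        (\<forall>c \<in> corners M v. {corner_prev M c, corner_cur M c} =
            {rs ! \<kappa> c, rs ! ((\<kappa> c + 1) mod length rs)})"
      using is_map v unfolding is_map_def by simp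
    then show ?thesis using that by blast
  qed
  have ne: "rs \<noteq> []" using rs(2) x0 by auto
  have n: "card (edges_at M v) = length rs" using rs(1,2) distinct_card by metis
  let ?n = "int (length rs)"
  have n0: "?n > 0" using ne by simp
  define \<rho> where "\<rho> = wlk rs"
  have inj: "\<rho> i = \<rho> j \<longleftrightarrow> i mod ?n = j mod ?n" for i j
  proof -
    have "nat (i mod ?n) < length rs" "nat (j mod ?n) < length rs"
      using n0 by (simp_all add: nat_less_iff)
    then have "\<rho> i = \<rho> j \<longleftrightarrow> nat (i mod ?n) = nat (j mod ?n)"
      unfolding \<rho>_def wlk_def using rs(1) by (simp add: nth_eq_iff_index_eq)
    then show ?thesis using n0 by (simp add: eq_nat_nat_iff)
  qed
  have pair: "\<rho> (int i) = rs ! i" "\<rho> (int i + 1) = rs ! ((i + 1) mod length rs)" if "i < length rs" for i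
  proof -
    show "\<rho> (int i) = rs ! i" using that by (simp add: \<rho>_def wlk_nth)
    have "(int i + 1) mod ?n = int ((i + 1) mod length rs)" by (simp add: zmod_int add.commute)
    then show "\<rho> (int i + 1) = rs ! ((i + 1) mod length rs)" by (simp add: \<rho>_def wlk_def)
  qed
  have k: "\<kappa> c < length rs" if "c \<in> corners M v" for c
    using rs(3) that by (auto simp: bij_betw_def)
  have 1: "range \<rho> = edges_at M v"
  proof
    show "range \<rho> \<subseteq> edges_at M v" using wlk_in_set[OF ne] rs(2) by (auto simp: \<rho>_def)
    show "edges_at M v \<subseteq> range \<rho>" using rs(2) pair(1) by (metis in_set_conv_nth rangeI subsetI)
  qed
  have 2: "(\<exists>h. is_corner M h x v y) \<longleftrightarrow> (\<exists>i. {x, y} = {\<rho> i, \<rho> (i + 1)})" for x y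
  proof
    assume "\<exists>h. is_corner M h x v y"
    then obtain c where c: "c \<in> corners M v" "{corner_prev M c, corner_cur M c} = {x, y}"
      using ex_corner_iff by metis
    then have "{x, y} = {\<rho> (int (\<kappa> c)), \<rho> (int (\<kappa> c) + 1)}"
      using rs(4)[OF c(1)] pair[OF k[OF c(1)]] by simp
    then show "\<exists>i. {x, y} = {\<rho> i, \<rho> (i + 1)}" by blast
  next
    assume "\<exists>i. {x, y} = {\<rho> i, \<rho> (i + 1)}"
    then obtain i where i: "{x, y} = {\<rho> i, \<rho> (i + 1)}" by blast
    define l where "l = nat (i mod ?n)"
    have l: "l < length rs" "int l = i mod ?n" using n0 by (simp_all add: l_def nat_less_iff)
    have "\<rho> (int l) = \<rho> i" "\<rho> (int l + 1) = \<rho> (i + 1)"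
      unfolding inj l(2) by (simp_all add: mod_simps)
    moreover obtain c where c: "c \<in> corners M v" "\<kappa> c = l"
      using rs(3) l(1) by (metis bij_betw_iff_bijections lessThan_iff)
    ultimately have "{corner_prev M c, corner_cur M c} = {x, y}"
      using rs(4)[OF c(1)] pair[OF l(1)] i c(2) by simp
    then show "\<exists>h. is_corner M h x v y" using c ex_corner_iff by metis
  qed
  have 3: "h = h'" if n3: "length rs \<ge> 3" and h: "is_corner M h x v y" "is_corner M h' x v y" for h h' x y
  proof -
    obtain i i' where i: "(h, i) \<in> corners M v" "{corner_prev M (h, i), corner_cur M (h, i)} = {x, y}"
      and i': "(h', i') \<in> corners M v" "{corner_prev M (h', i'), corner_cur M (h', i')} = {x, y}"
      using h is_corner_iff_index is_cornerD(4) by meson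
    define k1 where "k1 = \<kappa> (h, i)"
    define k2 where "k2 = \<kappa> (h', i')"
    have kk: "k1 < length rs" "k2 < length rs" using k i i' by (auto simp: k1_def k2_def)
    have "{\<rho> (int k1), \<rho> (int k1 + 1)} = {\<rho> (int k2), \<rho> (int k2 + 1)}"
      using rs(4)[OF i(1)] rs(4)[OF i'(1)] i i' pair kk unfolding k1_def k2_def by metis
    then consider "\<rho> (int k1) = \<rho> (int k2)" | "\<rho> (int k1) = \<rho> (int k2 + 1)" "\<rho> (int k1 + 1) = \<rho> (int k2)"
      by (auto simp: doubleton_eq_iff)
    then have "k1 = k2"
    proof cases
      case 1
      then show ?thesis using kk by (simp add: inj)
    next
      \<comment> \<open>Two consecutive pairs that agree with their entries exchanged would force
        the period to divide 2.\<close>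
      case 2
      then have "?n dvd int k1 - (int k2 + 1)" "?n dvd int k1 + 1 - int k2"
        by (simp_all add: inj mod_eq_dvd_iff)
      then have "?n dvd (int k1 + 1 - int k2) - (int k1 - (int k2 + 1))" by (rule dvd_diff[rotated])
      then have "?n dvd 2" by simp
      then show ?thesis using n3 by (auto dest: zdvd_imp_le)
    qed
    then have "(h, i) = (h', i')"
      using rs(3) i(1) i'(1) unfolding k1_def k2_def bij_betw_def inj_on_def by blast
    then show ?thesis by simp
  qed
  show ?thesis by (rule that[OF 1]) (use inj 2 3 in \<open>simp_all add: n\<close>)
qed

text \<open>Induction around the rotation in both directions, so that a property passed between
  neighbouring edges reaches the whole vertex.\<close>

lemma edges_at_closed_under_corners:
  assumes v: "v \<in> verts M" and x: "x \<in> edges_at M v" "x \<in> S"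
    and cl: "\<And>h p q. p \<in> S \<Longrightarrow> is_corner M h p v q \<Longrightarrow> q \<in> S"
  shows "edges_at M v \<subseteq> S"
proof -
  obtain \<rho> :: "int \<Rightarrow> 'e" where r: "range \<rho> = edges_at M v"
    "\<And>x y. (\<exists>h. is_corner M h x v y) \<longleftrightarrow> (\<exists>i. {x, y} = {\<rho> i, \<rho> (i + 1)})"
    by (rule rotation[OF v x(1)]) (rule that)
  obtain k where k: "x = \<rho> k" using r(1) x by blast
  have up: "\<rho> (i + 1) \<in> S" if "\<rho> i \<in> S" for i
    using r(2)[of "\<rho> i" "\<rho> (i + 1)"] cl that by blast
  have dn: "\<rho> (i - 1) \<in> S" if "\<rho> i \<in> S" for i
    using r(2)[of "\<rho> i" "\<rho> (i - 1)"] cl that by (metis diff_add_cancel insert_commute)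
  have "\<rho> i \<in> S" for i
    by (induction i rule: int_induct[of _ k]) (use k x up dn in auto)
  then show ?thesis unfolding r(1)[symmetric] by blast
qed

text \<open>Here two consecutive edges are needed to obtain the next one, as when an automorphism is
  known to fix a corner.\<close>

lemma edges_at_closed_under_corner_pairs:
  assumes v: "v \<in> verts M" and x: "is_corner M h x v u" "x \<in> S" "u \<in> S"
    and cl: "\<And>h h' p q r. p \<in> S \<Longrightarrow> q \<in> S \<Longrightarrow> is_corner M h p v q \<Longrightarrow> is_corner M h' q v r \<Longrightarrow> r \<in> S"
  shows "edges_at M v \<subseteq> S"
proof -
  \<comment> \<open>Members of \<open>T\<close> carry their neighbours along, which turns
    propagation from pairs into propagation from single edges.\<close>
  define T where "T = {p \<in> S. \<forall>h q. is_corner M h p v q \<longrightarrow> q \<in> S}"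
  have "edges_at M v \<subseteq> T"
  proof (rule edges_at_closed_under_corners[OF v is_cornerD(1)[OF x(1)]])
    show "x \<in> T" unfolding T_def using x(2) cl[OF x(3,2) is_corner_sym[OF x(1)]] by simp
    show "q \<in> T" if p: "p \<in> T" "is_corner M h p v q" for h p q
    proof -
      have "p \<in> S" "q \<in> S" using p by (auto simp: T_def)
      then show ?thesis unfolding T_def using cl[OF _ _ p(2)] by simp
    qed
  qed
  then show ?thesis unfolding T_def by blast
qed

text \<open>In a rotation of period at least 3 the positions \<open>k - 1\<close>, \<open>k\<close>
  and \<open>k + 1\<close> hold three different edges.\<close>

lemma two_neighbours:
  assumes v: "v \<in> verts M" and x: "x \<in> edges_at M v" and n: "card (edges_at M v) \<ge> 3"
  obtains u1 u2 where "u1 \<noteq> u2" "u1 \<noteq> x" "u2 \<noteq> x" "\<And>y. (\<exists>h. is_corner M h x v y) \<longleftrightarrow> y = u1 \<or> y = u2"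
proof -
  let ?n = "int (card (edges_at M v))"
  obtain \<rho> :: "int \<Rightarrow> 'e" where r: "range \<rho> = edges_at M v"
    "\<And>i j. \<rho> i = \<rho> j \<longleftrightarrow> i mod ?n = j mod ?n"
    "\<And>x y. (\<exists>h. is_corner M h x v y) \<longleftrightarrow> (\<exists>i. {x, y} = {\<rho> i, \<rho> (i + 1)})"
    by (rule rotation[OF v x(1)]) (rule that)
  obtain k where k: "x = \<rho> k" using r(1) x by blast
  have "\<not> ?n dvd 2" using n by (auto dest: zdvd_imp_le)
  then have "\<rho> (k - 1) \<noteq> \<rho> (k + 1)" unfolding r(2) mod_eq_dvd_iff
    by (metis add_diff_cancel_left' diff_diff_eq2 dvd_minus_iff minus_diff_eq one_add_one diff_add_eq)
  moreover have "\<not> ?n dvd 1" using n by (auto dest: zdvd_imp_le)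
  then have "\<rho> (k - 1) \<noteq> x" "\<rho> (k + 1) \<noteq> x" unfolding k r(2) mod_eq_dvd_iff by simp_all
  moreover have "(\<exists>h. is_corner M h x v y) \<longleftrightarrow> y = \<rho> (k - 1) \<or> y = \<rho> (k + 1)" for y
  proof
    assume "\<exists>h. is_corner M h x v y"
    then obtain i where "{x, y} = {\<rho> i, \<rho> (i + 1)}" using r(3) by blast
    then consider "\<rho> k = \<rho> i" "y = \<rho> (i + 1)" | "\<rho> k = \<rho> (i + 1)" "y = \<rho> i"
      using k by (auto simp: doubleton_eq_iff)
    then show "y = \<rho> (k - 1) \<or> y = \<rho> (k + 1)"
    proof cases
      case 1
      then have "\<rho> (i + 1) = \<rho> (k + 1)" unfolding r(2) by (metis mod_add_left_eq)
      then show ?thesis using 1 by simp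
    next
      case 2
      then have "\<rho> (i + 1 - 1) = \<rho> (k - 1)" unfolding r(2) by (metis mod_diff_left_eq)
      then show ?thesis using 2 by simp
    qed
  next
    assume "y = \<rho> (k - 1) \<or> y = \<rho> (k + 1)"
    then have "\<exists>i. {x, y} = {\<rho> i, \<rho> (i + 1)}"
    proof
      assume "y = \<rho> (k - 1)"
      then show ?thesis using k by (intro exI[of _ "k - 1"]) auto
    next
      assume "y = \<rho> (k + 1)"
      then show ?thesis using k by blast
    qed
    then show "\<exists>h. is_corner M h x v y" using r(3) by blast
  qed
  ultimately show ?thesis using that by blast
qed

lemma corner_determines_face:
  assumes "card (edges_at M v) \<ge> 3" "is_corner M h x v y" "is_corner M h' x v y"
  shows "h = h'"
proof -
  have "\<And>h h' x y. is_corner M h x v y \<Longrightarrow> is_corner M h' x v y \<Longrightarrow> h = h'"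
    by (rule rotation[OF is_cornerD(3,1)[OF assms(2)]]) (use assms(1) in metis)
  then show ?thesis using assms by blast
qed

text \<open>With at most two edges around the vertex, one consecutive pair of the rotation exhausts
  it. A face through such a vertex therefore contains all its edges, which is how small valency is
  refuted.\<close>

lemma corner_small_valency:
  assumes "card (edges_at M v) \<le> 2" "is_corner M h x v y"
  shows "edges_at M v = {x, y}"
proof -
  let ?n = "card (edges_at M v)"
  obtain \<rho> :: "int \<Rightarrow> 'e" where r: "range \<rho> = edges_at M v"
    "\<And>i j. \<rho> i = \<rho> j \<longleftrightarrow> i mod int ?n = j mod int ?n"
    "\<And>x y. (\<exists>h. is_corner M h x v y) \<longleftrightarrow> (\<exists>i. {x, y} = {\<rho> i, \<rho> (i + 1)})"
    by (rule rotation[OF is_cornerD(3,1)[OF assms(2)]]) (rule that)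
  obtain i where i: "{x, y} = {\<rho> i, \<rho> (i + 1)}" using r(3) assms by blast
  have fin: "finite (edges_at M v)" using finite_edges_at is_cornerD(3)[OF assms(2)] by blast
  have sub: "{x, y} \<subseteq> edges_at M v" using is_cornerD(1,2)[OF assms(2)] by simp
  have "?n \<le> card {x, y}"
  proof (cases "?n = 2")
    case True
    have "\<rho> i \<noteq> \<rho> (i + 1)" unfolding r(2) True by presburger
    then have "card {x, y} = 2" unfolding i by simp
    then show ?thesis using True by simp
  next
    case False
    then show ?thesis using assms(1) by (simp add: card_insert_if)
  qed
  with card_mono[OF fin sub] have "card {x, y} = ?n" by (rule antisym)
  then show ?thesis using card_subset_eq[OF fin sub] by metis
qed

end

section \<open>Invariance under isomorphism\<close>

lemma walk_equiv_closed_walk: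
  assumes "closed_walk M w" "walk_equiv w w'"
  shows "closed_walk M w'"
proof -
  have w: "w \<noteq> []" using assms(1) by (simp add: closed_walk_def)
  then have w': "w' \<noteq> []" using walk_equiv_length[OF assms(2)] by auto
  have c: "ed w j \<in> edges M" "ends M (ed w j) = {vt w j, vt w (j + 1)}" for j
    using assms(1) unfolding closed_walk_iff by auto
  consider k where "\<forall>j. wlk w' j = wlk w (j + k)"
    | k where "\<forall>j. wlk w' j = (vt w (k - j), ed w (k - j - 1))"
    using assms(2) unfolding walk_equiv_iff[OF w] by blast
  then show ?thesis
  proof cases
    case 1
    then show ?thesis unfolding closed_walk_iff using w' c by (auto simp: algebra_simps)
  next
    case 2
    have "vt w (k - (j + 1)) = vt w (k - j - 1)" for j by (simp add: algebra_simps)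
    then show ?thesis unfolding closed_walk_iff using w' c 2 by (auto simp del: diff_diff_eq2)
  qed
qed

lemma bij_betw_affine_mod:
  fixes c s :: int
  assumes "n > 0" "s = 1 \<or> s = - 1"
  shows "bij_betw (\<lambda>i. nat ((c + s * int i) mod int n)) {..<n} {..<n}" (is "bij_betw ?f _ _")
proof -
  have "inj_on ?f {..<n}"
  proof (rule inj_onI)
    fix i j assume ij: "i \<in> {..<n}" "j \<in> {..<n}" "?f i = ?f j"
    then have "(c + s * int i) mod int n = (c + s * int j) mod int n"
      using assms(1) by (simp add: eq_nat_nat_iff)
    then have "int n dvd (c + s * int i) - (c + s * int j)" by (simp only: mod_eq_dvd_iff)
    then have "int n dvd s * (int i - int j)" by (simp add: algebra_simps)
    then have "int n dvd int i - int j" using assms(2) by (auto simp: dvd_diff_commute)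
    then have "int i mod int n = int j mod int n" by (simp only: mod_eq_dvd_iff)
    then show "i = j" using ij by simp
  qed
  moreover have "?f ` {..<n} \<subseteq> {..<n}" using assms(1) by (auto simp: nat_less_iff)
  ultimately show ?thesis by (simp add: bij_betw_def endo_inj_surj)
qed

text \<open>Two index bijections are needed because reversal moves edges and vertices by different
  offsets: \<open>\<sigma>\<close> will match the sides of an edge and \<open>\<tau>\<close> the
  corners at a vertex.\<close>

lemma walk_equiv_index_bijections:
  assumes w: "w \<noteq> []" and eq: "walk_equiv w w'"
  obtains \<sigma> \<tau> where "bij_betw \<sigma> {..<length w} {..<length w'}" "bij_betw \<tau> {..<length w} {..<length w'}"
    "\<And>i. i < length w \<Longrightarrow> snd (w' ! \<sigma> i) = snd (w ! i)"
    "\<And>i. i < length w \<Longrightarrow> fst (w' ! \<tau> i) = fst (w ! i)"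
    "\<And>i. i < length w \<Longrightarrow>
       {ed w' (int (\<tau> i) - 1), ed w' (int (\<tau> i))} = {ed w (int i - 1), ed w (int i)}"
proof -
  have len: "length w' = length w" using walk_equiv_length[OF eq] .
  then have w': "w' \<noteq> []" using w by auto
  let ?n = "int (length w)"
  have n: "length w > 0" using w by simp
  define I where "I c s i = nat ((c + s * int i) mod ?n)" for c s :: int and i :: nat
  have bij: "s = 1 \<or> s = - 1 \<Longrightarrow> bij_betw (I c s) {..<length w} {..<length w'}" for c s
    unfolding len I_def using bij_betw_affine_mod[OF n] by blast
  have nth: "w' ! I c s i = wlk w' (c + s * int i)" for c s i
    unfolding I_def wlk_def len ..
  have sh: "wlk w' (int (I c s i) + d) = wlk w' (c + s * int i + d)" for c s i d
    by (rule wlk_cong) (use n in \<open>simp add: I_def len mod_simps\<close>)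
  have sh0: "wlk w' (int (I c s i)) = wlk w' (c + s * int i)" for c s i
    using sh[of c s i 0] by simp
  have shm: "wlk w' (int (I c s i) - 1) = wlk w' (c + s * int i - 1)" for c s i
    using sh[of c s i "- 1"] by simp
  have "walk_equiv w' w" by (rule walk_equiv_sym[OF w eq])
  then consider k where "\<forall>j. wlk w j = wlk w' (j + k)"
    | k where "\<forall>j. wlk w j = (vt w' (k - j), ed w' (k - j - 1))"
    unfolding walk_equiv_iff[OF w'] by blast
  then show ?thesis
  proof cases
    case 1
    have a: "wlk w (int i) = w' ! I k 1 i" "wlk w (int i - 1) = wlk w' (int (I k 1 i) - 1)" for i
      using 1 by (simp_all add: nth shm algebra_simps)
    show ?thesis
    proof (rule that[of "I k 1" "I k 1"])
      fix i assume "i < length w"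
      then show "snd (w' ! I k 1 i) = snd (w ! i)" "fst (w' ! I k 1 i) = fst (w ! i)"
        using a(1)[of i] by (simp_all add: wlk_nth)
      show "{ed w' (int (I k 1 i) - 1), ed w' (int (I k 1 i))} = {ed w (int i - 1), ed w (int i)}"
        using a[of i] by (simp add: sh0 nth)
    qed (use bij in auto)
  next
    case 2
    show ?thesis
    proof (rule that[of "I (k - 1) (- 1)" "I k (- 1)"])
      fix i assume i: "i < length w"
      have "wlk w (int i) = (vt w' (k - int i), ed w' (k - int i - 1))" using 2 by blast
      moreover have "k - int i = k + - 1 * int i" "k - int i - 1 = k - 1 + - 1 * int i" by auto
      ultimately have a: "wlk w (int i) = (fst (w' ! I k (- 1) i), snd (w' ! I (k - 1) (- 1) i))"
        unfolding nth by metis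
      then show "snd (w' ! I (k - 1) (- 1) i) = snd (w ! i)" "fst (w' ! I k (- 1) i) = fst (w ! i)"
        using i by (simp_all add: wlk_nth)
      have "ed w (int i) = ed w' (k - int i - 1)" "ed w (int i - 1) = ed w' (k - int i)"
        using 2 by simp_all
      then show "{ed w' (int (I k (- 1) i) - 1), ed w' (int (I k (- 1) i))} = {ed w (int i - 1), ed w (int i)}"
        unfolding sh0 shm by auto
    qed (use bij in auto)
  qed
qed

lemma bij_betw_Sigma:
  assumes p: "bij_betw p A B" and s: "\<And>x. x \<in> A \<Longrightarrow> bij_betw (s x) (C x) (D (p x))"
  shows "bij_betw (\<lambda>(x, i). (p x, s x i)) (Sigma A C) (Sigma B D)"
  unfolding bij_betw_def
proof
  show "inj_on (\<lambda>(x, i). (p x, s x i)) (Sigma A C)"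
  proof (rule inj_onI, clarsimp)
    fix x i y j assume a: "x \<in> A" "i \<in> C x" "y \<in> A" "j \<in> C y" "p x = p y" "s x i = s y j"
    have xy: "x = y" using p a by (metis bij_betw_inv_into_left)
    then show "x = y \<and> i = j" using s[OF a(1)] a by (metis bij_betw_inv_into_left)
  qed
  show "(\<lambda>(x, i). (p x, s x i)) ` Sigma A C = Sigma B D"
  proof
    show "(\<lambda>(x, i). (p x, s x i)) ` Sigma A C \<subseteq> Sigma B D"
      using p s by (auto dest: bij_betwE)
    show "Sigma B D \<subseteq> (\<lambda>(x, i). (p x, s x i)) ` Sigma A C"
    proof clarify
      fix y j assume y: "y \<in> B" "j \<in> D y"
      obtain x where x: "x \<in> A" "y = p x" using p y by (auto simp: bij_betw_def)
      obtain i where i: "i \<in> C x" "j = s x i" using s[OF x(1)] y x by (auto simp: bij_betw_def)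
      show "(y, j) \<in> (\<lambda>(x, i). (p x, s x i)) ` Sigma A C" using x i by force
    qed
  qed
qed

text \<open>This spares a direct verification of the surface conditions for \<open>RotaMap\<close>
  and \<open>BiRoMap\<close>. Walks correspond only up to shift and reversal, so sides and corners
  have to be matched by chosen index bijections.\<close>

lemma map_iso_is_map:
  assumes "is_map M" and iso: "map_iso M N \<phi>V \<phi>E \<phi>F"
  shows "is_map N"
proof -
  interpret surface_map M using assms(1) by unfold_locales
  have bV: "bij_betw \<phi>V (verts M) (verts N)" and bE: "bij_betw \<phi>E (edges M) (edges N)"
    and bF: "bij_betw \<phi>F (faces M) (faces N)"
    and en: "\<And>x. x \<in> edges M \<Longrightarrow> ends N (\<phi>E x) = \<phi>V ` ends M x"
    and wk: "\<And>f. f \<in> faces M \<Longrightarrow> walk_equiv (map_walk \<phi>V \<phi>E (bwalk M f)) (bwalk N (\<phi>F f))"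
    using iso unfolding map_iso_def by auto
  have iV: "inj_on \<phi>V (verts M)" and iE: "inj_on \<phi>E (edges M)"
    using bV bE by (auto simp: bij_betw_def)
  have sub: "ends M x \<subseteq> verts M" if "x \<in> edges M" for x using ends_subset that by blast
  have sV: "\<exists>v \<in> verts M. v' = \<phi>V v" if "v' \<in> verts N" for v' using bV that by (auto simp: bij_betw_def)
  have sE: "\<exists>x \<in> edges M. x' = \<phi>E x" if "x' \<in> edges N" for x' using bE that by (auto simp: bij_betw_def)
  have sF: "\<exists>f \<in> faces M. f' = \<phi>F f" if "f' \<in> faces N" for f' using bF that by (auto simp: bij_betw_def)
  have mw: "map_walk \<phi>V \<phi>E w = map (\<lambda>c. (\<phi>V (fst c), \<phi>E (snd c))) w" for w
    by (simp add: map_walk_def case_prod_unfold)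
  have wmw: "wlk (map_walk \<phi>V \<phi>E (bwalk M f)) j = (\<phi>V (vt (bwalk M f) j), \<phi>E (ed (bwalk M f) j))"
    if "f \<in> faces M" for f j
    using bwalk_ne[OF that] by (simp add: mw wlk_map)
  have mne: "map_walk \<phi>V \<phi>E (bwalk M f) \<noteq> []" if "f \<in> faces M" for f
    using bwalk_ne[OF that] by (simp add: mw)

  have c1: "\<forall>x \<in> edges N. ends N x \<subseteq> verts N \<and> card (ends N x) = 2"
  proof
    fix x' assume "x' \<in> edges N"
    then obtain x where x: "x \<in> edges M" "x' = \<phi>E x" using sE by blast
    show "ends N x' \<subseteq> verts N \<and> card (ends N x') = 2"
      using x en[OF x(1)] sub[OF x(1)] bV card_ends[OF x(1)] inj_on_subset[OF iV sub[OF x(1)]]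
      by (auto simp: card_image bij_betw_def)
  qed
  have ea: "edges_at N (\<phi>V v) = \<phi>E ` edges_at M v" if v: "v \<in> verts M" for v
  proof
    show "edges_at N (\<phi>V v) \<subseteq> \<phi>E ` edges_at M v"
    proof
      fix x' assume x': "x' \<in> edges_at N (\<phi>V v)"
      then obtain x where x: "x \<in> edges M" "x' = \<phi>E x" using sE unfolding edges_at_def by blast
      then have "\<phi>V v \<in> \<phi>V ` ends M x" using x' en unfolding edges_at_def by auto
      then have "v \<in> ends M x" using iV v sub[OF x(1)] by (metis inj_on_image_mem_iff)
      then show "x' \<in> \<phi>E ` edges_at M v" using x unfolding edges_at_def by blast
    qed
    show "\<phi>E ` edges_at M v \<subseteq> edges_at N (\<phi>V v)"
      using en bE unfolding edges_at_def by (auto dest: bij_betwE)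
  qed
  have c2: "\<forall>v \<in> verts N. finite (edges_at N v)"
    using sV ea finite_edges_at by (metis finite_imageI)
  have c3: "\<forall>u \<in> verts N. \<forall>w \<in> verts N. (u, w) \<in> (adj_rel N)\<^sup>*"
  proof (intro ballI)
    fix u' w' assume "u' \<in> verts N" "w' \<in> verts N"
    then obtain u w where uw: "u \<in> verts M" "w \<in> verts M" "u' = \<phi>V u" "w' = \<phi>V w"
      using sV by blast
    have "(\<phi>V u, \<phi>V w) \<in> (adj_rel N)\<^sup>*" using connected[OF uw(1,2)]
    proof (induction rule: rtrancl_induct)
      case (step y z)
      then obtain x where x: "x \<in> edges M" "ends M x = {y, z}" unfolding adj_rel_def by auto
      then have "(\<phi>V y, \<phi>V z) \<in> adj_rel N"
        unfolding adj_rel_def using en[OF x(1)] bE by (auto dest: bij_betwE intro!: bexI[of _ "\<phi>E x"])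
      then show ?case using step.IH by simp
    qed simp
    then show "(u', w') \<in> (adj_rel N)\<^sup>*" using uw by simp
  qed
  have c4: "\<forall>f \<in> faces N. closed_walk N (bwalk N f)"
  proof
    fix f' assume "f' \<in> faces N"
    then obtain f where f: "f \<in> faces M" "f' = \<phi>F f" using sF by blast
    have "closed_walk N (map_walk \<phi>V \<phi>E (bwalk M f))"
      unfolding closed_walk_iff
      using mne[OF f(1)] ed_in_edges[OF f(1)] ends_ed[OF f(1)] en bE
      by (auto simp: wmw[OF f(1)] dest: bij_betwE)
    then show "closed_walk N (bwalk N f')" using walk_equiv_closed_walk wk f by blast
  qed
  let ?all = "\<lambda>M. SIGMA f : faces M. {..<length (bwalk M f)}"
  \<comment> \<open>The pair consists of an index bijection for the edges and one for the vertices
    of the boundary of \<open>f\<close>; the last clause says that the second also respects the two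
    edges of each corner.\<close>
  define good where "good f st \<longleftrightarrow> (case st of (\<sigma>, \<tau>) \<Rightarrow>
    bij_betw \<sigma> {..<length (bwalk M f)} {..<length (bwalk N (\<phi>F f))} \<and>
    bij_betw \<tau> {..<length (bwalk M f)} {..<length (bwalk N (\<phi>F f))} \<and>
    (\<forall>i < length (bwalk M f).
       snd (bwalk N (\<phi>F f) ! \<sigma> i) = \<phi>E (snd (bwalk M f ! i)) \<and>
       fst (bwalk N (\<phi>F f) ! \<tau> i) = \<phi>V (fst (bwalk M f ! i)) \<and>
       {corner_prev N (\<phi>F f, \<tau> i), corner_cur N (\<phi>F f, \<tau> i)} =
         \<phi>E ` {corner_prev M (f, i), corner_cur M (f, i)}))" for f and st :: "(nat \<Rightarrow> nat) \<times> (nat \<Rightarrow> nat)"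
  have "\<exists>st. good f st" if f: "f \<in> faces M" for f
  proof -
    let ?w = "map_walk \<phi>V \<phi>E (bwalk M f)" and ?w' = "bwalk N (\<phi>F f)"
    have len: "length ?w = length (bwalk M f)" by (simp add: mw)
    obtain \<sigma> \<tau> where st: "bij_betw \<sigma> {..<length ?w} {..<length ?w'}" "bij_betw \<tau> {..<length ?w} {..<length ?w'}"
      "\<And>i. i < length ?w \<Longrightarrow> snd (?w' ! \<sigma> i) = snd (?w ! i)"
      "\<And>i. i < length ?w \<Longrightarrow> fst (?w' ! \<tau> i) = fst (?w ! i)"
      "\<And>i. i < length ?w \<Longrightarrow>
       {ed ?w' (int (\<tau> i) - 1), ed ?w' (int (\<tau> i))} = {ed ?w (int i - 1), ed ?w (int i)}"
      by (rule walk_equiv_index_bijections[OF mne[OF f] wk[OF f]]) (rule that)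
    have "good f (\<sigma>, \<tau>)"
      unfolding good_def prod.case
    proof (intro conjI allI impI)
      fix i assume i: "i < length (bwalk M f)"
      then have ti: "\<tau> i < length ?w'" using st(2) len by (auto dest: bij_betwE)
      show "snd (?w' ! \<sigma> i) = \<phi>E (snd (bwalk M f ! i))" using st(3) i len by (simp add: mw)
      show "fst (?w' ! \<tau> i) = \<phi>V (fst (bwalk M f ! i))" using st(4) i len by (simp add: mw)
      show "{corner_prev N (\<phi>F f, \<tau> i), corner_cur N (\<phi>F f, \<tau> i)} =
         \<phi>E ` {corner_prev M (f, i), corner_cur M (f, i)}"
        using st(5)[of i] i ti len
        by (simp add: corner_prev_wlk corner_cur_wlk wmw[OF f])
    qed (use st len in auto)
    then show ?thesis by blast
  qed
  then obtain st where st: "\<And>f. f \<in> faces M \<Longrightarrow> good f (st f)" by metis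
  \<comment> \<open>\<open>S\<close> and \<open>T\<close> glue the facewise bijections together;
    restricted to one edge or one vertex they give the bijections of sides and of corners.\<close>
  define S where "S = (\<lambda>(f, i). (\<phi>F f, fst (st f) i))"
  define T where "T = (\<lambda>(f, i). (\<phi>F f, snd (st f) i))"
  have bS: "bij_betw S (?all M) (?all N)" unfolding S_def
    by (rule bij_betw_Sigma[OF bF]) (auto dest!: st simp: good_def case_prod_unfold)
  have bT: "bij_betw T (?all M) (?all N)" unfolding T_def
    by (rule bij_betw_Sigma[OF bF]) (auto dest!: st simp: good_def case_prod_unfold)
  have c5: "\<forall>x \<in> edges N. finite (sides N x) \<and> card (sides N x) = 2"
  proof
    fix x' assume "x' \<in> edges N"
    then obtain x where x: "x \<in> edges M" "x' = \<phi>E x" using sE by blast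
    have "bij_betw S {c \<in> ?all M. snd (bwalk M (fst c) ! snd c) = x}
                     {c \<in> ?all N. snd (bwalk N (fst c) ! snd c) = x'}"
    proof (rule bij_betw_Collect[OF bS])
      fix c assume "c \<in> ?all M"
      then obtain f i where c: "c = (f, i)" "f \<in> faces M" "i < length (bwalk M f)" by auto
      have "snd (bwalk M f ! i) \<in> edges M" using ed_in_edges[OF c(2), of "int i"] by (simp add: wlk_nth c)
      moreover have "snd (bwalk N (fst (S c)) ! snd (S c)) = \<phi>E (snd (bwalk M f ! i))"
        using st[OF c(2)] c by (auto simp: S_def good_def split: prod.splits)
      ultimately show "(snd (bwalk N (fst (S c)) ! snd (S c)) = x') = (snd (bwalk M (fst c) ! snd c) = x)"
        using c x iE by (auto simp: inj_on_eq_iff)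
    qed
    moreover have "{c \<in> ?all M. snd (bwalk M (fst c) ! snd c) = x} = sides M x"
      "{c \<in> ?all N. snd (bwalk N (fst c) ! snd c) = x'} = sides N x'"
      unfolding sides_def by auto
    ultimately have "bij_betw S (sides M x) (sides N x')" by simp
    moreover have "finite (sides M x) \<and> card (sides M x) = 2"
      using is_map x(1) unfolding is_map_def by blast
    ultimately show "finite (sides N x') \<and> card (sides N x') = 2"
      using bij_betw_finite bij_betw_same_card by metis
  qed
  have c6: "\<forall>v \<in> verts N. \<exists>rs \<kappa>. distinct rs \<and> set rs = edges_at N v \<and>
        bij_betw \<kappa> (corners N v) {..<length rs} \<and>
        (\<forall>c \<in> corners N v. {corner_prev N c, corner_cur N c} =
            {rs ! \<kappa> c, rs ! ((\<kappa> c + 1) mod length rs)})"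
  proof
    fix v' assume "v' \<in> verts N"
    then obtain v where v: "v \<in> verts M" "v' = \<phi>V v" using sV by blast
    have "bij_betw T {c \<in> ?all M. fst (bwalk M (fst c) ! snd c) = v}
                     {c \<in> ?all N. fst (bwalk N (fst c) ! snd c) = v'}"
    proof (rule bij_betw_Collect[OF bT])
      fix c assume "c \<in> ?all M"
      then obtain f i where c: "c = (f, i)" "f \<in> faces M" "i < length (bwalk M f)" by auto
      have "fst (bwalk M f ! i) \<in> verts M" using vt_in_verts[OF c(2), of "int i"] by (simp add: wlk_nth c)
      moreover have "fst (bwalk N (fst (T c)) ! snd (T c)) = \<phi>V (fst (bwalk M f ! i))"
        using st[OF c(2)] c by (auto simp: T_def good_def split: prod.splits)
      ultimately show "(fst (bwalk N (fst (T c)) ! snd (T c)) = v') = (fst (bwalk M (fst c) ! snd c) = v)"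
        using c v iV by (auto simp: inj_on_eq_iff)
    qed
    moreover have "{c \<in> ?all M. fst (bwalk M (fst c) ! snd c) = v} = corners M v"
      "{c \<in> ?all N. fst (bwalk N (fst c) ! snd c) = v'} = corners N v'"
      unfolding corners_def by auto
    ultimately have bC: "bij_betw T (corners M v) (corners N v')" by simp
    have "\<exists>rs \<kappa>. distinct rs \<and> set rs = edges_at M v \<and>
        bij_betw \<kappa> (corners M v) {..<length rs} \<and>
        (\<forall>c \<in> corners M v. {corner_prev M c, corner_cur M c} =
            {rs ! \<kappa> c, rs ! ((\<kappa> c + 1) mod length rs)})"
      using is_map v unfolding is_map_def by simp
    then obtain rs \<kappa> where rs: "distinct rs" "set rs = edges_at M v"
      "bij_betw \<kappa> (corners M v) {..<length rs}"
      "\<And>c. c \<in> corners M v \<Longrightarrow> {corner_prev M c, corner_cur M c} =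
            {rs ! \<kappa> c, rs ! ((\<kappa> c + 1) mod length rs)}" by blast
    define \<kappa>' where "\<kappa>' = \<kappa> \<circ> inv_into (corners M v) T"
    have sube: "edges_at M v \<subseteq> edges M" by (auto simp: edges_at_def)
    have "distinct (map \<phi>E rs)"
      using rs(1,2) inj_on_subset[OF iE sube] by (simp add: distinct_map)
    moreover have "set (map \<phi>E rs) = edges_at N v'" using rs(2) ea[OF v(1)] v(2) by simp
    moreover have "bij_betw \<kappa>' (corners N v') {..<length (map \<phi>E rs)}"
      unfolding \<kappa>'_def using bij_betw_trans[OF bij_betw_inv_into[OF bC] rs(3)] by simp
    moreover have "{corner_prev N c', corner_cur N c'} =
        {map \<phi>E rs ! \<kappa>' c', map \<phi>E rs ! ((\<kappa>' c' + 1) mod length (map \<phi>E rs))}"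
      if c': "c' \<in> corners N v'" for c'
    proof -
      obtain c where c: "c \<in> corners M v" "c' = T c"
        using bC c' by (metis bij_betw_imp_surj_on imageE)
      have k: "\<kappa>' c' = \<kappa> c" unfolding \<kappa>'_def c(2) using bij_betw_inv_into_left[OF bC c(1)] by simp
      have kl: "\<kappa> c < length rs" using rs(3) c(1) by (auto dest: bij_betwE)
      then have kl': "(\<kappa> c + 1) mod length rs < length rs" by (intro mod_less_divisor) linarith
      obtain f i where fi: "c = (f, i)" by (cases c)
      then have f: "f \<in> faces M" "i < length (bwalk M f)" using c(1) by (auto simp: corners_def)
      have "{corner_prev N c', corner_cur N c'} = \<phi>E ` {corner_prev M c, corner_cur M c}"
        using st[OF f(1)] f(2) unfolding c(2) fi T_def good_def by (auto split: prod.splits)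
      also have "\<dots> = {\<phi>E (rs ! \<kappa> c), \<phi>E (rs ! ((\<kappa> c + 1) mod length rs))}"
        unfolding rs(4)[OF c(1)] by simp
      finally show ?thesis unfolding k using kl kl' by simp
    qed
    ultimately show "\<exists>rs \<kappa>. distinct rs \<and> set rs = edges_at N v' \<and>
        bij_betw \<kappa> (corners N v') {..<length rs} \<and>
        (\<forall>c \<in> corners N v'. {corner_prev N c, corner_cur N c} =
            {rs ! \<kappa> c, rs ! ((\<kappa> c + 1) mod length rs)})" by blast
  qed
  show ?thesis unfolding is_map_def using c1 c2 c3 c4 c5 c6 by blast
qed

section \<open>Group actions on maps\<close>

locale right_action = group G for G :: "('g, 'b) monoid_scheme" (structure) +
  fixes X :: "'x set" and act :: "'x \<Rightarrow> 'g \<Rightarrow> 'x"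
  assumes act_closed: "x \<in> X \<Longrightarrow> g \<in> carrier G \<Longrightarrow> act x g \<in> X"
    and act_one: "x \<in> X \<Longrightarrow> act x \<one> = x"
    and act_mult: "x \<in> X \<Longrightarrow> g \<in> carrier G \<Longrightarrow> h \<in> carrier G \<Longrightarrow> act (act x g) h = act x (g \<otimes> h)"
begin

lemma act_inv [simp]:
  assumes "x \<in> X" "g \<in> carrier G"
  shows "act (act x g) (inv g) = x" "act (act x (inv g)) g = x"
  using assms by (simp_all add: act_mult act_one)

lemma act_inj:
  assumes "x \<in> X" "y \<in> X" "g \<in> carrier G" "act x g = act y g"
  shows "x = y"
  using assms by (metis act_inv(1))

lemma stab_iff: "g \<in> stab G act x \<longleftrightarrow> g \<in> carrier G \<and> act x g = x"
  by (simp add: stab_def)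

lemma subgroup_stab: "x \<in> X \<Longrightarrow> subgroup (stab G act x) G"
proof (rule subgroupI)
  assume x: "x \<in> X"
  show "stab G act x \<subseteq> carrier G" by (auto simp: stab_def)
  show "stab G act x \<noteq> {}" using act_one[OF x] by (auto simp: stab_def)
  show "inv g \<in> stab G act x" if "g \<in> stab G act x" for g
    using that act_inv(1)[OF x, of g] by (simp add: stab_iff)
  show "g \<otimes> h \<in> stab G act x" if "g \<in> stab G act x" "h \<in> stab G act x" for g h
    using that act_mult[OF x, of g h] by (simp add: stab_iff)
qed

lemma act_pow_fixed: "x \<in> X \<Longrightarrow> g \<in> carrier G \<Longrightarrow> act x g = x \<Longrightarrow> act x (g [^] (i::int)) = x"
  using subgroup_int_pow_closed[OF subgroup_stab] by (simp add: stab_iff)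

lemma act_nat_pow_fixed: "x \<in> X \<Longrightarrow> g \<in> carrier G \<Longrightarrow> act x g = x \<Longrightarrow> act x (g [^] (i::nat)) = x"
  using act_pow_fixed[of x g "int i"] by (simp add: int_pow_int)

lemma act_eq_iff:
  assumes "x \<in> X" "g \<in> carrier G" "h \<in> carrier G"
  shows "act x g = act x h \<longleftrightarrow> act x (g \<otimes> inv h) = x"
proof
  assume "act x g = act x h"
  then have "act (act x g) (inv h) = x" using assms by simp
  then show "act x (g \<otimes> inv h) = x" using assms by (simp add: act_mult)
next
  assume a: "act x (g \<otimes> inv h) = x"
  have "act (act x (g \<otimes> inv h)) h = act x g"
    using assms by (simp add: act_mult m_assoc)
  then show "act x g = act x h" using a by simp
qed

text \<open>As \<open>y\<close> runs through the orbit of \<open>x\<close>, these sets are the right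
  cosets of the stabiliser. They identify points with cosets without any choice of representatives,
  and serve below as the maps on vertices, edges and faces.\<close>

definition transporter :: "'x \<Rightarrow> 'x \<Rightarrow> 'g set" where
  "transporter x y = {g \<in> carrier G. act x g = y}"

lemma transporter_act:
  assumes "x \<in> X" "g \<in> carrier G"
  shows "transporter x (act x g) = stab G act x #> g"
proof
  show "transporter x (act x g) \<subseteq> stab G act x #> g"
  proof
    fix h assume "h \<in> transporter x (act x g)"
    then have h: "h \<in> carrier G" "act x h = act x g" by (auto simp: transporter_def)
    then have "h \<otimes> inv g \<in> stab G act x" using act_eq_iff assms by (simp add: stab_iff)
    moreover have "h = (h \<otimes> inv g) \<otimes> g" using h assms by (simp add: m_assoc)
    ultimately show "h \<in> stab G act x #> g" unfolding r_coset_def by blast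
  qed
  show "stab G act x #> g \<subseteq> transporter x (act x g)"
    unfolding r_coset_def transporter_def using assms by (auto simp: stab_iff act_mult[symmetric])
qed

lemma transporter_inj:
  assumes "x \<in> X" "g \<in> carrier G" "transporter x (act x g) = transporter x y"
  shows "act x g = y"
  using assms unfolding transporter_def by blast

lemma bij_betw_transporter:
  assumes x: "x \<in> X" and tr: "\<And>y. y \<in> X \<Longrightarrow> \<exists>g \<in> carrier G. act x g = y"
  shows "bij_betw (transporter x) X (rcosets (stab G act x))"
  unfolding bij_betw_def
proof
  show "inj_on (transporter x) X"
    by (rule inj_onI) (metis tr transporter_inj x)
  show "transporter x ` X = rcosets (stab G act x)"
    unfolding RCOSETS_def using tr transporter_act[OF x] act_closed[OF x] by (auto simp: image_iff) metis+
qed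

end

locale map_action = surface_map M + group G
  for M :: "('v, 'e, 'f) pmap" and G :: "('g, 'b) monoid_scheme" (structure) +
  fixes aV :: "'v \<Rightarrow> 'g \<Rightarrow> 'v" and aE :: "'e \<Rightarrow> 'g \<Rightarrow> 'e" and aF :: "'f \<Rightarrow> 'g \<Rightarrow> 'f"
  assumes aut: "aut_action M G aV aE aF"
begin

sublocale V: right_action G "verts M" aV
proof
  show "aV v g \<in> verts M" if "v \<in> verts M" "g \<in> carrier G" for v g
    using aut that unfolding aut_action_def by meson
  show "aV v \<one> = v" if "v \<in> verts M" for v
    using aut that unfolding aut_action_def by meson
  show "aV (aV v g) h = aV v (g \<otimes> h)" if "v \<in> verts M" "g \<in> carrier G" "h \<in> carrier G" for v g h
    using aut that unfolding aut_action_def by meson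
qed

sublocale E: right_action G "edges M" aE
proof
  show "aE v g \<in> edges M" if "v \<in> edges M" "g \<in> carrier G" for v g
    using aut that unfolding aut_action_def by meson
  show "aE v \<one> = v" if "v \<in> edges M" for v
    using aut that unfolding aut_action_def by meson
  show "aE (aE v g) h = aE v (g \<otimes> h)" if "v \<in> edges M" "g \<in> carrier G" "h \<in> carrier G" for v g h
    using aut that unfolding aut_action_def by meson
qed

sublocale F: right_action G "faces M" aF
proof
  show "aF v g \<in> faces M" if "v \<in> faces M" "g \<in> carrier G" for v g
    using aut that unfolding aut_action_def by meson
  show "aF v \<one> = v" if "v \<in> faces M" for v
    using aut that unfolding aut_action_def by meson
  show "aF (aF v g) h = aF v (g \<otimes> h)" if "v \<in> faces M" "g \<in> carrier G" "h \<in> carrier G" for v g h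
    using aut that unfolding aut_action_def by meson
qed

lemma ends_act: "x \<in> edges M \<Longrightarrow> g \<in> carrier G \<Longrightarrow> ends M (aE x g) = (\<lambda>v. aV v g) ` ends M x"
  using aut unfolding aut_action_def by meson

lemma bwalk_act:
  "h \<in> faces M \<Longrightarrow> g \<in> carrier G \<Longrightarrow>
     walk_equiv (map_walk (\<lambda>v. aV v g) (\<lambda>x. aE x g) (bwalk M h)) (bwalk M (aF h g))"
  using aut unfolding aut_action_def by meson

lemma faithful:
  assumes "g \<in> carrier G" "\<And>v. v \<in> verts M \<Longrightarrow> aV v g = v" "\<And>x. x \<in> edges M \<Longrightarrow> aE x g = x"
    "\<And>h. h \<in> faces M \<Longrightarrow> aF h g = h"
  shows "g = \<one>"
  using aut assms unfolding aut_action_def by meson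

text \<open>Corners ignore the shift and reversal allowed in the action on boundary walks; this is
  the form in which that action is used from here on.\<close>

lemma corner_act:
  assumes "is_corner M h x v y" "g \<in> carrier G"
  shows "is_corner M (aF h g) (aE x g) (aV v g) (aE y g)"
proof -
  have h: "h \<in> faces M" and c: "corner_in (bwalk M h) x v y"
    using assms unfolding is_corner_def by auto
  let ?m = "map_walk (\<lambda>v. aV v g) (\<lambda>x. aE x g) (bwalk M h)"
  have "?m \<noteq> []" using bwalk_ne[OF h] by (simp add: map_walk_def)
  moreover have "corner_in ?m (aE x g) (aV v g) (aE y g)"
    unfolding corner_in_map_walk[OF bwalk_ne[OF h]] using c by auto
  ultimately have "corner_in (bwalk M (aF h g)) (aE x g) (aV v g) (aE y g)"
    using corner_in_equiv bwalk_act[OF h assms(2)] by metis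
  then show ?thesis using F.act_closed[OF h assms(2)] unfolding is_corner_def by simp
qed

lemma edges_at_act:
  assumes "x \<in> edges_at M v" "g \<in> carrier G"
  shows "aE x g \<in> edges_at M (aV v g)"
  using assms ends_act E.act_closed unfolding edges_at_def by auto

lemma face_edges_act:
  assumes "h \<in> faces M" "x \<in> face_edges M h" "g \<in> carrier G"
  shows "aE x g \<in> face_edges M (aF h g)"
proof -
  have x: "x \<in> edges M" using assms face_edges_subset by blast
  then obtain v where "v \<in> ends M x" using card_ends[OF x] by fastforce
  then obtain y where "is_corner M h x v y" using ex_corner assms by blast
  then show ?thesis using corner_act[OF _ assms(3)] is_cornerD(5) by blast
qed

lemma edges_at_act_image:
  assumes "v \<in> verts M" "g \<in> carrier G"
  shows "bij_betw (\<lambda>x. aE x g) (edges_at M v) (edges_at M (aV v g))"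
  unfolding bij_betw_def
proof
  show "inj_on (\<lambda>x. aE x g) (edges_at M v)"
    by (rule inj_onI) (use E.act_inj assms in \<open>auto simp: edges_at_def\<close>)
  show "(\<lambda>x. aE x g) ` edges_at M v = edges_at M (aV v g)"
  proof
    show "(\<lambda>x. aE x g) ` edges_at M v \<subseteq> edges_at M (aV v g)" using edges_at_act assms by blast
    show "edges_at M (aV v g) \<subseteq> (\<lambda>x. aE x g) ` edges_at M v"
    proof
      fix y assume y: "y \<in> edges_at M (aV v g)"
      then have "aE y (inv g) \<in> edges_at M v"
        using edges_at_act[OF y, of "inv g"] assms by simp
      moreover have "y = aE (aE y (inv g)) g" using y assms by (simp add: edges_at_def)
      ultimately show "y \<in> (\<lambda>x. aE x g) ` edges_at M v" by blast
    qed
  qed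
qed

end

section \<open>Rigidity of a vertex-rotary action\<close>

locale rotary_action = map_action M G aV aE aF
  for M :: "('v, 'e, 'f) pmap" and G :: "('g, 'b) monoid_scheme" (structure)
    and aV :: "'v \<Rightarrow> 'g \<Rightarrow> 'v" and aE :: "'e \<Rightarrow> 'g \<Rightarrow> 'e" and aF :: "'f \<Rightarrow> 'g \<Rightarrow> 'f" +
  fixes \<alpha> :: 'v and e :: 'e and f f' :: 'f
  assumes arc_trans: "arc_transitive M G aV aE"
    and cyclic_trans: "\<And>v. v \<in> verts M \<Longrightarrow> induces_cyclic G aE (stab G aV v) (edges_at M v)"
      "\<And>v. v \<in> verts M \<Longrightarrow> induces_transitive aE (stab G aV v) (edges_at M v)"
    and three_faces: "infinite (faces M) \<or> card (faces M) \<ge> 3"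
    and e: "e \<in> edges M" and \<alpha>: "\<alpha> \<in> ends M e"
    and ff': "f \<noteq> f'" and faces_e: "{h \<in> faces M. e \<in> face_edges M h} = {f, f'}"
begin

lemma \<alpha>V: "\<alpha> \<in> verts M" using e \<alpha> ends_subset by blast

lemma e_at: "e \<in> edges_at M \<alpha>" using e \<alpha> by (simp add: edges_at_def)

lemma arc_image:
  assumes "x \<in> edges M" "v \<in> ends M x"
  obtains g where "g \<in> carrier G" "aV \<alpha> g = v" "aE e g = x"
proof -
  have "v \<in> verts M" "x \<in> edges_at M v" using assms ends_subset by (auto simp: edges_at_def)
  then show ?thesis using arc_trans that \<alpha>V e_at unfolding arc_transitive_def by blast
qed

lemma edge_image:
  assumes "x \<in> edges M"
  obtains g where "g \<in> carrier G" "aE e g = x"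
proof -
  obtain v where "v \<in> ends M x" using card_ends[OF assms] by fastforce
  then show ?thesis using arc_image[OF assms] that by blast
qed

lemma vertex_edge:
  assumes "v \<in> verts M"
  shows "\<exists>x. x \<in> edges_at M v"
proof (cases "v = \<alpha>")
  case True
  then show ?thesis using e_at by blast
next
  case False
  then obtain u where "(u, v) \<in> adj_rel M"
    using connected[OF \<alpha>V assms] by (metis rtranclE)
  then show ?thesis unfolding adj_rel_def edges_at_def by auto
qed

lemma vertex_image:
  assumes "v \<in> verts M"
  obtains g where "g \<in> carrier G" "aV \<alpha> g = v"
proof -
  obtain x where "x \<in> edges M" "v \<in> ends M x" using vertex_edge[OF assms] by (auto simp: edges_at_def)
  then show ?thesis using arc_image that by blast
qed

lemma two_faces:
  assumes "x \<in> edges M"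
  obtains h1 h2 where "h1 \<noteq> h2" "{h \<in> faces M. x \<in> face_edges M h} = {h1, h2}"
proof -
  obtain g where g: "g \<in> carrier G" "aE e g = x" using edge_image[OF assms] by blast
  have fs: "f \<in> faces M" "f' \<in> faces M" "e \<in> face_edges M f" "e \<in> face_edges M f'"
    using faces_e by auto
  have "aF f g \<noteq> aF f' g" using F.act_inj[OF fs(1,2) g(1)] ff' by blast
  moreover have "{h \<in> faces M. x \<in> face_edges M h} = {aF f g, aF f' g}"
  proof
    show "{aF f g, aF f' g} \<subseteq> {h \<in> faces M. x \<in> face_edges M h}"
      using fs face_edges_act F.act_closed g by auto
    show "{h \<in> faces M. x \<in> face_edges M h} \<subseteq> {aF f g, aF f' g}"
    proof
      fix h assume "h \<in> {h \<in> faces M. x \<in> face_edges M h}"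
      then have h: "h \<in> faces M" "x \<in> face_edges M h" by auto
      have "aE x (inv g) = e" using g e by auto
      then have "aF h (inv g) \<in> {h \<in> faces M. e \<in> face_edges M h}"
        using face_edges_act[OF h inv_closed[OF g(1)]] F.act_closed[OF h(1) inv_closed[OF g(1)]] by simp
      then have "aF h (inv g) = f \<or> aF h (inv g) = f'" using faces_e by blast
      moreover have "h = aF (aF h (inv g)) g" using h g by simp
      ultimately show "h \<in> {aF f g, aF f' g}" by auto
    qed
  qed
  ultimately show ?thesis using that by blast
qed

text \<open>Two occurrences of an edge in the walk of \<open>h\<close> and one in the walk of its
  other face would make three sides, but every edge has exactly two.\<close>

lemma ed_inj:
  assumes h: "h \<in> faces M" and eq: "ed (bwalk M h) i = ed (bwalk M h) j"
  shows "i mod int (length (bwalk M h)) = j mod int (length (bwalk M h))"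
proof -
  let ?w = "bwalk M h"
  define x where "x = ed ?w i"
  have x: "x \<in> edges M" "x \<in> face_edges M h"
    using ed_in_edges[OF h] face_edges_ed[OF h] by (auto simp: x_def)
  obtain i' where i': "i' < length ?w" "wlk ?w i = ?w ! i'" "i mod int (length ?w) = int i'"
    using wlk_nat_index[OF bwalk_ne[OF h]] by blast
  obtain j' where j': "j' < length ?w" "wlk ?w j = ?w ! j'" "j mod int (length ?w) = int j'"
    using wlk_nat_index[OF bwalk_ne[OF h]] by blast
  obtain h2 where h2: "h2 \<noteq> h" "h2 \<in> faces M" "x \<in> face_edges M h2"
    using two_faces[OF x(1)] by (metis (mono_tags, lifting) insertI1 insert_commute mem_Collect_eq)
  then obtain k where k: "k < length (bwalk M h2)" "snd (bwalk M h2 ! k) = x"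
    unfolding face_edges_def by (metis imageE in_set_conv_nth)
  have sub: "{(h, i'), (h, j'), (h2, k)} \<subseteq> sides M x"
    using h h2 k i' j' eq unfolding sides_def x_def by auto
  have "finite (sides M x)" "card (sides M x) = 2"
    using is_map x(1) unfolding is_map_def by blast+
  then have "card {(h, i'), (h, j'), (h2, k)} \<le> 2" using card_mono sub by metis
  then have "i' = j'" using h2(1) by (auto simp: card_insert_if split: if_splits)
  then show ?thesis using i' j' by simp
qed

lemma corner_unique:
  assumes "is_corner M h x v y" "is_corner M h x v y'"
  shows "y = y'"
proof -
  let ?w = "bwalk M h"
  have h: "h \<in> faces M" using assms by (simp add: is_corner_def)
  have same: "ed ?w i = ed ?w j \<Longrightarrow> wlk ?w (i + d) = wlk ?w (j + d)" for i j d
    by (rule wlk_cong) (metis ed_inj[OF h] mod_add_left_eq)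
  obtain j where j: "vt ?w j = v" "x = ed ?w (j - 1) \<and> y = ed ?w j \<or> x = ed ?w j \<and> y = ed ?w (j - 1)"
    using assms(1) unfolding is_corner_def corner_in_def by blast
  obtain i where i: "vt ?w i = v" "x = ed ?w (i - 1) \<and> y' = ed ?w i \<or> x = ed ?w i \<and> y' = ed ?w (i - 1)"
    using assms(2) unfolding is_corner_def corner_in_def by blast
  \<comment> \<open>If one corner has \<open>x\<close> behind it and the other has \<open>x\<close>
    ahead, both corners sit at the same vertex but at opposite ends of \<open>x\<close>, which would
    then be a loop.\<close>
  have bad: False if "ed ?w (p - 1) = ed ?w q" "vt ?w p = vt ?w q" for p q
    using same[OF that(1), of 1] vt_neq[OF h, of q] that(2) by simp
  from j(2) i(2) show ?thesis
  proof (elim disjE conjE)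
    assume "x = ed ?w (j - 1)" "y = ed ?w j" "x = ed ?w (i - 1)" "y' = ed ?w i"
    then show ?thesis using same[of "j - 1" "i - 1" 1] by simp
  next
    assume "x = ed ?w j" "y = ed ?w (j - 1)" "x = ed ?w i" "y' = ed ?w (i - 1)"
    then show ?thesis using same[of j i "- 1"] by simp
  qed (use bad i(1) j(1) in metis)+
qed

lemma valency_const:
  assumes "v \<in> verts M"
  shows "card (edges_at M v) = card (edges_at M \<alpha>)"
proof -
  obtain g where g: "g \<in> carrier G" "aV \<alpha> g = v" using vertex_image[OF assms] .
  show ?thesis using bij_betw_same_card[OF edges_at_act_image[OF \<alpha>V g(1)]] g(2) by simp
qed

text \<open>If valencies were at most 2, a face containing one edge at a vertex would contain all of
  them, and by connectedness both \<open>f\<close> and \<open>f'\<close> would contain every edge.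
  Since an edge lies on only two faces, no third face could exist.\<close>

lemma valency_ge_3:
  assumes "v \<in> verts M"
  shows "card (edges_at M v) \<ge> 3"
proof (rule ccontr)
  assume "\<not> card (edges_at M v) \<ge> 3"
  then have small: "card (edges_at M u) \<le> 2" if "u \<in> verts M" for u
    using valency_const[OF assms] valency_const[OF that] by simp
  have all: "edges M \<subseteq> face_edges M h" if h: "h \<in> faces M" "e \<in> face_edges M h" for h
  proof -
    have star: "edges_at M u \<subseteq> face_edges M h" if u: "u \<in> verts M" "x \<in> edges_at M u" "x \<in> face_edges M h" for u x
    proof -
      obtain y where y: "is_corner M h x u y"
        using ex_corner[OF h(1) u(3)] u(2) by (auto simp: edges_at_def)
      then show ?thesis using corner_small_valency[OF small[OF u(1)] y] is_cornerD(5,6)[OF y] by simp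
    qed
    have "edges_at M u \<subseteq> face_edges M h" if "u \<in> verts M" for u
      using connected[OF \<alpha>V that]
    proof (induction rule: rtrancl_induct)
      case base
      then show ?case using star[OF \<alpha>V e_at h(2)] .
    next
      case (step y z)
      then obtain x where x: "x \<in> edges M" "ends M x = {y, z}" unfolding adj_rel_def by auto
      then have "x \<in> edges_at M y" "x \<in> edges_at M z" "z \<in> verts M"
        using ends_subset[OF x(1)] by (auto simp: edges_at_def)
      then show ?case using star step.IH by blast
    qed
    moreover have "\<exists>u \<in> verts M. x \<in> edges_at M u" if x: "x \<in> edges M" for x
      using edge_image[OF x] edges_at_act[OF e_at] V.act_closed[OF \<alpha>V] by metis
    ultimately show ?thesis by blast
  qed
  have fs: "f \<in> faces M" "f' \<in> faces M" "e \<in> face_edges M f" "e \<in> face_edges M f'"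
    using faces_e by auto
  have "faces M \<subseteq> {f, f'}"
  proof
    fix h assume h: "h \<in> faces M"
    define x where "x = ed (bwalk M h) 0"
    have x: "x \<in> edges M" "x \<in> face_edges M h"
      using ed_in_edges[OF h] face_edges_ed[OF h] by (auto simp: x_def)
    obtain h1 h2 where hh: "{h \<in> faces M. x \<in> face_edges M h} = {h1, h2}"
      using two_faces[OF x(1)] by metis
    have "x \<in> face_edges M f" "x \<in> face_edges M f'" using all x(1) fs by blast+
    then have "{f, f', h} \<subseteq> {h1, h2}" unfolding hh[symmetric] using x h fs by blast
    then show "h \<in> {f, f'}" using ff' by blast
  qed
  then have "finite (faces M)" "card (faces M) \<le> card {f, f'}"
    by (auto intro: finite_subset card_mono)
  then show False using three_faces ff' by simp
qed

lemma corner_face_eq: "is_corner M h x v y \<Longrightarrow> is_corner M h' x v y \<Longrightarrow> h = h'"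
  by (rule corner_determines_face[OF valency_ge_3[OF is_cornerD(3)]])

text \<open>Being fixed together with all incident edges passes from a vertex to its neighbour: the
  common edge is fixed, and a second fixed edge at the neighbour comes from a face through that
  edge.\<close>

lemma rigid:
  assumes g: "g \<in> carrier G" and v: "v \<in> verts M" "aV v g = v"
    and fixed: "\<And>x. x \<in> edges_at M v \<Longrightarrow> aE x g = x"
  shows "g = \<one>"
proof -
  have star: "aV z g = z \<and> (\<forall>x \<in> edges_at M z. aE x g = x)" if "z \<in> verts M" for z
    using connected[OF v(1) that]
  proof (induction rule: rtrancl_induct)
    case base
    then show ?case using v(2) fixed by blast
  next
    case (step y z)
    then obtain x where x: "x \<in> edges M" "ends M x = {y, z}" unfolding adj_rel_def by auto
    have at: "x \<in> edges_at M y" "x \<in> edges_at M z" "y \<in> verts M" "z \<in> verts M"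
      using x ends_subset[OF x(1)] by (auto simp: edges_at_def)
    have xg: "aE x g = x" and yg: "aV y g = y" using step.IH at(1) by auto
    have "y \<noteq> z" using card_ends[OF x(1)] x(2) by auto
    moreover have "{y, z} = {y, aV z g}" using ends_act[OF x(1) g] xg yg x(2) by simp
    ultimately have zg: "aV z g = z" by (metis doubleton_eq_iff)
    obtain u h where h: "is_corner M h x y u"
      using two_neighbours[OF at(3,1) valency_ge_3[OF at(3)]] by metis
    have "aE u g = u" using step.IH is_cornerD(2)[OF h] by blast
    then have hg: "aF h g = h" using corner_act[OF h g] h xg yg corner_face_eq by metis
    \<comment> \<open>The fixed face \<open>h\<close> is followed across \<open>x\<close>;
      uniqueness of its corner at \<open>z\<close> next to \<open>x\<close> makes \<open>r\<close>
      fixed as well.\<close>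
    obtain r where r: "is_corner M h x z r"
      using ex_corner[OF is_cornerD(4,5)[OF h]] x(2) by blast
    have rg: "aE r g = r" using corner_act[OF r g] r xg zg hg corner_unique by metis
    have "edges_at M z \<subseteq> {p. aE p g = p}"
    proof (rule edges_at_closed_under_corner_pairs[OF at(4) r])
      fix h h' p q t
      assume a: "p \<in> {p. aE p g = p}" "q \<in> {p. aE p g = p}" "is_corner M h p z q" "is_corner M h' q z t"
      show "t \<in> {p. aE p g = p}"
      proof (cases "t = p")
        case False
        \<comment> \<open>The edge \<open>q\<close> has only the two neighbours \<open>p\<close> and
          \<open>t\<close>. Both \<open>q\<close> and \<open>p\<close> are fixed, so the image of
          \<open>t\<close> is a neighbour of \<open>q\<close> other than \<open>p\<close>, hence
          \<open>t\<close> itself.\<close>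
        obtain u1 u2 where u: "\<And>y. (\<exists>h. is_corner M h q z y) \<longleftrightarrow> y = u1 \<or> y = u2"
          using two_neighbours[OF at(4) is_cornerD(2)[OF a(3)] valency_ge_3[OF at(4)]] by metis
        have "is_corner M (aF h' g) q z (aE t g)" using corner_act[OF a(4) g] a(2) zg by simp
        moreover have "aE t g \<noteq> p"
        proof
          assume "aE t g = p"
          then have "aE t g = aE p g" using a(1) by simp
          then have "t = p"
            using E.act_inj[OF _ _ g] is_cornerD(2)[OF a(4)] is_cornerD(1)[OF a(3)] by (auto simp: edges_at_def)
          then show False using False by simp
        qed
        ultimately show ?thesis
          using u[of t] u[of p] u[of "aE t g"] a(3,4) is_corner_sym[OF a(3)] False by auto
      qed (use a in simp)
    qed (use xg rg in auto)
    then show ?case using zg by blast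
  qed
  show ?thesis
  proof (rule faithful[OF g])
    show "aV z g = z" if "z \<in> verts M" for z using star[OF that] by blast
    show eg: "aE x g = x" if x: "x \<in> edges M" for x
      using edge_image[OF x] edges_at_act[OF e_at] V.act_closed[OF \<alpha>V] star by metis
    show "aF h g = h" if h: "h \<in> faces M" for h
    proof -
      let ?w = "bwalk M h"
      have c: "is_corner M h (ed ?w (- 1)) (vt ?w 0) (ed ?w 0)"
        using h unfolding is_corner_def corner_in_def by (auto intro!: exI[of _ 0])
      then show ?thesis
        using corner_act[OF c g] corner_face_eq star[OF vt_in_verts[OF h]] eg[OF ed_in_edges[OF h]] by metis
    qed
  qed
qed

text \<open>A transitive abelian permutation group is regular: what fixes \<open>x\<close> commutes
  with an element taking \<open>x\<close> to \<open>y\<close>, hence fixes \<open>y\<close>. Only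
  the actions on the edges at \<open>v\<close> are known to commute at this point, and
  \<open>rigid\<close> converts trivial action into triviality.\<close>

lemma arc_stab_trivial:
  assumes "g \<in> carrier G" "v \<in> verts M" "x \<in> edges_at M v" "aV v g = v" "aE x g = x"
  shows "g = \<one>"
proof (rule rigid[OF assms(1,2,4)])
  fix y assume y: "y \<in> edges_at M v"
  obtain h where h: "h \<in> carrier G" "aV v h = v" and
    gen: "\<And>k. k \<in> stab G aV v \<Longrightarrow> \<exists>i::int. \<forall>x \<in> edges_at M v. aE x k = aE x (h [^] i)"
    using cyclic_trans(1)[OF assms(2)] unfolding induces_cyclic_def stab_def by auto
  obtain k where k: "k \<in> stab G aV v" "aE x k = y"
    using cyclic_trans(2)[OF assms(2)] assms(3) y unfolding induces_transitive_def by blast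
  obtain i :: int where i: "\<forall>x \<in> edges_at M v. aE x k = aE x (h [^] i)" using gen[OF k(1)] by blast
  obtain j :: int where j: "\<forall>x \<in> edges_at M v. aE x g = aE x (h [^] j)"
    using gen[of g] assms by (auto simp: stab_def)
  have x: "x \<in> edges M" using assms by (simp add: edges_at_def)
  have "aE y g = aE y (h [^] j)" using j y by blast
  also have "y = aE x (h [^] i)" using i k assms by auto
  also have "aE (aE x (h [^] i)) (h [^] j) = aE (aE x (h [^] j)) (h [^] i)"
    using x h by (simp add: E.act_mult int_pow_mult[symmetric] add.commute)
  also have "aE x (h [^] j) = x" using j assms by auto
  finally show "aE y g = y" using i k assms by auto
qed

end

section \<open>Generators of the stabilisers\<close>

text \<open>A cyclic group has at most one involution, stated for the set \<open>P\<close> of exponents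
that annihilate a generator.\<close>
lemma int_subgroup_unique_involution:
  fixes P :: "int \<Rightarrow> bool"
  assumes diff: "\<And>a b. P a \<Longrightarrow> P b \<Longrightarrow> P (a - b)"
    and ij: "P (2 * i)" "P (2 * j)" "\<not> P i" "\<not> P j"
  shows "P (i - j)"
proof -
  have zero: "P 0" using diff[OF ij(1,1)] by simp
  have neg: "P (- a)" if "P a" for a using diff[OF zero that] by simp
  have add: "P (a + b)" if "P a" "P b" for a b using diff[OF that(1) neg[OF that(2)]] by simp
  have mult: "P (k * a)" if "P a" for k a
  proof (induction k rule: int_induct[of _ 0])
    case base
    then show ?case using zero by simp
  next
    case (step1 k)
    then show ?case using add[of "k * a" a] that by (simp add: algebra_simps)
  next
    case (step2 k)
    then show ?case using diff[of "k * a" a] that by (simp add: algebra_simps)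
  qed
  \<comment> \<open>Bezout gives \<open>P (2 * d)\<close>, so all even multiples of \<open>d\<close>
    satisfy \<open>P\<close>. Then \<open>i\<close> and \<open>j\<close> are odd multiples of
    \<open>d\<close>, and their difference is an even one.\<close>
  define d where "d = gcd i j"
  obtain x y where xy: "x * i + y * j = d" unfolding d_def using bezout_int by metis
  obtain p where p: "i = d * p" unfolding d_def by (metis dvdE gcd_dvd1)
  obtain q where q: "j = d * q" unfolding d_def by (metis dvdE gcd_dvd2)
  have "P (x * (2 * i) + y * (2 * j))" using add mult ij by blast
  moreover have "x * (2 * i) + y * (2 * j) = 2 * d" using xy by (simp add: algebra_simps)
  ultimately have d2: "P (2 * d)" by simp
  have even: "P (d * c)" if "even c" for c
  proof -
    obtain c' where "c = 2 * c'" using \<open>even c\<close> by (rule evenE)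
    then show ?thesis using mult[OF d2, of c'] by (simp add: algebra_simps)
  qed
  have "odd p" "odd q" using even[of p] even[of q] ij(3,4) p q by auto
  then have "P (d * (p - q))" using even by simp
  then show ?thesis using p q by (simp add: algebra_simps)
qed

context group
begin

lemma inv_cancel_left:
  assumes "x \<in> carrier G" "y \<in> carrier G"
  shows "x \<otimes> (inv x \<otimes> y) = y" "inv x \<otimes> (x \<otimes> y) = y"
  using assms by (simp_all add: m_assoc[symmetric])

lemma conj_nat_pow:
  assumes "x \<in> carrier G" "g \<in> carrier G"
  shows "(inv g \<otimes> x \<otimes> g) [^] (n::nat) = inv g \<otimes> x [^] n \<otimes> g"
proof (induction n)
  case 0
  then show ?case using assms by simp
next
  case (Suc n)
  have "(inv g \<otimes> x \<otimes> g) [^] Suc n = inv g \<otimes> x [^] n \<otimes> g \<otimes> (inv g \<otimes> x \<otimes> g)"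
    by (simp only: nat_pow_Suc Suc)
  then show ?case using assms by (simp add: m_assoc inv_cancel_left)
qed

lemma generate_involution:
  assumes "g \<in> carrier G" "g \<otimes> g = \<one>"
  shows "generate G {g} = {\<one>, g}"
proof
  have "inv g = g" using assms by (metis inv_equality)
  then have "subgroup {\<one>, g} G" using assms by (intro subgroupI) auto
  then show "generate G {g} \<subseteq> {\<one>, g}" by (intro generate_subgroup_incl) auto
  show "{\<one>, g} \<subseteq> generate G {g}" by (auto intro: generate.intros)
qed

lemma ord_eq_2_iff:
  assumes "g \<in> carrier G"
  shows "ord g = 2 \<longleftrightarrow> g \<noteq> \<one> \<and> g \<otimes> g = \<one>"
proof
  assume o: "ord g = 2"
  have "g [^] (2::nat) = \<one>" using pow_eq_id[OF assms, of 2] o by simp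
  then have "g \<otimes> g = \<one>" using assms by (simp add: numeral_2_eq_2)
  moreover have "g \<noteq> \<one>" using o by auto
  ultimately show "g \<noteq> \<one> \<and> g \<otimes> g = \<one>" by blast
next
  assume "g \<noteq> \<one> \<and> g \<otimes> g = \<one>"
  then show "ord g = 2" using generate_pow_card[OF assms] generate_involution[OF assms] by auto
qed

end

context rotary_action
begin

text \<open>Arc-transitivity supplies an element reversing \<open>e\<close>. Its square fixes an arc
  and is trivial, and any other element reversing \<open>e\<close> differs from it by an element
  fixing an arc.\<close>

lemma edge_stab_generator: "\<exists>z. stab G aE e = generate G {z} \<and> ord z = 2"
proof -
  obtain \<beta> where \<beta>: "ends M e = {\<alpha>, \<beta>}" "\<alpha> \<noteq> \<beta>"
    using card_ends[OF e] \<alpha> unfolding card_2_iff by (metis doubleton_eq_iff insertE singletonD)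
  obtain z where z: "z \<in> carrier G" "aV \<alpha> z = \<beta>" "aE e z = e" using arc_image[OF e, of \<beta>] \<beta> by auto
  have \<beta>V: "\<beta> \<in> verts M" "e \<in> edges_at M \<beta>" using \<beta> e ends_subset by (auto simp: edges_at_def)
  have "aV \<beta> z \<in> ends M e" using ends_act[OF e z(1)] z(3) \<beta> by auto
  moreover have "aV \<beta> z \<noteq> \<beta>" using V.act_inj[OF \<beta>V(1) \<alpha>V z(1)] z(2) \<beta> by auto
  ultimately have bz: "aV \<beta> z = \<alpha>" using \<beta> by blast
  have zz: "z \<otimes> z = \<one>"
  proof (rule arc_stab_trivial[OF _ \<alpha>V e_at])
    show "aV \<alpha> (z \<otimes> z) = \<alpha>" using V.act_mult[OF \<alpha>V z(1) z(1)] z bz by simp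
    show "aE e (z \<otimes> z) = e" using E.act_mult[OF e z(1) z(1)] z by simp
  qed (use z in simp)
  have zne: "z \<noteq> \<one>" using z(2) \<beta>(2) V.act_one[OF \<alpha>V] by auto
  have "stab G aE e = {\<one>, z}"
  proof
    show "{\<one>, z} \<subseteq> stab G aE e" using z E.act_one[OF e] by (auto simp: stab_def)
    show "stab G aE e \<subseteq> {\<one>, z}"
    proof
      fix k assume "k \<in> stab G aE e"
      then have k: "k \<in> carrier G" "aE e k = e" by (auto simp: stab_def)
      have "aV \<alpha> k \<in> ends M e" using ends_act[OF e k(1)] k(2) \<alpha> by auto
      then have "aV \<alpha> k = \<alpha> \<or> aV \<alpha> k = \<beta>" using \<beta> by simp
      then show "k \<in> {\<one>, z}"
      proof
        assume "aV \<alpha> k = \<alpha>"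
        then show ?thesis using arc_stab_trivial[OF k(1) \<alpha>V e_at] k by simp
      next
        assume "aV \<alpha> k = \<beta>"
        then have "aV \<alpha> (k \<otimes> z) = \<alpha>" using V.act_mult[OF \<alpha>V k(1) z(1)] bz by simp
        moreover have "aE e (k \<otimes> z) = e" using E.act_mult[OF e k(1) z(1)] k z by simp
        ultimately have "k \<otimes> z = \<one>" using arc_stab_trivial[OF _ \<alpha>V e_at] k z by simp
        then have "k = inv z" using k z by (metis inv_equality)
        then have "k = z" using z zz by (metis inv_equality)
        then show ?thesis by simp
      qed
    qed
  qed
  then show ?thesis
    using generate_involution[OF z(1) zz] ord_eq_2_iff[OF z(1)] zz zne by auto
qed

lemma neighbours_e:
  obtains u1 u2 where "u1 \<noteq> u2" "u1 \<noteq> e" "u2 \<noteq> e" "\<And>y. (\<exists>h. is_corner M h e \<alpha> y) \<longleftrightarrow> y = u1 \<or> y = u2"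
  by (rule two_neighbours[OF \<alpha>V e_at valency_ge_3[OF \<alpha>V]]) (rule that)

lemma stab_\<alpha>_eq:
  assumes "g \<in> stab G aV \<alpha>" "h \<in> stab G aV \<alpha>" "aE e g = aE e h"
  shows "g = h"
proof -
  have gh: "g \<in> carrier G" "h \<in> carrier G" "aV \<alpha> g = aV \<alpha> h" using assms by (auto simp: stab_def)
  have "aV \<alpha> (g \<otimes> inv h) = \<alpha>" using V.act_eq_iff[OF \<alpha>V gh(1,2)] gh by simp
  moreover have "aE e (g \<otimes> inv h) = e" using E.act_eq_iff[OF e gh(1,2)] assms by simp
  ultimately have "g \<otimes> inv h = \<one>" using arc_stab_trivial[OF _ \<alpha>V e_at] gh by simp
  then show ?thesis using gh by (metis inv_equality inv_inv inv_closed)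
qed

text \<open>The neighbours \<open>e\<^sup>p\<close>, \<open>e\<^sup>q\<close> of \<open>e\<close> around \<open>\<alpha>\<close> satisfy \<open>{p\<^sup>-\<^sup>1, q\<^sup>-\<^sup>1} = {p, q}\<close>; as the
cyclic group \<open>G\<^sub>\<alpha>\<close> has at most one involution, \<open>q = p\<^sup>-\<^sup>1\<close>.\<close>
lemma one_step_rotation:
  obtains p where "p \<in> carrier G" "aV \<alpha> p = \<alpha>" "aE e p \<noteq> aE e (inv p)"
    "\<And>y. (\<exists>h. is_corner M h e \<alpha> y) \<longleftrightarrow> y = aE e p \<or> y = aE e (inv p)"
proof -
  have sub: "subgroup (stab G aV \<alpha>) G" using V.subgroup_stab[OF \<alpha>V] .
  obtain h where h: "h \<in> stab G aV \<alpha>" and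
    gen0: "\<And>k. k \<in> stab G aV \<alpha> \<Longrightarrow> \<exists>i::int. \<forall>x \<in> edges_at M \<alpha>. aE x k = aE x (h [^] i)"
    using cyclic_trans(1)[OF \<alpha>V] unfolding induces_cyclic_def by blast
  have hc: "h \<in> carrier G" using h by (simp add: stab_def)
  have gen: "\<exists>i::int. k = h [^] i" if "k \<in> stab G aV \<alpha>" for k
    using gen0[OF that] stab_\<alpha>_eq[OF that] subgroup_int_pow_closed[OF sub h] e_at by blast
  obtain u1 u2 where u: "u1 \<noteq> u2" "\<And>y. (\<exists>h. is_corner M h e \<alpha> y) \<longleftrightarrow> y = u1 \<or> y = u2"
    and ue: "u1 \<noteq> e" "u2 \<noteq> e"
    by (rule neighbours_e) (rule that)
  have "u1 \<in> edges_at M \<alpha>" "u2 \<in> edges_at M \<alpha>" using u(2) is_cornerD(2) by blast+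
  then obtain p q where p: "p \<in> stab G aV \<alpha>" "aE e p = u1" and q: "q \<in> stab G aV \<alpha>" "aE e q = u2"
    using cyclic_trans(2)[OF \<alpha>V] e_at unfolding induces_transitive_def by blast
  \<comment> \<open>Applying the inverse of \<open>k\<close> to the corner between \<open>e\<close>
    and its image under \<open>k\<close> gives a corner between \<open>e\<close> and its image under
    that inverse.\<close>
  have flip: "aE e (inv k) = u1 \<or> aE e (inv k) = u2" if k: "k \<in> stab G aV \<alpha>" "aE e k = u1 \<or> aE e k = u2" for k
  proof -
    have kc: "k \<in> carrier G" "aV \<alpha> k = \<alpha>" using k by (auto simp: stab_def)
    then have ki: "aV \<alpha> (inv k) = \<alpha>" using V.act_inv(1)[OF \<alpha>V kc(1)] by simp
    obtain h where "is_corner M h e \<alpha> (aE e k)" using u(2) k(2) by blast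
    from is_corner_sym[OF corner_act[OF this inv_closed[OF kc(1)]]]
    have "is_corner M (aF h (inv k)) e \<alpha> (aE e (inv k))"
      using ki e kc by simp
    then show ?thesis using u(2) by blast
  qed
  have inS: "inv k \<in> stab G aV \<alpha>" if "k \<in> stab G aV \<alpha>" for k using subgroup.m_inv_closed[OF sub that] .
  have pc: "p \<in> carrier G" "q \<in> carrier G" "aV \<alpha> p = \<alpha>" using p q by (auto simp: stab_def)
  have "inv p = q"
  proof (rule ccontr)
    \<comment> \<open>Inversion would then fix both \<open>p\<close> and \<open>q\<close>, giving
      two different involutions in a cyclic group.\<close>
    assume ne: "inv p \<noteq> q"
    then have "aE e (inv p) \<noteq> u2" using stab_\<alpha>_eq[OF inS[OF p(1)] q(1)] q(2) by auto
    then have "aE e (inv p) = aE e p" using flip[OF p(1)] p(2) by auto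
    then have ip: "inv p = p" using stab_\<alpha>_eq[OF inS[OF p(1)] p(1)] by simp
    have "inv q \<noteq> p" using ne pc by auto
    then have "aE e (inv q) \<noteq> u1" using stab_\<alpha>_eq[OF inS[OF q(1)] p(1)] p(2) by auto
    then have "aE e (inv q) = aE e q" using flip[OF q(1)] q(2) by auto
    then have iq: "inv q = q" using stab_\<alpha>_eq[OF inS[OF q(1)] q(1)] by simp
    obtain i :: int where i: "p = h [^] i" using gen[OF p(1)] by blast
    obtain j :: int where j: "q = h [^] j" using gen[OF q(1)] by blast
    have sq: "h [^] (2 * k) = h [^] k \<otimes> h [^] k" for k :: int
      by (metis int_pow_mult[OF hc] mult_2)
    have "p \<noteq> \<one>" "q \<noteq> \<one>" using p q ue E.act_one[OF e] by auto
    moreover have "p \<otimes> p = \<one>" "q \<otimes> q = \<one>" using ip iq pc by (metis r_inv)+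
    ultimately have "h [^] (i - j) = \<one>"
      using int_subgroup_unique_involution[of "\<lambda>k. h [^] k = \<one>" i j]
        int_pow_diff[OF hc] i j sq by (metis r_inv one_closed)
    then have "p \<otimes> inv q = \<one>" using i j int_pow_diff[OF hc] by metis
    then have "p = q" using iq pc by (metis inv_equality)
    then show False using p q u by simp
  qed
  then show ?thesis using that[OF pc(1,3)] u p q by simp
qed

text \<open>Both \<open>p\<close> and \<open>p\<^sup>-\<^sup>1\<close> generate \<open>G\<^sub>\<alpha>\<close>; one of them maps \<open>f\<close> to \<open>f'\<close>.\<close>
lemma vertex_stab_generator:
  "\<exists>a. stab G aV \<alpha> = generate G {a} \<and> rot_step M aE \<alpha> e a \<and> aF f a = f'"
proof -
  obtain p where p: "p \<in> carrier G" "aV \<alpha> p = \<alpha>" "aE e p \<noteq> aE e (inv p)"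
    and nb: "\<And>y. (\<exists>h. is_corner M h e \<alpha> y) \<longleftrightarrow> y = aE e p \<or> y = aE e (inv p)"
    by (rule one_step_rotation) (rule that)
  have ps: "p \<in> stab G aV \<alpha>" using p by (simp add: stab_def)
  have sub: "subgroup (stab G aV \<alpha>) G" using V.subgroup_stab[OF \<alpha>V] .
  have powS: "p [^] i \<in> stab G aV \<alpha>" for i :: int using subgroup_int_pow_closed[OF sub ps] .
  have ip: "aV \<alpha> (inv p) = \<alpha>" using V.act_inv(1)[OF \<alpha>V p(1)] p(2) by simp
  \<comment> \<open>Translating by a power of \<open>p\<close> brings any corner back to one at
    \<open>e\<close>, so the orbit of \<open>e\<close> under powers of \<open>p\<close> is closed
    under passing to neighbours.\<close>
  have "edges_at M \<alpha> \<subseteq> range (\<lambda>i::int. aE e (p [^] i))"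
  proof (rule edges_at_closed_under_corners[OF \<alpha>V e_at])
    show "e \<in> range (\<lambda>i::int. aE e (p [^] i))"
      using E.act_one[OF e] by (intro image_eqI[of _ _ 0]) auto
    fix h x y assume a: "x \<in> range (\<lambda>i::int. aE e (p [^] i))" "is_corner M h x \<alpha> y"
    then obtain i :: int where i: "x = aE e (p [^] i)" by blast
    have pi: "p [^] i \<in> carrier G" "aV \<alpha> (inv (p [^] i)) = \<alpha>"
      using p powS[of "- i"] by (auto simp: stab_def int_pow_neg)
    have y: "y \<in> edges M" using is_cornerD(2)[OF a(2)] by (simp add: edges_at_def)
    have "is_corner M (aF h (inv (p [^] i))) e \<alpha> (aE y (inv (p [^] i)))"
      using corner_act[OF a(2), of "inv (p [^] i)"] pi i e by simp
    then have "aE y (inv (p [^] i)) = aE e p \<or> aE y (inv (p [^] i)) = aE e (inv p)" using nb by blast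
    then have "y = aE (aE e p) (p [^] i) \<or> y = aE (aE e (inv p)) (p [^] i)"
      using E.act_inv(2)[OF y pi(1)] by metis
    moreover have "p [^] (1 + i) = p \<otimes> p [^] i" "p [^] (- 1 + i) = inv p \<otimes> p [^] i"
      using int_pow_mult[OF p(1), of 1 i] int_pow_mult[OF p(1), of "- 1" i] p(1)
      by (simp_all add: int_pow_neg)
    ultimately have "y = aE e (p [^] (1 + i)) \<or> y = aE e (p [^] (- 1 + i))"
      using p e by (simp add: E.act_mult)
    then show "y \<in> range (\<lambda>i::int. aE e (p [^] i))" by blast
  qed
  then have "k \<in> generate G {p}" if k: "k \<in> stab G aV \<alpha>" for k
  proof -
    have "aE e k \<in> edges_at M \<alpha>" using edges_at_act[OF e_at, of k] k by (simp add: stab_def)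
    then obtain i :: int where "aE e k = aE e (p [^] i)"
      using \<open>edges_at M \<alpha> \<subseteq> _\<close> by blast
    then have "k = p [^] i" using stab_\<alpha>_eq[OF k powS] by blast
    then show ?thesis using generate_pow[OF p(1)] by blast
  qed
  moreover have "generate G {p} \<subseteq> stab G aV \<alpha>" using generate_subgroup_incl[OF _ sub] ps by simp
  ultimately have gen: "stab G aV \<alpha> = generate G {p}" by blast
  have "generate G {inv p} = generate G {p}"
  proof
    have "inv p \<in> generate G {p}" by (rule generate.inv) simp
    then show "generate G {inv p} \<subseteq> generate G {p}"
      using generate_subgroup_incl[OF _ generate_is_subgroup] p by simp
    have "inv (inv p) \<in> generate G {inv p}" by (rule generate.inv) simp
    then show "generate G {p} \<subseteq> generate G {inv p}"
      using generate_subgroup_incl[OF _ generate_is_subgroup] p by simp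
  qed
  with gen have gen': "stab G aV \<alpha> = generate G {inv p}" by simp
  \<comment> \<open>The two corners at \<open>e\<close> on either side are exchanged in the sense
    that \<open>p\<close> carries the face of the second to that of the first, and its inverse does
    the opposite. Hence one of the two generators takes \<open>f\<close> to
    \<open>f'\<close>.\<close>
  obtain F0 where F0: "is_corner M F0 e \<alpha> (aE e p)" using nb by blast
  obtain F1 where F1: "is_corner M F1 e \<alpha> (aE e (inv p))" using nb by blast
  have rs: "rot_step M aE \<alpha> e p" "rot_step M aE \<alpha> e (inv p)"
    unfolding rot_step_def ex_corner_iff using F0 F1 by blast+
  have "F0 \<noteq> F1" using corner_unique F0 F1 p(3) by metis
  moreover have "F0 \<in> {f, f'}" "F1 \<in> {f, f'}"
    unfolding faces_e[symmetric] using is_cornerD(4,5)[OF F0] is_cornerD(4,5)[OF F1] by auto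
  moreover have "is_corner M (aF F1 p) e \<alpha> (aE e p)"
    using is_corner_sym[OF corner_act[OF F1 p(1)]] p e by simp
  then have "aF F1 p = F0" using corner_face_eq F0 by blast
  moreover have "is_corner M (aF F0 (inv p)) e \<alpha> (aE e (inv p))"
    using is_corner_sym[OF corner_act[OF F0 inv_closed[OF p(1)]]] ip p e by simp
  then have "aF F0 (inv p) = F1" using corner_face_eq F1 by blast
  ultimately have "aF f p = f' \<or> aF f (inv p) = f'" by auto
  then show ?thesis using gen gen' rs by blast
qed

end

section \<open>The coset identification\<close>

locale rotation_generator = rotary_action M G aV aE aF \<alpha> e f f'
  for M :: "('v, 'e, 'f) pmap" and G :: "('g, 'b) monoid_scheme" (structure)
    and aV :: "'v \<Rightarrow> 'g \<Rightarrow> 'v" and aE :: "'e \<Rightarrow> 'g \<Rightarrow> 'e" and aF :: "'f \<Rightarrow> 'g \<Rightarrow> 'f"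
    and \<alpha> :: 'v and e :: 'e and f f' :: 'f +
  fixes a z :: 'g
  assumes stab_\<alpha>: "stab G aV \<alpha> = generate G {a}"
    and rot_step: "rot_step M aE \<alpha> e a"
    and stab_e: "stab G aE e = generate G {z}"
    and ord_z: "ord z = 2"
begin

lemma a: "a \<in> carrier G" "aV \<alpha> a = \<alpha>"
  using generate.incl[of a "{a}" G] stab_\<alpha> by (auto simp: stab_def)

lemma z: "z \<in> carrier G" "aE e z = e"
  using generate.incl[of z "{z}" G] stab_e by (auto simp: stab_def)

lemma zz: "z \<otimes> z = \<one>" and z_ne: "z \<noteq> \<one>"
  using ord_eq_2_iff[OF z(1)] ord_z by auto

lemma inv_z: "inv z = z"
  using zz z by (metis inv_equality)

lemma stab_e_eq: "k \<in> carrier G \<Longrightarrow> aE e k = e \<Longrightarrow> k = \<one> \<or> k = z"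
  using stab_e generate_involution[OF z(1) zz] by (auto simp: stab_def)

lemma stab_\<alpha>_pow: "k \<in> carrier G \<Longrightarrow> aV \<alpha> k = \<alpha> \<Longrightarrow> \<exists>i::int. k = a [^] i"
  using stab_\<alpha> generate_pow[OF a(1)] by (auto simp: stab_def)

lemma \<alpha>_inv_a: "aV \<alpha> (inv a) = \<alpha>"
  using V.act_inv(1)[OF \<alpha>V a(1)] a(2) by simp

lemma \<alpha>_z: "aV \<alpha> z \<noteq> \<alpha>"
  using arc_stab_trivial[OF z(1) \<alpha>V e_at] z z_ne by blast

lemma \<alpha>z: "aV \<alpha> z \<in> verts M" "e \<in> edges_at M (aV \<alpha> z)"
  using V.act_closed[OF \<alpha>V z(1)] edges_at_act[OF e_at z(1)] z by auto

lemma ends_e: "ends M e = {\<alpha>, aV \<alpha> z}"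
proof -
  have fin: "finite (ends M e)" using card_ends[OF e] card.infinite by fastforce
  have "{\<alpha>, aV \<alpha> z} \<subseteq> ends M e" using \<alpha> \<alpha>z(2) by (auto simp: edges_at_def)
  moreover have "card {\<alpha>, aV \<alpha> z} = card (ends M e)" using card_ends[OF e] \<alpha>_z by simp
  ultimately show ?thesis using card_subset_eq[OF fin] by metis
qed

lemma edges_at_\<alpha>:
  assumes "x \<in> edges_at M \<alpha>"
  shows "\<exists>i::int. x = aE e (a [^] i)"
proof -
  obtain k where "k \<in> stab G aV \<alpha>" "aE e k = x"
    using cyclic_trans(2)[OF \<alpha>V] e_at assms unfolding induces_transitive_def by blast
  then show ?thesis using stab_\<alpha>_pow by (auto simp: stab_def)
qed

lemma ord_a: "ord a = card (edges_at M \<alpha>)"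
proof -
  have "bij_betw (aE e) (stab G aV \<alpha>) (edges_at M \<alpha>)"
    unfolding bij_betw_def
  proof
    show "inj_on (aE e) (stab G aV \<alpha>)" using stab_\<alpha>_eq by (auto intro: inj_onI)
    show "aE e ` stab G aV \<alpha> = edges_at M \<alpha>"
    proof
      show "aE e ` stab G aV \<alpha> \<subseteq> edges_at M \<alpha>"
        using edges_at_act[OF e_at] by (auto simp: stab_def) metis
      show "edges_at M \<alpha> \<subseteq> aE e ` stab G aV \<alpha>"
        using cyclic_trans(2)[OF \<alpha>V] e_at unfolding induces_transitive_def image_iff subset_iff by metis
    qed
  qed
  then show ?thesis using generate_pow_card[OF a(1)] stab_\<alpha> bij_betw_same_card by metis
qed

text \<open>An involution could not rotate at least three edges transitively. This keeps the two
  neighbours of \<open>e\<close> apart, and with them the two faces at \<open>e\<close>.\<close>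

lemma edge_a_neq: "aE e a \<noteq> aE e (inv a)"
proof
  assume "aE e a = aE e (inv a)"
  then have "a = inv a"
    using stab_\<alpha>_eq a \<alpha>_inv_a by (simp add: stab_def)
  then have "a \<otimes> a = \<one>" using a by (metis r_inv)
  then have "generate G {a} = {\<one>, a}" using generate_involution a by blast
  then have "ord a \<le> 2" using generate_pow_card[OF a(1)] by (simp add: card_insert_if)
  then show False using ord_a valency_ge_3[OF \<alpha>V] by simp
qed

text \<open>Naming the faces at \<open>e\<close> by their corners at \<alpha> ties them to the
  rotation: \<open>a\<close> carries \<open>F1\<close> to \<open>F0\<close>.\<close>

definition F0 :: 'f where "F0 = (SOME h. is_corner M h e \<alpha> (aE e a))"

definition F1 :: 'f where "F1 = aF F0 (inv a)"

lemma corner_F0: "is_corner M F0 e \<alpha> (aE e a)"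
  unfolding F0_def by (rule someI_ex) (use rot_step in \<open>simp add: rot_step_def ex_corner_iff\<close>)

lemma corner_F1: "is_corner M F1 (aE e (inv a)) \<alpha> e"
  using corner_act[OF corner_F0 inv_closed[OF a(1)]] \<alpha>_inv_a a e by (simp add: F1_def)

lemma F_faces: "F0 \<in> faces M" "F1 \<in> faces M"
  using is_cornerD(4) corner_F0 corner_F1 by auto

lemma F1_a: "aF F1 a = F0"
  using F_faces a by (simp add: F1_def)

lemma F0_neq_F1: "F0 \<noteq> F1"
  using corner_unique[OF corner_F0] is_corner_sym[OF corner_F1] edge_a_neq by metis

lemma F_eq: "{F0, F1} = {f, f'}"
proof -
  have "{F0, F1} \<subseteq> {f, f'}" unfolding faces_e[symmetric]
    using is_cornerD(4,5)[OF corner_F0] is_cornerD(4,6)[OF corner_F1] by simp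
  then show ?thesis using F0_neq_F1 by auto
qed

text \<open>Every face has an edge, every edge is an image of \<open>e\<close>, and the two faces at
  \<open>e\<close> are fused by \<open>a\<close>; so G is transitive on faces even when z fixes
  both.\<close>

lemma face_orbit:
  assumes "h \<in> faces M"
  shows "\<exists>g \<in> carrier G. aF F0 g = h" "\<exists>g \<in> carrier G. aF F1 g = h"
proof -
  define x where "x = ed (bwalk M h) 0"
  have x: "x \<in> edges M" "x \<in> face_edges M h"
    using ed_in_edges[OF assms] face_edges_ed[OF assms] by (auto simp: x_def)
  obtain g where g: "g \<in> carrier G" "aE e g = x" using edge_image[OF x(1)] .
  have "e \<in> face_edges M (aF h (inv g))"
    using face_edges_act[OF assms x(2) inv_closed[OF g(1)]] g e by auto
  then have "aF h (inv g) \<in> {F0, F1}"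
    unfolding F_eq faces_e[symmetric] using F.act_closed[OF assms inv_closed[OF g(1)]] by simp
  moreover have "h = aF (aF h (inv g)) g" using assms g by simp
  ultimately have "h = aF F0 g \<or> h = aF F1 g" by auto
  then show "\<exists>g \<in> carrier G. aF F0 g = h"
    using g a F_faces F.act_mult[OF F_faces(1) inv_closed[OF a(1)] g(1)] unfolding F1_def
    by (metis inv_closed m_closed)
  show "\<exists>g \<in> carrier G. aF F1 g = h"
    using \<open>h = aF F0 g \<or> h = aF F1 g\<close> g a F.act_mult[OF F_faces(2) a(1) g(1)] F1_a
    by (metis m_closed)
qed

text \<open>The stabiliser of \<alpha> is transitive on the incident edges and permutes the classes
  of parallel edges, which therefore have equal size.\<close>

lemma multiplicity:
  assumes \<beta>: "\<beta> \<in> nbrs M \<alpha>"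
  shows "card (edges_at M \<alpha>) = card (nbrs M \<alpha>) * card {x \<in> edges M. ends M x = {\<alpha>, \<beta>}}"
proof -
  define N where "N \<gamma> = {x \<in> edges M. ends M x = {\<alpha>, \<gamma>}}" for \<gamma>
  have sub: "N \<gamma> \<subseteq> edges_at M \<alpha>" for \<gamma> by (auto simp: N_def edges_at_def)
  have fin: "finite (edges_at M \<alpha>)" using finite_edges_at[OF \<alpha>V] .
  have U: "edges_at M \<alpha> = (\<Union>\<gamma> \<in> nbrs M \<alpha>. N \<gamma>)"
  proof
    show "edges_at M \<alpha> \<subseteq> (\<Union>\<gamma> \<in> nbrs M \<alpha>. N \<gamma>)"
    proof
      fix x assume "x \<in> edges_at M \<alpha>"
      then have x: "x \<in> edges M" "\<alpha> \<in> ends M x" by (auto simp: edges_at_def)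
      then obtain \<gamma> where "ends M x = {\<alpha>, \<gamma>}" "\<gamma> \<noteq> \<alpha>"
        using card_ends[OF x(1)] unfolding card_2_iff by (metis doubleton_eq_iff insertE singletonD)
      then show "x \<in> (\<Union>\<gamma> \<in> nbrs M \<alpha>. N \<gamma>)" using x by (auto simp: N_def nbrs_def)
    qed
  qed (use sub in blast)
  have disj: "N \<gamma> \<inter> N \<delta> = {}" if "\<gamma> \<noteq> \<delta>" for \<gamma> \<delta>
    using that by (auto simp: N_def doubleton_eq_iff)
  have finn: "finite (nbrs M \<alpha>)"
  proof (rule finite_subset)
    show "nbrs M \<alpha> \<subseteq> (\<Union>x \<in> edges_at M \<alpha>. ends M x)" by (auto simp: nbrs_def edges_at_def)
    have "finite (ends M x)" if "x \<in> edges_at M \<alpha>" for x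
      using card_ends[of x] that by (intro card_ge_0_finite) (simp add: edges_at_def)
    then show "finite (\<Union>x \<in> edges_at M \<alpha>. ends M x)" using fin by simp
  qed
  have "card (N \<gamma>) \<le> card (N \<delta>)" if gd: "\<gamma> \<in> nbrs M \<alpha>" "\<delta> \<in> nbrs M \<alpha>" for \<gamma> \<delta>
  proof -
    obtain x y where x: "x \<in> edges M" "ends M x = {\<alpha>, \<gamma>}" "\<gamma> \<noteq> \<alpha>"
      and y: "y \<in> edges M" "ends M y = {\<alpha>, \<delta>}" "\<delta> \<noteq> \<alpha>"
      using gd by (auto simp: nbrs_def)
    obtain g where g: "g \<in> carrier G" "aV \<alpha> g = \<alpha>" "aE x g = y"
      using cyclic_trans(2)[OF \<alpha>V] x y unfolding induces_transitive_def stab_def edges_at_def by blast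
    have "{\<alpha>, aV \<gamma> g} = {\<alpha>, \<delta>}" using ends_act[OF x(1) g(1)] g x y by simp
    then have gg: "aV \<gamma> g = \<delta>" using y(3) by (metis doubleton_eq_iff)
    have "(\<lambda>x. aE x g) ` N \<gamma> \<subseteq> N \<delta>"
      using ends_act[OF _ g(1)] E.act_closed[OF _ g(1)] g gg by (auto simp: N_def)
    moreover have "inj_on (\<lambda>x. aE x g) (N \<gamma>)"
      by (rule inj_onI) (use E.act_inj g in \<open>auto simp: N_def\<close>)
    moreover have "finite (N \<delta>)" using sub fin finite_subset by blast
    ultimately show ?thesis by (metis card_inj_on_le)
  qed
  then have "card (N \<gamma>) = card (N \<beta>)" if "\<gamma> \<in> nbrs M \<alpha>" for \<gamma>
    using that \<beta> by (metis antisym)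
  moreover have "card (\<Union>\<gamma> \<in> nbrs M \<alpha>. N \<gamma>) = (\<Sum>\<gamma> \<in> nbrs M \<alpha>. card (N \<gamma>))"
    using disj finite_subset[OF sub fin] by (intro card_UN_disjoint[OF finn]) simp_all
  ultimately show ?thesis using U by (simp add: N_def)
qed

text \<open>Powers of \<open>a\<close> reach every edge at \<alpha> and \<open>z\<close> crosses an
  edge, so by connectedness the generated subgroup is transitive on vertices; it also contains the
  stabiliser of \<alpha>.\<close>

lemma generates: "generate G {a, z} = carrier G"
proof
  let ?K = "generate G {a, z}"
  have az: "{a, z} \<subseteq> carrier G" using a z by simp
  show "?K \<subseteq> carrier G" using generate_incl[OF az] .
  have sub: "subgroup ?K G" using generate_is_subgroup[OF az] .
  have aK: "a \<in> ?K" "z \<in> ?K" by (auto intro: generate.incl)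
  have pK: "a [^] i \<in> ?K" for i :: int using subgroup_int_pow_closed[OF sub aK(1)] .
  have tr: "\<exists>k \<in> ?K. aV \<alpha> k = v" if "v \<in> verts M" for v
    using connected[OF \<alpha>V that]
  proof (induction rule: rtrancl_induct)
    case base
    then show ?case using V.act_one[OF \<alpha>V] subgroup.one_closed[OF sub] by blast
  next
    case (step y w)
    then obtain k where k: "k \<in> ?K" "aV \<alpha> k = y" by blast
    have kc: "k \<in> carrier G" using k subgroup.mem_carrier[OF sub] by blast
    obtain x where x: "x \<in> edges M" "ends M x = {y, w}" using step unfolding adj_rel_def by auto
    have yV: "y \<in> verts M" "x \<in> edges_at M y" "w \<in> ends M x" "w \<in> verts M"
      using x ends_subset[OF x(1)] by (auto simp: edges_at_def)
    have "aE x (inv k) \<in> edges_at M \<alpha>"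
      using edges_at_act[OF yV(2) inv_closed[OF kc]] k(2) V.act_inv(1)[OF \<alpha>V kc] by simp
    then obtain i :: int where i: "aE x (inv k) = aE e (a [^] i)" using edges_at_\<alpha> by blast
    \<comment> \<open>This takes \<open>e\<close> to \<open>x\<close>, so the ends of
      \<open>x\<close> are the images of \<alpha> under \<open>b\<close> and under
      \<open>z \<otimes> b\<close>.\<close>
    define b where "b = a [^] i \<otimes> k"
    have bK: "b \<in> ?K" unfolding b_def using pK k subgroup.m_closed[OF sub] by blast
    have bc: "b \<in> carrier G" using bK subgroup.mem_carrier[OF sub] by blast
    have "x = aE (aE x (inv k)) k" using x kc by simp
    then have "x = aE e b" unfolding i b_def using E.act_mult[OF e _ kc] a by simp
    then have "w \<in> {aV \<alpha> b, aV (aV \<alpha> z) b}" using ends_act[OF e bc] ends_e yV(3) by simp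
    then have "w = aV \<alpha> b \<or> w = aV \<alpha> (z \<otimes> b)" using V.act_mult[OF \<alpha>V z(1) bc] by auto
    then show ?case using bK aK subgroup.m_closed[OF sub] by blast
  qed
  show "carrier G \<subseteq> ?K"
  proof
    fix g assume g: "g \<in> carrier G"
    obtain k where k: "k \<in> ?K" "aV \<alpha> k = aV \<alpha> g" using tr V.act_closed[OF \<alpha>V g] by blast
    have kc: "k \<in> carrier G" using k subgroup.mem_carrier[OF sub] by blast
    have "aV \<alpha> (g \<otimes> inv k) = \<alpha>" using V.act_eq_iff[OF \<alpha>V g kc] k by simp
    then obtain i :: int where "g \<otimes> inv k = a [^] i" using stab_\<alpha>_pow g kc by blast
    then have "g = a [^] i \<otimes> k" using g kc a by (metis inv_solve_right int_pow_closed)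
    then show "g \<in> ?K" using pK k subgroup.m_closed[OF sub] by blast
  qed
qed

lemma rotary_pair: "rotary_pair G a z"
proof -
  have "z \<notin> generate G {a}"
    unfolding stab_\<alpha>[symmetric] using \<alpha>_z by (simp add: stab_def)
  then show ?thesis
    unfolding rotary_pair_def using a z generates ord_z ord_a valency_ge_3[OF \<alpha>V] by simp
qed

abbreviation "\<phi>V \<equiv> V.transporter \<alpha>"
abbreviation "\<phi>E \<equiv> E.transporter e"

lemma \<phi>V_act: "g \<in> carrier G \<Longrightarrow> \<phi>V (aV \<alpha> g) = generate G {a} #> g"
  using V.transporter_act[OF \<alpha>V] stab_\<alpha> by simp

lemma \<phi>E_act: "g \<in> carrier G \<Longrightarrow> \<phi>E (aE e g) = generate G {z} #> g"
  using E.transporter_act[OF e] stab_e by simp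

text \<open>A common element of \<open>\<phi>V v\<close> and \<open>\<phi>E x\<close> is an element
  carrying the arc (\<alpha>, \<open>e\<close>) to (\<open>v\<close>, \<open>x\<close>); hence
  incidence becomes non-empty intersection.\<close>

lemma cos_identification: "cos_identification M G aV aE \<alpha> e a z \<phi>V \<phi>E"
proof -
  have bV: "bij_betw \<phi>V (verts M) (rcosets (generate G {a}))"
    using V.bij_betw_transporter[OF \<alpha>V] vertex_image stab_\<alpha> by metis
  have bE: "bij_betw \<phi>E (edges M) (rcosets (generate G {z}))"
    using E.bij_betw_transporter[OF e] edge_image stab_e by metis
  have "\<phi>V ` ends M x = cos_ends G a (\<phi>E x)" if x: "x \<in> edges M" for x
  proof
    show "\<phi>V ` ends M x \<subseteq> cos_ends G a (\<phi>E x)"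
    proof
      fix Y assume "Y \<in> \<phi>V ` ends M x"
      then obtain v where v: "v \<in> ends M x" "Y = \<phi>V v" by blast
      obtain g where g: "g \<in> carrier G" "aV \<alpha> g = v" "aE e g = x" using arc_image[OF x v(1)] .
      have "g \<in> Y \<inter> \<phi>E x" using g v by (auto simp: V.transporter_def E.transporter_def)
      then show "Y \<in> cos_ends G a (\<phi>E x)"
        unfolding cos_ends_def using bij_betwE[OF bV] v ends_subset[OF x] by blast
    qed
    show "cos_ends G a (\<phi>E x) \<subseteq> \<phi>V ` ends M x"
    proof
      fix Y assume "Y \<in> cos_ends G a (\<phi>E x)"
      then have Y: "Y \<in> rcosets (generate G {a})" "Y \<inter> \<phi>E x \<noteq> {}" by (auto simp: cos_ends_def)
      then obtain v where v: "v \<in> verts M" "Y = \<phi>V v" using bV by (auto simp: bij_betw_def)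
      obtain g where "g \<in> Y" "g \<in> \<phi>E x" using Y by blast
      then have g: "g \<in> carrier G" "aV \<alpha> g = v" "aE e g = x"
        using v by (auto simp: V.transporter_def E.transporter_def)
      then have "v \<in> ends M x" using ends_act[OF e g(1)] \<alpha> by auto
      then show "Y \<in> \<phi>V ` ends M x" using v by blast
    qed
  qed
  then show ?thesis
    unfolding cos_identification_def using bV bE \<phi>V_act \<phi>E_act by blast
qed

lemma z_faces: "(aF f z = f' \<and> aF f' z = f) \<or> (aF f z = f \<and> aF f' z = f')"
proof -
  have fs: "f \<in> faces M" "f' \<in> faces M" "e \<in> face_edges M f" "e \<in> face_edges M f'"
    using faces_e by auto
  have "aF f z \<in> {f, f'}" "aF f' z \<in> {f, f'}" unfolding faces_e[symmetric]
    using face_edges_act[OF fs(1,3) z(1)] face_edges_act[OF fs(2,4) z(1)]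
      F.act_closed[OF fs(1) z(1)] F.act_closed[OF fs(2) z(1)] z by auto
  moreover have "aF f z \<noteq> aF f' z" using F.act_inj[OF fs(1,2) z(1)] ff' by blast
  ultimately show ?thesis by auto
qed

end

section \<open>Recovering faces from sequences of corners\<close>

context rotation_generator
begin

lemma fixed_pow:
  assumes "h \<in> faces M" "t \<in> carrier G" "aF h t = h" "g \<in> carrier G"
  shows "aF h (t [^] (i::nat) \<otimes> g) = aF h g"
  using F.act_mult[OF assms(1) nat_pow_closed[OF assms(2)] assms(4)] F.act_nat_pow_fixed[OF assms(1-3)]
  by metis

text \<open>To know a boundary walk it suffices to exhibit a chain of corners of that face which
  never stays at a vertex.\<close>

lemma face_corner_sequence:
  assumes h: "h \<in> faces M"
    and "is_corner M h x (fst (s 0)) (snd (s 0))"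
    and "\<And>j. is_corner M h (snd (s j)) (fst (s (Suc j))) (snd (s (Suc j)))"
    and "\<And>j. fst (s j) \<noteq> fst (s (Suc j))"
  shows "walk_equiv (bwalk M h) (map s [0..<length (bwalk M h)])"
    and "length (bwalk M h) dvd j \<Longrightarrow> s j = s 0"
    and "snd (s j) = snd (s 0) \<longleftrightarrow> length (bwalk M h) dvd j"
proof -
  have c: "corner_in (bwalk M h) x (fst (s 0)) (snd (s 0))"
    "corner_in (bwalk M h) (snd (s j)) (fst (s (Suc j))) (snd (s (Suc j)))" for j
    using assms(2,3) by (auto simp: is_corner_def)
  note seq = corner_sequence_walk_equiv[OF bwalk_ne[OF h] ed_inj[OF h] c assms(4)]
  show "walk_equiv (bwalk M h) (map s [0..<length (bwalk M h)])" by (rule seq(1))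
  show "length (bwalk M h) dvd j \<Longrightarrow> s j = s 0" by (rule seq(2))
  show "snd (s j) = snd (s 0) \<longleftrightarrow> length (bwalk M h) dvd j" by (rule seq(3))
qed

text \<open>Vertices and edges are settled by \<open>cos_identification\<close>; what remains in
  each case is the correspondence of faces and their walks.\<close>

lemma map_isoI:
  assumes N: "verts N = rcosets (generate G {a})" "edges N = rcosets (generate G {z})" "ends N = cos_ends G a"
    and F: "bij_betw \<phi>F (faces M) (faces N)"
    and walk: "\<And>h. h \<in> faces M \<Longrightarrow> \<exists>w. walk_equiv (bwalk M h) w \<and> bwalk N (\<phi>F h) = map_walk \<phi>V \<phi>E w"
  shows "map_iso M N \<phi>V \<phi>E \<phi>F"
proof -
  have "walk_equiv (map_walk \<phi>V \<phi>E (bwalk M h)) (bwalk N (\<phi>F h))" if h: "h \<in> faces M" for h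
    using walk[OF h] walk_equiv_map_walk[OF bwalk_ne[OF h]] by metis
  then show ?thesis
    using cos_identification F unfolding map_iso_def cos_identification_def N by auto
qed

section \<open>The rotary case\<close>

abbreviation t where "t \<equiv> a \<otimes> z"

lemma t: "t \<in> carrier G" using a z by simp

text \<open>The corner of \<open>F1\<close> at \<alpha> is translated by
  \<open>t [^] j \<otimes> g\<close>. Successive translates share an edge because
  \<open>inv a \<otimes> t\<close> is \<open>z\<close>, which fixes \<open>e\<close>.\<close>

lemma rota_walk:
  assumes swap: "aF F0 z = F1" and g: "g \<in> carrier G"
  defines "s \<equiv> \<lambda>j::nat. (aV \<alpha> (t [^] j \<otimes> g), aE e (t [^] j \<otimes> g))"
  shows "walk_equiv (bwalk M (aF F1 g)) (map s [0..<ord t])" "length (bwalk M (aF F1 g)) = ord t"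
proof -
  let ?h = "aF F1 g" let ?n = "length (bwalk M ?h)"
  have h: "?h \<in> faces M" using F.act_closed[OF F_faces(2) g] .
  have Ft: "aF F1 t = F1" using F.act_mult[OF F_faces(2) a(1) z(1)] F1_a swap by simp
  have tj: "t [^] j \<otimes> g \<in> carrier G" for j :: nat using t g by simp
  have t_Suc: "t [^] Suc j \<otimes> g = t \<otimes> (t [^] j \<otimes> g)" for j :: nat
    using t g by (metis m_assoc nat_pow_Suc2 nat_pow_closed)
  have c: "is_corner M ?h (aE (aE e (inv a)) (t [^] j \<otimes> g)) (fst (s j)) (snd (s j))" for j :: nat
    using corner_act[OF corner_F1 tj] fixed_pow[OF F_faces(2) t Ft g] by (simp add: s_def)
  have prev: "aE (aE e (inv a)) (t [^] Suc j \<otimes> g) = snd (s j)" for j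
  proof -
    have "inv a \<otimes> (t \<otimes> (t [^] j \<otimes> g)) = z \<otimes> (t [^] j \<otimes> g)"
      using a z tj[of j] by (simp add: m_assoc[symmetric])
    then have "aE (aE e (inv a)) (t [^] Suc j \<otimes> g) = aE e (z \<otimes> (t [^] j \<otimes> g))"
      unfolding t_Suc using E.act_mult[OF e inv_closed[OF a(1)] m_closed[OF t tj[of j]]] by simp
    also have "\<dots> = aE e (t [^] j \<otimes> g)" using E.act_mult[OF e z(1) tj[of j]] z(2) by simp
    finally show ?thesis by (simp add: s_def)
  qed
  have step: "is_corner M ?h (snd (s j)) (fst (s (Suc j))) (snd (s (Suc j)))" for j
    using c[of "Suc j"] unfolding prev .
  have neq: "fst (s j) \<noteq> fst (s (Suc j))" for j
  proof
    assume "fst (s j) = fst (s (Suc j))"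
    then have "aV \<alpha> (t [^] j \<otimes> g) = aV (aV \<alpha> t) (t [^] j \<otimes> g)"
      using V.act_mult[OF \<alpha>V t tj[of j]] t_Suc by (simp add: s_def)
    then have "\<alpha> = aV \<alpha> t" using V.act_inj[OF \<alpha>V V.act_closed[OF \<alpha>V t] tj] by blast
    then show False using V.act_mult[OF \<alpha>V a(1) z(1)] a \<alpha>_z by simp
  qed
  note seq = face_corner_sequence[OF h c[of 0] step neq]
  have s0: "s 0 = (aV \<alpha> g, aE e g)" using g by (simp add: s_def)
  \<comment> \<open>A return of \<open>s\<close> to its start means that \<open>t [^] j\<close>
    fixes the arc (\<alpha>, \<open>e\<close>), hence is trivial. The order of \<open>t\<close> is
    thereby the walk length, in particular positive.\<close>
  have "t [^] j = \<one> \<longleftrightarrow> ?n dvd j" for j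
  proof
    assume "t [^] j = \<one>"
    then have "s j = s 0" using g s0 by (simp add: s_def)
    then show "?n dvd j" using seq(3)[of j] by simp
  next
    assume "?n dvd j"
    then have "s j = s 0" by (rule seq(2))
    then have eq: "aV (aV \<alpha> (t [^] j)) g = aV \<alpha> g" "aE (aE e (t [^] j)) g = aE e g"
      using s0 t g V.act_mult[OF \<alpha>V _ g] E.act_mult[OF e _ g] by (simp_all add: s_def)
    then have "aV \<alpha> (t [^] j) = \<alpha>" "aE e (t [^] j) = e"
      using V.act_inj[OF V.act_closed[OF \<alpha>V] \<alpha>V g] E.act_inj[OF E.act_closed[OF e] e g] t by auto
    then show "t [^] j = \<one>" using arc_stab_trivial[OF _ \<alpha>V e_at] t by simp
  qed
  then have "ord t = ?n" using ord_unique[OF t] by blast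
  then show "walk_equiv (bwalk M ?h) (map s [0..<ord t])" "?n = ord t" using seq(1) by simp_all
qed

lemma rota_ord:
  assumes "aF F0 z = F1"
  shows "ord t \<noteq> 0"
  using rota_walk(2)[OF assms one_closed] bwalk_ne[OF F.act_closed[OF F_faces(2) one_closed]]
  by (metis length_0_conv)

text \<open>An element fixing \<open>F1\<close> takes \<open>e\<close> to an edge of
  \<open>F1\<close>, and those are the images of \<open>e\<close> under powers of \<open>t\<close>.
  After dividing by such a power it fixes both \<open>e\<close> and \<open>F1\<close>; it is then
  trivial, since \<open>z\<close> moves \<open>F1\<close>.\<close>

lemma rota_stab:
  assumes swap: "aF F0 z = F1"
  shows "stab G aF F1 = generate G {t}"
proof
  have sub: "subgroup (stab G aF F1) G" using F.subgroup_stab[OF F_faces(2)] .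
  have Ft: "aF F1 t = F1" using F.act_mult[OF F_faces(2) a(1) z(1)] F1_a swap by simp
  show "generate G {t} \<subseteq> stab G aF F1"
    using generate_subgroup_incl[OF _ sub] t Ft by (simp add: stab_def)
  show "stab G aF F1 \<subseteq> generate G {t}"
  proof
    fix k assume "k \<in> stab G aF F1"
    then have k: "k \<in> carrier G" "aF F1 k = F1" by (auto simp: stab_def)
    have "aE e k \<in> face_edges M F1"
      using face_edges_act[OF F_faces(2) is_cornerD(6)[OF corner_F1] k(1)] k(2) by simp
    moreover have "walk_equiv (bwalk M F1) (map (\<lambda>j. (aV \<alpha> (t [^] j), aE e (t [^] j))) [0..<ord t])"
      using rota_walk(1)[OF swap one_closed] F.act_one[OF F_faces(2)] t by simp
    from walk_equiv_edges[OF bwalk_ne[OF F_faces(2)] this]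
    have "face_edges M F1 = (\<lambda>j. aE e (t [^] j)) ` set [0..<ord t]"
      unfolding face_edges_def by (simp add: image_image)
    ultimately obtain j where j: "aE e k = aE e (t [^] (j::nat))" by auto
    have tj: "t [^] j \<in> carrier G" using t by simp
    have "aE e (k \<otimes> inv (t [^] j)) = e" using E.act_eq_iff[OF e k(1) tj] j by simp
    moreover have "aF F1 (k \<otimes> inv (t [^] j)) = F1"
      using F.act_eq_iff[OF F_faces(2) k(1) tj] k F.act_nat_pow_fixed[OF F_faces(2) t Ft] by simp
    moreover have "aF F1 z \<noteq> F1"
      using F.act_inj[OF F_faces z(1)] swap F0_neq_F1 by metis
    ultimately have "k \<otimes> inv (t [^] j) = \<one>" using stab_e_eq[of "k \<otimes> inv (t [^] j)"] k tj by auto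
    then have "k = t [^] j" using k tj by (metis inv_equality inv_inv inv_closed)
    then show "k \<in> generate G {t}"
      using generate_pow[OF t] int_pow_int[of G t j] by (metis (mono_tags, lifting) UNIV_I mem_Collect_eq)
  qed
qed

lemma rota_iso:
  assumes swap: "aF F0 z = F1"
  shows "map_iso M (RotaMap G a z) \<phi>V \<phi>E (F.transporter F1)"
proof (rule map_isoI)
  let ?H = "generate G {t}"
  show "bij_betw (F.transporter F1) (faces M) (faces (RotaMap G a z))"
    using F.bij_betw_transporter[OF F_faces(2) face_orbit(2)] rota_stab[OF swap]
    by (simp add: RotaMap_def Let_def)
  fix h assume h: "h \<in> faces M"
  \<comment> \<open>This is the representative selected inside \<open>RotaMap\<close>. Any element
    of the coset carries \<open>F1\<close> to \<open>h\<close>, so nothing depends on the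
    selection.\<close>
  define g where "g = (SOME g. g \<in> carrier G \<and> F.transporter F1 h = ?H #> g)"
  have tr: "F.transporter F1 (aF F1 g) = ?H #> g" if "g \<in> carrier G" for g
    using F.transporter_act[OF F_faces(2) that] rota_stab[OF swap] by simp
  have "\<exists>g. g \<in> carrier G \<and> F.transporter F1 h = ?H #> g" using face_orbit(2)[OF h] tr by metis
  then have g: "g \<in> carrier G" "F.transporter F1 h = ?H #> g" unfolding g_def by (metis (mono_tags, lifting) someI_ex)+
  have hg: "aF F1 g = h" using F.transporter_inj[OF F_faces(2) g(1)] tr[OF g(1)] g(2) by metis
  let ?w = "map (\<lambda>j. (aV \<alpha> (t [^] j \<otimes> g), aE e (t [^] j \<otimes> g))) [0..<ord t]"
  have "walk_equiv (bwalk M h) ?w" using rota_walk(1)[OF swap g(1)] unfolding hg .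
  moreover have "bwalk (RotaMap G a z) (F.transporter F1 h) = map_walk \<phi>V \<phi>E ?w"
    using \<phi>V_act \<phi>E_act t g(1) by (simp add: RotaMap_def Let_def g_def[symmetric] map_walk_def)
  ultimately show "\<exists>w. walk_equiv (bwalk M h) w \<and>
      bwalk (RotaMap G a z) (F.transporter F1 h) = map_walk \<phi>V \<phi>E w" by blast
qed (simp_all add: RotaMap_def Let_def)

text \<open>All face stabilisers are conjugate to that of \<open>F1\<close>, which is generated by
  \<open>t\<close>.\<close>

lemma rota_face_rotary:
  assumes swap: "aF F0 z = F1"
  shows "face_rotary M G aE aF"
  unfolding face_rotary_def induces_cyclic_def
proof
  fix h assume "h \<in> faces M"
  then obtain g where g: "g \<in> carrier G" "aF F1 g = h" using face_orbit(2) by blast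
  have hF: "h \<in> faces M" using \<open>h \<in> faces M\<close> .
  have hg: "aF h (inv g) = F1" using g F_faces by auto
  let ?c = "inv g \<otimes> t \<otimes> g"
  have Ft: "aF F1 t = F1" using F.act_mult[OF F_faces(2) a(1) z(1)] F1_a swap by simp
  have "aF h ?c = aF (aF (aF h (inv g)) t) g"
    using F.act_mult hF g t by simp
  then have c: "?c \<in> stab G aF h" using hg Ft g t by (simp add: stab_def)
  have "\<exists>i::int. \<forall>x \<in> face_edges M h. aE x k = aE x (?c [^] i)" if "k \<in> stab G aF h" for k
  proof -
    have k: "k \<in> carrier G" "aF h k = h" using that by (auto simp: stab_def)
    have "aF F1 (g \<otimes> k \<otimes> inv g) = aF (aF (aF F1 g) k) (inv g)"
      using F.act_mult[OF F_faces(2)] g(1) k(1) by simp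
    then have "g \<otimes> k \<otimes> inv g \<in> stab G aF F1" using g k hg by (simp add: stab_def)
    then obtain n :: nat where n: "g \<otimes> k \<otimes> inv g = t [^] n"
      unfolding rota_stab[OF swap] using generate_pow_nat[OF t rota_ord[OF swap]] by blast
    have "k = inv g \<otimes> (g \<otimes> k \<otimes> inv g) \<otimes> g" using g(1) k(1) by (simp add: m_assoc inv_cancel_left)
    then have "k = ?c [^] n" unfolding n conj_nat_pow[OF t g(1)] .
    then have "k = ?c [^] int n" by (simp add: int_pow_int)
    then show ?thesis by blast
  qed
  then show "\<exists>c \<in> stab G aF h. \<forall>k \<in> stab G aF h. \<exists>i::int. \<forall>x \<in> face_edges M h. aE x k = aE x (c [^] i)"
    using c by blast
qed

lemma rota_length:
  assumes "aF F0 z = F1" "h \<in> faces M"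
  shows "length (bwalk M h) = ord t"
  using rota_walk(2)[OF assms(1)] face_orbit(2)[OF assms(2)] by auto

section \<open>The bi-rotary case\<close>

abbreviation za where "za \<equiv> conj_by G z a"
abbreviation w where "w \<equiv> z \<otimes> za"

lemma za: "za \<in> carrier G" using a z by (simp add: conj_by_def)

lemma w: "w \<in> carrier G" using z za by simp

lemma za_za: "za \<otimes> za = \<one>"
proof -
  have "z \<otimes> (z \<otimes> a) = a" using zz a z by (simp add: m_assoc[symmetric])
  then show ?thesis unfolding conj_by_def using a z by (simp add: m_assoc inv_cancel_left)
qed

lemma z_w: "z \<otimes> w = za" using z za zz by (simp add: m_assoc[symmetric])

lemma a_za: "a \<otimes> za = z \<otimes> a" unfolding conj_by_def using a z by (simp add: m_assoc inv_cancel_left)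

text \<open>Conjugation by \<open>a\<close> moves the condition from \<open>F1\<close> to its image
  \<open>F0\<close>.\<close>

lemma za_F0:
  assumes "aF F1 z = F1"
  shows "aF F0 za = F0"
proof -
  have "aF F0 za = aF (aF (aF F0 (inv a)) z) a"
    unfolding conj_by_def using F.act_mult[OF F_faces(1)] a z by simp
  then show ?thesis using F1_def F1_a assms by simp
qed

lemma w_F0:
  assumes "aF F0 z = F0" "aF F1 z = F1"
  shows "aF F0 w = F0"
  using F.act_mult[OF F_faces(1) z(1) za] za_F0 assms by simp

text \<open>The walk that becomes \<open>BiRo_cycle G a z g\<close> once vertices and edges are identified with cosets.\<close>
definition biro_seq :: "'g \<Rightarrow> nat \<Rightarrow> 'v \<times> 'e" where
  "biro_seq g j = (if even j then (aV \<alpha> (z \<otimes> w [^] (j div 2) \<otimes> g), aE e (w [^] (j div 2) \<otimes> g))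
             else (aV \<alpha> (w [^] (j div 2) \<otimes> g), aE e (a \<otimes> w [^] (j div 2) \<otimes> g)))"

text \<open>The basic corner of \<open>F0\<close> is used in both directions: translates by
  \<open>w [^] i \<otimes> g\<close> are read forwards, those by
  \<open>z \<otimes> w [^] i \<otimes> g\<close> backwards. Consecutive ones share an edge because
  \<open>z\<close> fixes \<open>e\<close> and \<open>za\<close> fixes the image of \<open>e\<close>
  under \<open>a\<close>.\<close>

lemma biro_walk:
  assumes fx: "aF F0 z = F0" "aF F1 z = F1" and g: "g \<in> carrier G"
  shows "walk_equiv (bwalk M (aF F0 g)) (map (biro_seq g) [0..<2 * ord w])"
    "length (bwalk M (aF F0 g)) = 2 * ord w"
proof -
  let ?h = "aF F0 g" let ?n = "length (bwalk M ?h)"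
  have h: "?h \<in> faces M" using F.act_closed[OF F_faces(1) g] .
  note Fw = w_F0[OF fx]
  have wi: "w [^] i \<otimes> g \<in> carrier G" "w [^] i \<in> carrier G" for i :: nat using w g by simp_all
  have Fwi: "aF F0 (w [^] i \<otimes> g) = ?h" for i :: nat
    using fixed_pow[OF F_faces(1) w Fw g] .
  have Fzwi: "aF F0 (z \<otimes> (w [^] i \<otimes> g)) = ?h" for i :: nat
    using F.act_mult[OF F_faces(1) z(1) wi(1)] fx Fwi by metis
  have assoc: "z \<otimes> w [^] i \<otimes> g = z \<otimes> (w [^] i \<otimes> g)" "a \<otimes> w [^] i \<otimes> g = a \<otimes> (w [^] i \<otimes> g)" for i :: nat
    using a z wi g by (simp_all add: m_assoc)
  have seq_even: "biro_seq g (2 * i) = (aV \<alpha> (z \<otimes> (w [^] i \<otimes> g)), aE e (w [^] i \<otimes> g))"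
    and seq_odd: "biro_seq g (Suc (2 * i)) = (aV \<alpha> (w [^] i \<otimes> g), aE e (a \<otimes> (w [^] i \<otimes> g)))" for i
    by (simp_all add: biro_seq_def assoc)
  have ez: "aE e (z \<otimes> k) = aE e k" if "k \<in> carrier G" for k
    using E.act_mult[OF e z(1) that] z by simp
  have c0: "is_corner M ?h (aE e (a \<otimes> (z \<otimes> (w [^] i \<otimes> g)))) (fst (biro_seq g (2 * i))) (snd (biro_seq g (2 * i)))" for i
  proof -
    have k: "z \<otimes> (w [^] i \<otimes> g) \<in> carrier G" using z wi by simp
    show ?thesis
      using is_corner_sym[OF corner_act[OF corner_F0 k]] Fzwi[of i] ez[OF wi(1)[of i]]
        E.act_mult[OF e a(1) k] by (simp add: seq_even)
  qed
  have c1: "is_corner M ?h (snd (biro_seq g (2 * i))) (fst (biro_seq g (Suc (2 * i)))) (snd (biro_seq g (Suc (2 * i))))" for i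
    using corner_act[OF corner_F0 wi(1)[of i]] Fwi[of i] E.act_mult[OF e a(1) wi(1)[of i]]
    by (simp add: seq_even seq_odd)
  \<comment> \<open>Since \<open>z \<otimes> w\<close> is \<open>za\<close>, the next backward
    corner is the reflection by \<open>za\<close> of the current forward one.\<close>
  have w_Suc: "z \<otimes> (w [^] Suc i \<otimes> g) = za \<otimes> (w [^] i \<otimes> g)" for i :: nat
  proof -
    have "w [^] Suc i \<otimes> g = w \<otimes> (w [^] i \<otimes> g)"
      using w g wi(2)[of i] nat_pow_Suc2[OF w, of i] by (simp only: m_assoc)
    then have "z \<otimes> (w [^] Suc i \<otimes> g) = (z \<otimes> w) \<otimes> (w [^] i \<otimes> g)"
      using z w wi(1)[of i] by (simp only: m_assoc)
    then show ?thesis unfolding z_w .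
  qed
  have c2: "is_corner M ?h (snd (biro_seq g (Suc (2 * i)))) (fst (biro_seq g (2 * Suc i))) (snd (biro_seq g (2 * Suc i)))" for i
  proof -
    have "a \<otimes> (z \<otimes> (w [^] Suc i \<otimes> g)) = a \<otimes> za \<otimes> (w [^] i \<otimes> g)"
      unfolding w_Suc using a za wi(1)[of i] by (simp only: m_assoc)
    also have "\<dots> = z \<otimes> (a \<otimes> (w [^] i \<otimes> g))" unfolding a_za using a z wi(1)[of i] by (simp only: m_assoc)
    finally have "aE e (a \<otimes> (z \<otimes> (w [^] Suc i \<otimes> g))) = snd (biro_seq g (Suc (2 * i)))"
      using ez[of "a \<otimes> (w [^] i \<otimes> g)"] a wi(1)[of i] by (simp only: seq_odd m_closed snd_conv)
    then show ?thesis using c0[of "Suc i"] by simp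
  qed
  have step: "is_corner M ?h (snd (biro_seq g j)) (fst (biro_seq g (Suc j))) (snd (biro_seq g (Suc j)))" for j
  proof (cases "even j")
    case True
    then obtain i where "j = 2 * i" by blast
    then show ?thesis using c1 by simp
  next
    case False
    then obtain i where "j = Suc (2 * i)" by (metis oddE Suc_eq_plus1)
    then show ?thesis using c2[of i] by simp
  qed
  have neq: "fst (biro_seq g j) \<noteq> fst (biro_seq g (Suc j))" for j
  proof (cases "even j")
    case True
    then obtain i where j: "j = 2 * i" by blast
    show ?thesis
    proof
      assume "fst (biro_seq g j) = fst (biro_seq g (Suc j))"
      then have "aV (aV \<alpha> z) (w [^] i \<otimes> g) = aV \<alpha> (w [^] i \<otimes> g)"
        using V.act_mult[OF \<alpha>V z(1) wi(1)[of i]] by (simp add: j seq_even seq_odd)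
      then show False using V.act_inj[OF \<alpha>z(1) \<alpha>V wi(1)[of i]] \<alpha>_z by blast
    qed
  next
    case False
    then obtain i where j: "j = Suc (2 * i)" by (metis oddE Suc_eq_plus1)
    show ?thesis
    proof
      assume "fst (biro_seq g j) = fst (biro_seq g (Suc j))"
      then have "aV \<alpha> (w [^] i \<otimes> g) = aV \<alpha> (z \<otimes> (w [^] Suc i \<otimes> g))"
        using seq_even[of "Suc i"] by (simp add: j seq_odd)
      also have "\<dots> = aV (aV \<alpha> za) (w [^] i \<otimes> g)"
        unfolding w_Suc using V.act_mult[OF \<alpha>V za wi(1)[of i]] by simp
      finally have "aV \<alpha> za = \<alpha>" using V.act_inj[OF \<alpha>V V.act_closed[OF \<alpha>V za] wi(1)[of i]] by simp
      moreover have "aV \<alpha> za = aV (aV (aV \<alpha> (inv a)) z) a"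
        unfolding conj_by_def using V.act_mult[OF \<alpha>V] a z by simp
      ultimately have "aV (aV \<alpha> z) a = aV \<alpha> a" using \<alpha>_inv_a a by simp
      then show False using V.act_inj[OF \<alpha>z(1) \<alpha>V a(1)] \<alpha>_z by blast
    qed
  qed
  have c00: "is_corner M ?h (aE e (a \<otimes> (z \<otimes> (w [^] (0::nat) \<otimes> g)))) (fst (biro_seq g 0)) (snd (biro_seq g 0))"
    using c0[of 0] by (simp only: mult_0_right)
  note seq = face_corner_sequence[OF h c00 step neq]
  have b0: "biro_seq g 0 = (aV \<alpha> (z \<otimes> g), aE e g)" using seq_even[of 0] g by simp
  \<comment> \<open>At an odd return the element \<open>a \<otimes> w [^] i\<close> would fix
    \<open>e\<close>, so it would be trivial or \<open>z\<close> and would fix \<open>F0\<close>. As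
    \<open>w\<close> fixes \<open>F0\<close>, so would \<open>a\<close>, and \<open>F0\<close> would
    equal \<open>F1\<close>.\<close>
  have "even ?n"
  proof (rule ccontr)
    assume "odd ?n"
    then obtain i where i: "?n = Suc (2 * i)" by (metis oddE Suc_eq_plus1)
    have "snd (biro_seq g (Suc (2 * i))) = snd (biro_seq g 0)" using seq(3)[of "Suc (2 * i)"] unfolding i by simp
    then have "aE (aE e (a \<otimes> w [^] i)) g = aE e g"
      using E.act_mult[OF e m_closed[OF a(1) wi(2)[of i]] g] by (simp add: seq_odd b0 assoc[symmetric])
    then have "aE e (a \<otimes> w [^] i) = e"
      using E.act_inj[OF E.act_closed[OF e] e g] a wi(2)[of i] by simp
    then have "a \<otimes> w [^] i = \<one> \<or> a \<otimes> w [^] i = z"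
      using stab_e_eq a wi(2)[of i] by simp
    then have "aF F0 (a \<otimes> w [^] i) = F0" using fx(1) F.act_one[OF F_faces(1)] by auto
    then have "aF (aF F0 a) (w [^] i) = aF F0 (w [^] i)"
      using F.act_mult[OF F_faces(1) a(1) wi(2)[of i]] F.act_nat_pow_fixed[OF F_faces(1) w Fw] by simp
    then have "aF F0 a = F0"
      using F.act_inj[OF F.act_closed[OF F_faces(1) a(1)] F_faces(1) wi(2)[of i]] by simp
    then have "aF F0 (inv a) = F0" using F.act_inv(1)[OF F_faces(1) a(1)] by simp
    then show False using F0_neq_F1 by (simp add: F1_def)
  qed
  then obtain m where m: "?n = 2 * m" by blast
  \<comment> \<open>Even positions alone decide the order. The starting vertex is the image of
    \<alpha> under \<open>z\<close>, so the trivial arc stabiliser is that of the other end of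
    \<open>e\<close>.\<close>
  have "w [^] i = \<one> \<longleftrightarrow> m dvd i" for i
  proof
    assume "w [^] i = \<one>"
    then have "biro_seq g (2 * i) = biro_seq g 0" unfolding seq_even b0 using g by simp
    then have "?n dvd 2 * i" using seq(3)[of "2 * i"] by simp
    then show "m dvd i" unfolding m by simp
  next
    assume "m dvd i"
    then have "?n dvd 2 * i" unfolding m by simp
    then have "biro_seq g (2 * i) = biro_seq g 0" by (rule seq(2))
    then have "aV \<alpha> (z \<otimes> (w [^] i \<otimes> g)) = aV \<alpha> (z \<otimes> g)" "aE e (w [^] i \<otimes> g) = aE e g"
      unfolding seq_even b0 by auto
    then have "aV (aV (aV \<alpha> z) (w [^] i)) g = aV (aV \<alpha> z) g" "aE (aE e (w [^] i)) g = aE e g"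
      using V.act_mult[OF \<alpha>V z(1) wi(1)[of i]] V.act_mult[OF \<alpha>V z(1) g]
        V.act_mult[OF \<alpha>z(1) wi(2)[of i] g] E.act_mult[OF e wi(2)[of i] g] by simp_all
    then have "aV (aV \<alpha> z) (w [^] i) = aV \<alpha> z" "aE e (w [^] i) = e"
      using V.act_inj[OF V.act_closed[OF \<alpha>z(1) wi(2)[of i]] \<alpha>z(1) g]
        E.act_inj[OF E.act_closed[OF e wi(2)[of i]] e g] by auto
    then show "w [^] i = \<one>" using arc_stab_trivial[OF wi(2)[of i] \<alpha>z] by blast
  qed
  then have "ord w = m" using ord_unique[OF w] by blast
  then show "walk_equiv (bwalk M ?h) (map (biro_seq g) [0..<2 * ord w])" "?n = 2 * ord w"
    using seq(1) m by simp_all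
qed

lemma biro_ord:
  assumes "aF F0 z = F0" "aF F1 z = F1"
  shows "ord w \<noteq> 0"
  using biro_walk(2)[OF assms one_closed] bwalk_ne[OF F.act_closed[OF F_faces(1) one_closed]]
  by (metis length_0_conv mult_0_right)

lemma BiRo_cycle_eq:
  assumes "g \<in> carrier G"
  shows "BiRo_cycle G a z g = map_walk \<phi>V \<phi>E (map (biro_seq g) [0..<2 * ord w])"
proof -
  have "\<phi>V (aV \<alpha> (z \<otimes> w [^] i \<otimes> g)) = generate G {a} #> (z \<otimes> w [^] i \<otimes> g)"
    "\<phi>V (aV \<alpha> (w [^] i \<otimes> g)) = generate G {a} #> (w [^] i \<otimes> g)"
    "\<phi>E (aE e (w [^] i \<otimes> g)) = generate G {z} #> (w [^] i \<otimes> g)"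
    "\<phi>E (aE e (a \<otimes> w [^] i \<otimes> g)) = generate G {z} #> (a \<otimes> w [^] i \<otimes> g)" for i :: nat
    using \<phi>V_act \<phi>E_act a z w assms by simp_all
  then show ?thesis
    unfolding BiRo_cycle_def Let_def concat_pairs map_walk_def map_map
    by (intro map_cong) (auto simp: biro_seq_def)
qed

text \<open>Faces of \<open>BiRoMap\<close> are classes of equivalent cycles, so different faces
  must have inequivalent cycles. They do, because equivalent cycles share a corner and a corner lies
  on only one face.\<close>

lemma biro_cycle_equiv_iff:
  assumes fx: "aF F0 z = F0" "aF F1 z = F1" and g: "g \<in> carrier G" and k: "k \<in> carrier G"
  shows "walk_equiv (BiRo_cycle G a z g) (BiRo_cycle G a z k) \<longleftrightarrow> aF F0 g = aF F0 k"
proof -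
  let ?m = "\<lambda>h. map_walk \<phi>V \<phi>E (bwalk M h)"
  have fin: "aF F0 g \<in> faces M" "aF F0 k \<in> faces M" using F.act_closed[OF F_faces(1)] g k by auto
  have ne: "?m h \<noteq> []" if "h \<in> faces M" for h using bwalk_ne[OF that] by (simp add: map_walk_def)
  have 1: "walk_equiv (?m (aF F0 g)) (BiRo_cycle G a z g)" if "g \<in> carrier G" for g
    unfolding BiRo_cycle_eq[OF that]
    using walk_equiv_map_walk[OF bwalk_ne[OF F.act_closed[OF F_faces(1) that]] biro_walk(1)[OF fx that]] .
  have 2: "BiRo_cycle G a z g \<noteq> []" if "g \<in> carrier G" for g
    using walk_equiv_length[OF 1[OF that]] ne[OF F.act_closed[OF F_faces(1) that]] by auto
  show ?thesis
  proof
    assume "walk_equiv (BiRo_cycle G a z g) (BiRo_cycle G a z k)"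
    then have mm: "walk_equiv (?m (aF F0 g)) (?m (aF F0 k))"
      using walk_equiv_trans[OF ne[OF fin(1)] walk_equiv_trans[OF ne[OF fin(1)] 1[OF g]]
          walk_equiv_sym[OF ne[OF fin(2)] 1[OF k]]] by blast
    have c: "is_corner M (aF F0 g) (aE e g) (aV \<alpha> g) (aE (aE e a) g)" using corner_act[OF corner_F0 g] .
    then have "corner_in (?m (aF F0 g)) (\<phi>E (aE e g)) (\<phi>V (aV \<alpha> g)) (\<phi>E (aE (aE e a) g))"
      unfolding corner_in_map_walk[OF bwalk_ne[OF fin(1)]] is_corner_def by blast
    then have "corner_in (?m (aF F0 k)) (\<phi>E (aE e g)) (\<phi>V (aV \<alpha> g)) (\<phi>E (aE (aE e a) g))"
      using corner_in_equiv[OF ne[OF fin(1)] mm] by blast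
    then obtain x v y where xvy: "corner_in (bwalk M (aF F0 k)) x v y" "\<phi>E (aE e g) = \<phi>E x"
        "\<phi>V (aV \<alpha> g) = \<phi>V v" "\<phi>E (aE (aE e a) g) = \<phi>E y"
      unfolding corner_in_map_walk[OF bwalk_ne[OF fin(2)]] by auto
    have "aE (aE e a) g = aE e (a \<otimes> g)" using E.act_mult[OF e a(1) g] .
    then have "x = aE e g" "v = aV \<alpha> g" "y = aE (aE e a) g"
      using xvy(2-4) E.transporter_inj[OF e] V.transporter_inj[OF \<alpha>V] g a by (metis m_closed)+
    then have "is_corner M (aF F0 k) (aE e g) (aV \<alpha> g) (aE (aE e a) g)"
      using xvy(1) fin(2) by (simp add: is_corner_def)
    then show "aF F0 g = aF F0 k" using corner_face_eq[OF c] by simp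
  next
    assume "aF F0 g = aF F0 k"
    then have "walk_equiv (?m (aF F0 g)) (BiRo_cycle G a z k)" using 1[OF k] by simp
    then show "walk_equiv (BiRo_cycle G a z g) (BiRo_cycle G a z k)"
      using walk_equiv_trans[OF 2[OF g] walk_equiv_sym[OF ne[OF fin(1)] 1[OF g]]] by blast
  qed
qed

lemma biro_iso:
  assumes fx: "aF F0 z = F0" "aF F1 z = F1"
  shows "map_iso M (BiRoMap G a z) \<phi>V \<phi>E (F.transporter F0)"
proof (rule map_isoI)
  \<comment> \<open>The set of elements representing one cycle is the transporter from
    \<open>F0\<close> to the corresponding face, so the face map needs no choice.\<close>
  have cls: "{h \<in> carrier G. walk_equiv (BiRo_cycle G a z g) (BiRo_cycle G a z h)} = F.transporter F0 (aF F0 g)"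
    if "g \<in> carrier G" for g
    using biro_cycle_equiv_iff[OF fx that] by (auto simp: F.transporter_def)
  have "inj_on (F.transporter F0) (faces M)"
    using F.bij_betw_transporter[OF F_faces(1) face_orbit(1)] by (simp add: bij_betw_def)
  moreover have "F.transporter F0 ` faces M = faces (BiRoMap G a z)"
  proof
    show "F.transporter F0 ` faces M \<subseteq> faces (BiRoMap G a z)"
    proof
      fix X assume "X \<in> F.transporter F0 ` faces M"
      then obtain g where "g \<in> carrier G" "X = F.transporter F0 (aF F0 g)" using face_orbit(1) by blast
      then show "X \<in> faces (BiRoMap G a z)" using cls by (auto simp: BiRoMap_def)
    qed
    show "faces (BiRoMap G a z) \<subseteq> F.transporter F0 ` faces M"
      using cls F.act_closed[OF F_faces(1)] by (auto simp: BiRoMap_def)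
  qed
  ultimately show "bij_betw (F.transporter F0) (faces M) (faces (BiRoMap G a z))"
    by (simp add: bij_betw_def)
  fix h assume h: "h \<in> faces M"
  define g where "g = rep (F.transporter F0 h)"
  have "\<exists>g. g \<in> F.transporter F0 h" using face_orbit(1)[OF h] by (auto simp: F.transporter_def)
  then have "g \<in> F.transporter F0 h" unfolding g_def rep_def by (rule someI_ex)
  then have g: "g \<in> carrier G" "aF F0 g = h" by (auto simp: F.transporter_def)
  have "bwalk (BiRoMap G a z) (F.transporter F0 h) = map_walk \<phi>V \<phi>E (map (biro_seq g) [0..<2 * ord w])"
    using BiRo_cycle_eq[OF g(1)] by (simp add: BiRoMap_def g_def)
  then show "\<exists>w. walk_equiv (bwalk M h) w \<and>
      bwalk (BiRoMap G a z) (F.transporter F0 h) = map_walk \<phi>V \<phi>E w"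
    using biro_walk(1)[OF fx g(1)] g(2) by blast
qed (simp_all add: BiRoMap_def)

text \<open>If \<open>a\<close> and \<open>z\<close> commute, the edge \<open>e\<close> and its images join \<open>\<alpha>\<close> to \<open>\<alpha>\<^sup>z\<close> only.\<close>
lemma not_commute:
  assumes "infinite (verts M) \<or> card (verts M) \<ge> 3"
  shows "a \<otimes> z \<noteq> z \<otimes> a"
proof
  assume c: "a \<otimes> z = z \<otimes> a"
  let ?S = "{\<alpha>, aV \<alpha> z}"
  have fa: "aV (aV \<alpha> z) a = aV \<alpha> z"
    using V.act_mult[OF \<alpha>V z(1) a(1)] V.act_mult[OF \<alpha>V a(1) z(1)] c a by simp
  have fa': "aV (aV \<alpha> z) (inv a) = aV \<alpha> z" using V.act_inv(1)[OF \<alpha>z(1) a(1)] fa by simp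
  have fz: "aV (aV \<alpha> z) z = \<alpha>" using V.act_inv(1)[OF \<alpha>V z(1)] inv_z by simp
  have az: "{a, z} \<subseteq> carrier G" using a z by simp
  \<comment> \<open>Both generators preserve the two ends of \<open>e\<close>, hence so does G, and
    vertex-transitivity leaves no further vertex.\<close>
  have "\<forall>v \<in> ?S. aV v g \<in> ?S" if "g \<in> generate G {a, z}" for g
    using that
  proof (induction rule: generate.induct)
    case one
    then show ?case using V.act_one \<alpha>V \<alpha>z by auto
  next
    case (incl h)
    then show ?case using fa fz a by auto
  next
    case (inv h)
    then show ?case using fa' fz \<alpha>_inv_a inv_z by auto
  next
    case (eng h1 h2)
    have "h1 \<in> carrier G" "h2 \<in> carrier G" using eng generate_in_carrier[OF az] by auto
    then have "aV v (h1 \<otimes> h2) = aV (aV v h1) h2" if "v \<in> ?S" for v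
      using V.act_mult \<alpha>V \<alpha>z(1) that by auto
    then show ?case using eng by metis
  qed
  then have "verts M \<subseteq> ?S" using vertex_image generates by (metis insertI1 subsetI)
  then have "finite (verts M)" "card (verts M) \<le> card ?S" by (auto intro: finite_subset card_mono)
  moreover have "card ?S \<le> 2" by (simp add: card_insert_if)
  ultimately show False using assms by simp
qed

text \<open>The stabiliser of \<open>F0\<close> contains \<open>z\<close> and \<open>z\<^sup>a\<close>, which induce distinct involutions on
its boundary, so the induced group is not cyclic.\<close>
lemma biro_not_face_rotary:
  assumes fx: "aF F0 z = F0" "aF F1 z = F1" and nc: "a \<otimes> z \<noteq> z \<otimes> a"
  shows "\<not> face_rotary M G aE aF"
proof
  assume "face_rotary M G aE aF"
  then obtain k where k: "k \<in> carrier G" "aF F0 k = F0" and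
    gen: "\<And>g. g \<in> stab G aF F0 \<Longrightarrow> \<exists>i::int. \<forall>x \<in> face_edges M F0. aE x g = aE x (k [^] i)"
    unfolding face_rotary_def induces_cyclic_def using F_faces(1) by (auto simp: stab_def)
  let ?X = "face_edges M F0"
  have eX: "e \<in> ?X" "aE e a \<in> ?X" using is_cornerD(5,6)[OF corner_F0] by auto
  have XE: "x \<in> edges M" if "x \<in> ?X" for x using face_edges_subset[OF F_faces(1)] that by blast
  have inv: "aE x g \<in> ?X" if "x \<in> ?X" "g \<in> carrier G" "aF F0 g = F0" for x g
    using face_edges_act[OF F_faces(1) that(1,2)] that(3) by simp
  have kp: "k [^] i \<in> carrier G" "aF F0 (k [^] i) = F0" for i :: int
    using k F.act_pow_fixed[OF F_faces(1) k] by auto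
  \<comment> \<open>Only the group induced on the boundary is assumed cyclic, so exponents are
    tested by their action on the boundary edges instead of by triviality in G.\<close>
  define P where "P i \<longleftrightarrow> (\<forall>x \<in> ?X. aE x (k [^] i) = x)" for i :: int
  obtain i :: int where i: "\<forall>x \<in> ?X. aE x z = aE x (k [^] i)"
    using gen[of z] z fx by (auto simp: stab_def)
  obtain j :: int where j: "\<forall>x \<in> ?X. aE x za = aE x (k [^] j)"
    using gen[of za] za za_F0[OF fx(2)] by (auto simp: stab_def)
  have add: "aE x (k [^] (m + n)) = aE (aE x (k [^] m)) (k [^] n)" if "x \<in> ?X" for x and m n :: int
    using E.act_mult[OF XE[OF that] kp(1) kp(1)] int_pow_mult[OF k(1)] by simp
  have diff: "P (m - n)" if "P m" "P n" for m n
    unfolding P_def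
  proof
    fix x assume x: "x \<in> ?X"
    then have "aE x (k [^] (m - n)) \<in> ?X" using inv kp by blast
    then have "aE x (k [^] (m - n)) = aE (aE x (k [^] (m - n))) (k [^] n)" using that(2) P_def by simp
    also have "\<dots> = aE x (k [^] m)" using add[OF x, of "m - n" n] by simp
    finally show "aE x (k [^] (m - n)) = x" using that(1) x P_def by simp
  qed
  have sq: "P (2 * m)" if g: "g \<in> carrier G" "aF F0 g = F0" "g \<otimes> g = \<one>"
    and m: "\<forall>x \<in> ?X. aE x g = aE x (k [^] m)" for g m
    unfolding P_def
  proof
    fix x assume x: "x \<in> ?X"
    have "aE x (k [^] (2 * m)) = aE (aE x (k [^] m)) (k [^] m)" using add[OF x, of m m] by (simp only: mult_2)
    also have "\<dots> = aE (aE x g) g" using m x inv[OF x g(1,2)] by simp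
    also have "\<dots> = x" using E.act_mult[OF XE[OF x] g(1) g(1)] g(3) E.act_one[OF XE[OF x]] by simp
    finally show "aE x (k [^] (2 * m)) = x" .
  qed
  \<comment> \<open>If \<open>za\<close> fixed \<open>e\<close> it would be trivial, forcing
    \<open>z\<close> to be trivial, or equal to \<open>z\<close>, forcing \<open>a\<close> and
    \<open>z\<close> to commute.\<close>
  have za_e: "aE e za \<noteq> e"
  proof
    assume "aE e za = e"
    then have "za = \<one> \<or> za = z" using stab_e_eq za by blast
    then have "a \<otimes> za = a \<or> a \<otimes> za = a \<otimes> z" using a by auto
    then have "z \<otimes> a = a" using a_za nc by auto
    then have "z = \<one>" using a z by (metis r_cancel_one)
    then show False using z_ne by simp
  qed
  \<comment> \<open>If \<open>z\<close> fixed the neighbouring edge, the conjugate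
    \<open>a \<otimes> z \<otimes> inv a\<close> would fix \<open>e\<close>, with the same two
    outcomes.\<close>
  have "aE (aE e a) z \<noteq> aE e a"
  proof
    assume "aE (aE e a) z = aE e a"
    then have "aE e (a \<otimes> z \<otimes> inv a) = e"
      using E.act_mult[OF e a(1) z(1)] E.act_eq_iff[OF e _ a(1), of "a \<otimes> z"] a z by simp
    then have "a \<otimes> z \<otimes> inv a = \<one> \<or> a \<otimes> z \<otimes> inv a = z" using stab_e_eq a z by simp
    then have "a \<otimes> z = a \<or> a \<otimes> z = z \<otimes> a"
      using a z by (metis inv_solve_right l_one m_closed one_closed)
    then show False using nc a z z_ne by (metis l_cancel_one)
  qed
  then have "\<not> P i" using i eX P_def by metis
  moreover have "\<not> P j" using j eX za_e P_def by metis
  ultimately have "P (i - j)"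
    using int_subgroup_unique_involution[of P i j] diff sq[OF z(1) fx(1) zz i]
      sq[OF za za_F0[OF fx(2)] za_za j] by blast
  \<comment> \<open>By uniqueness of the involution \<open>z\<close> and \<open>za\<close> act alike
    on the boundary, although \<open>z\<close> fixes \<open>e\<close> and \<open>za\<close> does
    not.\<close>
  have "e = aE e (k [^] i)" using i eX z by metis
  also have "\<dots> = aE (aE e (k [^] (i - j))) (k [^] j)" using add[OF eX(1), of "i - j" j] by simp
  also have "\<dots> = aE e za" using \<open>P (i - j)\<close> eX j P_def by simp
  finally show False using za_e by simp
qed

lemma biro_length:
  assumes "aF F0 z = F0" "aF F1 z = F1" "h \<in> faces M"
  shows "length (bwalk M h) = 2 * ord w"
  using biro_walk(2)[OF assms(1,2)] face_orbit(1)[OF assms(3)] by auto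

end

section \<open>Assembly of the rotary and bi-rotary cases\<close>

theorem mainTheorem16:
  fixes M :: "('v, 'e, 'f) pmap"
    and G :: "('g, 'b) monoid_scheme"
    and aV :: "'v \<Rightarrow> 'g \<Rightarrow> 'v" and aE :: "'e \<Rightarrow> 'g \<Rightarrow> 'e" and aF :: "'f \<Rightarrow> 'g \<Rightarrow> 'f"
    and \<alpha> :: 'v and e :: 'e and f f' :: 'f
  assumes map: "is_map M"
    and V3: "infinite (verts M) \<or> card (verts M) \<ge> 3"
    and F3: "infinite (faces M) \<or> card (faces M) \<ge> 3"
    and vrot: "vertex_rotary M G aV aE aF"
    and arc: "e \<in> edges M" "\<alpha> \<in> ends M e"
    and faces_e: "f \<noteq> f'" "{h \<in> faces M. e \<in> face_edges M h} = {f, f'}"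
  shows
    "(\<exists>z. stab G aE e = generate G {z} \<and> group.ord G z = 2) \<and>
     (\<exists>a. stab G aV \<alpha> = generate G {a} \<and> rot_step M aE \<alpha> e a \<and> aF f a = f') \<and>
     (\<forall>a z. stab G aV \<alpha> = generate G {a} \<and> rot_step M aE \<alpha> e a \<and> aF f a = f' \<and>
            stab G aE e = generate G {z} \<and> group.ord G z = 2 \<longrightarrow>
        group.ord G a = card (edges_at M \<alpha>) \<and> card (edges_at M \<alpha>) \<ge> 3 \<and>
        (\<forall>\<beta> \<in> nbrs M \<alpha>. card (edges_at M \<alpha>) =
             card (nbrs M \<alpha>) * card {x \<in> edges M. ends M x = {\<alpha>, \<beta>}}) \<and>
        rotary_pair G a z \<and>
        (\<exists>\<phi>V \<phi>E. cos_identification M G aV aE \<alpha> e a z \<phi>V \<phi>E) \<and>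
        ((aF f z = f' \<and> aF f' z = f) \<or> (aF f z = f \<and> aF f' z = f')) \<and>
        (aF f z = f' \<and> aF f' z = f \<longrightarrow>
           group.ord G (a \<otimes>\<^bsub>G\<^esub> z) \<noteq> 0 \<and>
           is_map (RotaMap G a z) \<and>
           (\<exists>\<phi>V \<phi>E \<phi>F. cos_identification M G aV aE \<alpha> e a z \<phi>V \<phi>E \<and>
                       map_iso M (RotaMap G a z) \<phi>V \<phi>E \<phi>F) \<and>
           G_rotary M G aV aE aF \<and>
           (\<forall>h \<in> faces M. length (bwalk M h) = group.ord G (a \<otimes>\<^bsub>G\<^esub> z))) \<and>
        (aF f z = f \<and> aF f' z = f' \<longrightarrow>
           group.ord G (z \<otimes>\<^bsub>G\<^esub> conj_by G z a) \<noteq> 0 \<and>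
           is_map (BiRoMap G a z) \<and>
           (\<exists>\<phi>V \<phi>E \<phi>F. cos_identification M G aV aE \<alpha> e a z \<phi>V \<phi>E \<and>
                       map_iso M (BiRoMap G a z) \<phi>V \<phi>E \<phi>F) \<and>
           G_birotary M G aV aE aF \<and>
           (\<forall>h \<in> faces M. length (bwalk M h) = 2 * group.ord G (z \<otimes>\<^bsub>G\<^esub> conj_by G z a))))"
proof -
  have aut: "aut_action M G aV aE aF" and at: "arc_transitive M G aV aE"
    and ct: "\<And>v. v \<in> verts M \<Longrightarrow> induces_cyclic G aE (stab G aV v) (edges_at M v)"
      "\<And>v. v \<in> verts M \<Longrightarrow> induces_transitive aE (stab G aV v) (edges_at M v)"
    using vrot unfolding vertex_rotary_def by auto
  have "group G" using aut unfolding aut_action_def by (rule conjunct1)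
  interpret rotary_action M G aV aE aF \<alpha> e f f'
    by (intro rotary_action.intro map_action.intro surface_map.intro map_action_axioms.intro
        rotary_action_axioms.intro) (fact map \<open>group G\<close> aut at ct F3 arc faces_e)+
  show ?thesis
  proof (intro conjI allI impI; (elim conjE)?)
    show "\<exists>z. stab G aE e = generate G {z} \<and> group.ord G z = 2" by (rule edge_stab_generator)
    show "\<exists>a. stab G aV \<alpha> = generate G {a} \<and> rot_step M aE \<alpha> e a \<and> aF f a = f'"
      by (rule vertex_stab_generator)
    fix a z
    assume "stab G aV \<alpha> = generate G {a}" "rot_step M aE \<alpha> e a"
      "stab G aE e = generate G {z}" "group.ord G z = 2"
    then interpret rotation_generator M G aV aE aF \<alpha> e f f' a z by unfold_locales
    show "group.ord G a = card (edges_at M \<alpha>)" by (rule ord_a)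
    show "card (edges_at M \<alpha>) \<ge> 3" by (rule valency_ge_3[OF \<alpha>V])
    show "\<forall>\<beta> \<in> nbrs M \<alpha>. card (edges_at M \<alpha>) =
             card (nbrs M \<alpha>) * card {x \<in> edges M. ends M x = {\<alpha>, \<beta>}}"
      using multiplicity by blast
    show "rotary_pair G a z" by (rule rotary_pair)
    show "\<exists>\<phi>V \<phi>E. cos_identification M G aV aE \<alpha> e a z \<phi>V \<phi>E" using cos_identification by blast
    show "(aF f z = f' \<and> aF f' z = f) \<or> (aF f z = f \<and> aF f' z = f')" by (rule z_faces)
    {
      assume "aF f z = f'" "aF f' z = f"
      \<comment> \<open>\<open>F_eq\<close> is an equality of unordered pairs; that \<open>z\<close>
        interchanges the two faces is symmetric in them and so passes from \<open>f\<close>,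
        \<open>f'\<close> to \<open>F0\<close>, \<open>F1\<close>.\<close>
      then have swap: "aF F0 z = F1" using F_eq F0_neq_F1 by (auto simp: doubleton_eq_iff)
      show "group.ord G (a \<otimes>\<^bsub>G\<^esub> z) \<noteq> 0" by (rule rota_ord[OF swap])
      show "is_map (RotaMap G a z)" by (rule map_iso_is_map[OF map rota_iso[OF swap]])
      show "\<exists>\<phi>V \<phi>E \<phi>F. cos_identification M G aV aE \<alpha> e a z \<phi>V \<phi>E \<and>
                       map_iso M (RotaMap G a z) \<phi>V \<phi>E \<phi>F"
        using cos_identification rota_iso[OF swap] by blast
      show "G_rotary M G aV aE aF"
        unfolding G_rotary_def using vrot rota_face_rotary[OF swap] by blast
      show "\<forall>h \<in> faces M. length (bwalk M h) = group.ord G (a \<otimes>\<^bsub>G\<^esub> z)"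
        using rota_length[OF swap] by blast
    }
    assume "aF f z = f" "aF f' z = f'"
    then have fx: "aF F0 z = F0" "aF F1 z = F1" using F_eq by (auto simp: doubleton_eq_iff)
    show "group.ord G (z \<otimes>\<^bsub>G\<^esub> conj_by G z a) \<noteq> 0" by (rule biro_ord[OF fx])
    show "is_map (BiRoMap G a z)" by (rule map_iso_is_map[OF map biro_iso[OF fx]])
    show "\<exists>\<phi>V \<phi>E \<phi>F. cos_identification M G aV aE \<alpha> e a z \<phi>V \<phi>E \<and>
                     map_iso M (BiRoMap G a z) \<phi>V \<phi>E \<phi>F"
      using cos_identification biro_iso[OF fx] by blast
    show "G_birotary M G aV aE aF"
      unfolding G_birotary_def using vrot biro_not_face_rotary[OF fx not_commute[OF V3]] by blast
    show "\<forall>h \<in> faces M. length (bwalk M h) = 2 * group.ord G (z \<otimes>\<^bsub>G\<^esub> conj_by G z a)"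
      using biro_length[OF fx] by blast
  qed
qed

end
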